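(* Let $(V_\lambda)_{\lambda\in\mathbb{C}}$ be a family of linear subspaces of $\mathbb{C}[z]$ such that each $V_\lambda$ is $\lambda$-primary and $V_\lambda=\mathbb{C}[z]$ for all but finitely many $\lambda$. Let $k_\lambda$ be the codimension of $V_\lambda$ in $\mathbb{C}[z]$, and let $$W=\prod_{\lambda}(z-\lambda)^{-k_\lambda}\,\bigcap_{\lambda}V_\lambda\subset\mathbb{C}(z)$$ be the corresponding point of the adelic Grassmannian $\mathrm{Gr}^{\mathrm{ad}}$. Let $n$ be the non-negative integer associated to $W$, that is, the index of the Calogero-Moser space $\mathcal{C}_n$ containing $\beta^{-1}(W)$, where $\beta:\bigsqcup_{m\ge 0}\mathcal{C}_m\to\mathrm{Gr}^{\mathrm{ad}}$ is the natural bijection described in the context. Then $$n=\sum_{\lambda\in\mathbb{C}}n_\lambda ,$$ where $n_\lambda$ depends only on $V_\lambda$ (and is zero if $V_\lambda=\mathbb{C}[z]$) and is calculated as follows. Let $$r_0<r_1<r_2<\cdots$$ be the numbers $r$ such that $V_\lambda$ contains a polynomial that vanishes exactly to order $r$ at $\lambda$. For large $i$ we have $r_i=g+i$, where $g$ is the number of gaps (non-negative integers that do not occur) in this sequence. Then $$n_\lambda=\sum_{i\ge 0}(g+i-r_i).$$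
   Context: A linear subspace $V_\lambda\subseteq\mathbb{C}[z]$ is called $\lambda$-primary if $(z-\lambda)^N\mathbb{C}[z]\subseteq V_\lambda$ for some $N$. The adelic Grassmannian $\mathrm{Gr}^{\mathrm{ad}}$ is the set of all $W\subset\mathbb{C}(z)$ obtained from families $(V_\lambda)$ as in the claim. For $m\ge 0$, the Calogero-Moser space $\mathcal{C}_m$ is the quotient, by simultaneous conjugation by $\mathrm{GL}(m,\mathbb{C})$, of the space of pairs $(X,Y)$ of complex $m\times m$ matrices such that $[X,Y]+I$ has rank $1$; $\mathcal{C}_0$ is a point. The natural bijection $\beta$ is obtained by passing through ideals of the first Weyl algebra $A=\mathbb{C}[z,\partial]$, $\partial=d/dz$. Let $\mathcal{R}$ be the set of isomorphism classes of nonzero right ideals of $A$ (equivalently, of finitely generated torsion-free rank 1 right $A$-modules). There is a bijection $\alpha:\mathrm{Gr}^{\mathrm{ad}}\to\mathcal{R}$ sending $W$ to the class of the fractional right ideal $\{D\in\mathbb{C}(z)[\partial]: D.\mathbb{C}[z]\subseteq W\}$, where the dot denotes the natural action of differential operators on functions. There is also a bijection $\bigsqcup_{m\ge0}\mathcal{C}_m\to\mathcal{R}$ sending $(X,Y)\in\mathcal{C}_m$ to the class of the fractional right ideal $$\det(Y-zI)\,A+\kappa\det(X-\partial I)\,A\subset\mathbb{C}(z)[\partial],\qquad \kappa:=1-w(Y-zI)^{-1}(X-\partial I)^{-1}v,$$ where $v$ and $w$ are a column and a row vector with $[X,Y]+I=vw$ (and $\kappa$ lies in the quotient field of $A$); the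 point $\mathcal{C}_0$ goes to the class of $A$. The bijection $\beta$ is the composite of this second bijection with $\alpha^{-1}$. *)

theory Defs
  imports
    "HOL-Library.Infinite_Set"
    "HOL-Computational_Algebra.Computational_Algebra"
    "Jordan_Normal_Form.DL_Rank"
begin

section \<open>Rational functions and their derivative\<close>

type_synonym ratfun = "complex poly fract"

instance fract :: ("{idom, ring_char_0}") field_char_0
proof
  show "inj (of_nat :: nat \<Rightarrow> 'a fract)"
    by (rule injI) (simp add: of_nat_fract eq_fract)
qed

definition rderiv :: "ratfun \<Rightarrow> ratfun"
  where "rderiv f = (THE g. \<exists>a b. b \<noteq> 0 \<and> f = Fract a b \<and> g = Fract (pderiv a * b - a * pderiv b) (b * b))"

lemma rderiv_Fract:
  assumes b: "b \<noteq> 0"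
  shows "rderiv (Fract a b) = Fract (pderiv a * b - a * pderiv b) (b * b)"
  unfolding rderiv_def
proof (rule the_equality)
  show "\<exists>a' b'. b' \<noteq> 0 \<and> Fract a b = Fract a' b' \<and>
      Fract (pderiv a * b - a * pderiv b) (b * b) = Fract (pderiv a' * b' - a' * pderiv b') (b' * b')"
    using b by blast
next
  fix g
  assume "\<exists>c d. d \<noteq> 0 \<and> Fract a b = Fract c d \<and> g = Fract (pderiv c * d - c * pderiv d) (d * d)"
  then obtain c d where d: "d \<noteq> 0" and eq: "a * d = c * b"
    and g: "g = Fract (pderiv c * d - c * pderiv d) (d * d)"
    using b by (auto simp: eq_fract)
  have "pderiv (a * d) = pderiv (c * b)" by (simp add: eq)
  then have e2: "d * pderiv a = c * pderiv b + b * pderiv c - a * pderiv d"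
    by (simp add: pderiv_mult algebra_simps)
  have "(pderiv a * b - a * pderiv b) * (d * d)
      = (d * pderiv a) * (b * d) - (a * d) * (pderiv b * d)"
    by (simp add: algebra_simps)
  also have "\<dots> = (c * pderiv b + b * pderiv c - a * pderiv d) * (b * d) - (c * b) * (pderiv b * d)"
    by (simp only: e2 eq)
  also have "\<dots> = b * pderiv c * (b * d) - (a * d) * (pderiv d * b)"
    by (simp add: algebra_simps)
  also have "\<dots> = (pderiv c * d - c * pderiv d) * (b * b)"
    unfolding eq by (simp add: algebra_simps)
  finally show "g = Fract (pderiv a * b - a * pderiv b) (b * b)"
    using b d by (simp add: g eq_fract)
qed

lemma rderiv_to_fract: "rderiv (to_fract p) = to_fract (pderiv p)"
  by (simp add: to_fract_def rderiv_Fract)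

lemma rderiv_add: "rderiv (f + g) = rderiv f + rderiv g"
  by (cases f, cases g) (simp add: rderiv_Fract eq_fract pderiv_add pderiv_mult algebra_simps)

lemma rderiv_mult: "rderiv (f * g) = rderiv f * g + f * rderiv g"
  by (cases f, cases g) (simp add: rderiv_Fract eq_fract pderiv_add pderiv_mult algebra_simps)

lemma rderiv_0 [simp]: "rderiv 0 = 0"
  using rderiv_add[of 0 0] by simp

lemma rderiv_1 [simp]: "rderiv 1 = 0"
  using rderiv_mult[of 1 1] by simp

abbreviation rderivs :: "nat \<Rightarrow> ratfun \<Rightarrow> ratfun"
  where "rderivs k \<equiv> rderiv ^^ k"

lemma rderivs_add: "rderivs k (f + g) = rderivs k f + rderivs k g"
  by (induction k) (simp_all add: rderiv_add)

lemma rderivs_0 [simp]: "rderivs k 0 = 0"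
  by (induction k) simp_all

lemma rderivs_sum: "rderivs k (sum h A) = (\<Sum>x\<in>A. rderivs k (h x))"
  by (induction A rule: infinite_finite_induct) (simp_all add: rderivs_add)

lemma rderivs_1: "rderivs k 1 = (if k = 0 then 1 else 0)"
  by (induction k) auto

lemma rderiv_of_nat [simp]: "rderiv (of_nat n) = 0"
  by (induction n) (simp_all add: rderiv_add)

lemma rderiv_minus: "rderiv (- f) = - rderiv f"
  using rderiv_add[of f "- f"] by (simp add: eq_neg_iff_add_eq_0 add.commute)

lemma rderiv_const_quot:
  assumes "rderiv d = 0" "rderiv c = 0" shows "rderiv (c / d) = 0"
proof (cases "d = 0")
  case False
  then have "rderiv c = rderiv ((c / d) * d)" by simp
  also have "\<dots> = rderiv (c / d) * d"
    unfolding rderiv_mult using assms(1) by simp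
  finally show ?thesis using False assms(2) by simp
qed simp

lemma rderiv_prod_0:
  "(\<And>x. x \<in> A \<Longrightarrow> rderiv (h x) = 0) \<Longrightarrow> rderiv (prod h A) = 0"
  by (induction A rule: infinite_finite_induct) (simp_all add: rderiv_mult)

lemma rderiv_of_int [simp]: "rderiv (of_int n) = 0"
  by (cases n rule: int_cases2) (simp_all add: rderiv_minus)

lemma rderiv_gbinomial [simp]: "rderiv (of_int i gchoose k) = 0"
proof -
  have "rderiv (\<Prod>j = 0..<k. of_int i - of_nat j :: ratfun) = 0"
  proof (rule rderiv_prod_0)
    fix j
    have "(of_int i - of_nat j :: ratfun) = of_int (i - int j)" by simp
    then show "rderiv (of_int i - of_nat j :: ratfun) = 0" by (metis rderiv_of_int)
  qed
  moreover have "rderiv (fact k :: ratfun) = 0"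
    by (metis of_nat_fact rderiv_of_nat)
  ultimately show ?thesis
    unfolding gbinomial_prod_rev by (rule rderiv_const_quot[rotated])
qed

lemma rderivs_const_mult:
  "rderiv c = 0 \<Longrightarrow> rderivs k (c * f) = c * rderivs k f"
  by (induction k) (simp_all add: rderiv_mult)

lemma rderivs_mult:
  "rderivs p (f * g) = (\<Sum>q\<le>p. of_nat (p choose q) * rderivs q f * rderivs (p - q) g)"
proof (induction p)
  case (Suc p)
  have 1: "rderiv (of_nat (p choose q) * rderivs q f * rderivs (p - q) g)
      = of_nat (p choose q) * rderivs (Suc q) f * rderivs (p - q) g
        + of_nat (p choose q) * rderivs q f * rderivs (Suc (p - q)) g" for q
    by (simp add: rderiv_mult algebra_simps)
  have sum_rd: "rderiv (sum h A) = (\<Sum>x\<in>A. rderiv (h x))" for h :: "nat \<Rightarrow> ratfun" and A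
    using rderivs_sum[of 1 h A] by simp
  have L: "rderivs (Suc p) (f * g) = (\<Sum>q\<le>p. of_nat (p choose q) * rderivs (Suc q) f * rderivs (p - q) g)
     + (\<Sum>q\<le>p. of_nat (p choose q) * rderivs q f * rderivs (Suc (p - q)) g)"
    by (simp only: funpow.simps comp_def Suc sum_rd 1 sum.distrib)
  have "(\<Sum>q\<le>Suc p. of_nat (Suc p choose q) * rderivs q f * rderivs (Suc p - q) g)
     = f * rderivs (Suc p) g
       + (\<Sum>q\<le>p. of_nat (Suc p choose Suc q) * rderivs (Suc q) f * rderivs (p - q) g)"
    by (subst sum.atMost_Suc_shift) simp
  also have "(\<Sum>q\<le>p. of_nat (Suc p choose Suc q) * rderivs (Suc q) f * rderivs (p - q) g)
     = (\<Sum>q\<le>p. of_nat (p choose q) * rderivs (Suc q) f * rderivs (p - q) g)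
     + (\<Sum>q\<le>p. of_nat (p choose Suc q) * rderivs (Suc q) f * rderivs (p - q) g)"
    unfolding sum.distrib[symmetric] by (rule sum.cong) (simp_all only: binomial_Suc_Suc of_nat_add distrib_right)
  also have "f * rderivs (Suc p) g + (\<dots>) = (\<Sum>q\<le>p. of_nat (p choose q) * rderivs (Suc q) f * rderivs (p - q) g)
     + (f * rderivs (Suc p) g + (\<Sum>q\<le>p. of_nat (p choose Suc q) * rderivs (Suc q) f * rderivs (p - q) g))"
    by (simp only: ac_simps)
  also have "f * rderivs (Suc p) g + (\<Sum>q\<le>p. of_nat (p choose Suc q) * rderivs (Suc q) f * rderivs (p - q) g)
     = (\<Sum>q\<le>Suc p. of_nat (p choose q) * rderivs q f * rderivs (Suc p - q) g)"
    by (subst sum.atMost_Suc_shift) simp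
  also have "\<dots> = (\<Sum>q\<le>p. of_nat (p choose q) * rderivs q f * rderivs (Suc (p - q)) g)"
    by (simp add: Suc_diff_le del: funpow.simps)
  finally show ?case using L by simp
qed simp

section \<open>Formal pseudo-differential operators over the rational functions\<close>

text \<open>
  An operator is the formal sum over \<open>i\<close> of \<open>coeff i \<cdot> \<partial>\<^sup>i\<close>, bounded in the positive direction.
  The product is the one determined by
  \<open>\<partial>\<^sup>i \<cdot> f = (\<Sum>k\<ge>0. (i gchoose k) f\<^bsup>(k)\<^esup> \<partial>\<^bsup>i-k\<^esup>)\<close>, for all integers \<open>i\<close>. The resulting ring is a skew
  field, so it contains the quotient field of the Weyl algebra.
\<close>

typedef pdo = "{a :: int \<Rightarrow> ratfun. \<exists>N. \<forall>i>N. a i = 0}"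
  morphisms pcoeff Abs_pdo
  by (rule exI[of _ "\<lambda>_. 0"]) simp

setup_lifting type_definition_pdo

lemma pdo_eqI: "(\<And>i. pcoeff P i = pcoeff Q i) \<Longrightarrow> P = Q"
  by transfer auto

lemma pcoeff_bounded: obtains N where "\<And>i. i > N \<Longrightarrow> pcoeff P i = 0"
  using pcoeff[of P] by auto

definition pterm :: "(int \<Rightarrow> ratfun) \<Rightarrow> (int \<Rightarrow> ratfun) \<Rightarrow> int \<Rightarrow> int \<Rightarrow> int \<Rightarrow> ratfun"
  where "pterm a b n i j =
    (if n \<le> i + j then (of_int i gchoose nat (i + j - n)) * a i * rderivs (nat (i + j - n)) (b j) else 0)"

text \<open>
  The coefficient of \<open>\<partial>\<^sup>n\<close> in a product; \<open>pterm a b n i j\<close> is the contribution of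
  \<open>(a i \<partial>\<^sup>i) (b j \<partial>\<^sup>j)\<close>. For \<open>a\<close> and \<open>b\<close> bounded above the index set is finite.
\<close>

definition pmult :: "(int \<Rightarrow> ratfun) \<Rightarrow> (int \<Rightarrow> ratfun) \<Rightarrow> int \<Rightarrow> ratfun"
  where "pmult a b n = (\<Sum>(i, j) \<in> {(i, j). a i \<noteq> 0 \<and> b j \<noteq> 0 \<and> n \<le> i + j}. pterm a b n i j)"

lemma pterm_eq_0: "a i = 0 \<or> b j = 0 \<or> i + j < n \<Longrightarrow> pterm a b n i j = 0"
  by (auto simp: pterm_def)

lemma pmult_box:
  assumes a: "\<And>i. i > N \<Longrightarrow> a i = 0" and b: "\<And>j. j > M \<Longrightarrow> b j = 0"
    and I: "finite I" "{n - M..N} \<subseteq> I" and J: "finite J" "{n - N..M} \<subseteq> J"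
  shows "pmult a b n = (\<Sum>i\<in>I. \<Sum>j\<in>J. pterm a b n i j)"
proof -
  let ?S = "{(i, j). a i \<noteq> 0 \<and> b j \<noteq> 0 \<and> n \<le> i + j}"
  have sub: "?S \<subseteq> I \<times> J"
  proof safe
    fix i j assume *: "a i \<noteq> 0" "b j \<noteq> 0" "n \<le> i + j"
    then have "i \<le> N" "j \<le> M" using a b by (meson not_le)+
    with * have "i \<in> {n - M..N}" "j \<in> {n - N..M}" by auto
    with I J show "i \<in> I" "j \<in> J" by auto
  qed
  have "pmult a b n = (\<Sum>(i, j)\<in>I \<times> J. pterm a b n i j)"
    unfolding pmult_def
    by (rule sum.mono_neutral_left) (use I J sub in \<open>auto simp: pterm_def split: if_splits\<close>)
  then show ?thesis by (simp add: sum.cartesian_product)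
qed

lemma pmult_bounded:
  assumes a: "\<And>i. i > N \<Longrightarrow> a i = 0" and b: "\<And>j. j > M \<Longrightarrow> b j = 0" and "n > N + M"
  shows "pmult a b n = 0"
proof -
  have "a i = 0 \<or> b j = 0 \<or> i + j < n" for i j
    using assms by (meson add_mono le_less_trans not_le)
  then have "pterm a b n i j = 0" for i j using pterm_eq_0 by metis
  then show ?thesis by (simp add: pmult_def)
qed

lemma gbinomial_int_Vandermonde:
  "(\<Sum>r=0..m. (of_int (i - int q) gchoose r) * (of_int j gchoose (m - r)))
    = (of_int (i + j - int q) gchoose m :: ratfun)"
  using gbinomial_Vandermonde[of "of_int (i - int q) :: ratfun" "of_int j" m]
  by (simp add: algebra_simps)

lemma pterm_assoc:
  assumes B: "i \<le> H" "j \<le> H" "l \<le> H" "n \<le> i + j + l"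
    and S: "finite S" "{n - H..2 * H} \<subseteq> S"
  shows "(\<Sum>s\<in>S. pterm (\<lambda>s. pterm a b s i j) c n s l)
       = (\<Sum>t\<in>S. pterm a (\<lambda>t. pterm b c t j l) n i t)"
proof -
  define T where "T = nat (i + j + l - n)"
  have T: "int T = i + j + l - n" using B by (simp add: T_def)
  define G where "G q = (of_int i gchoose q) * (of_int (i + j - int q) gchoose (T - q))
     * a i * rderivs q (b j) * rderivs (T - q) (c l)" for q
  have L: "(\<Sum>s\<in>S. pterm (\<lambda>s. pterm a b s i j) c n s l) = (\<Sum>q\<le>T. G q)"
  proof -
    have "(\<Sum>s\<in>S. pterm (\<lambda>s. pterm a b s i j) c n s l)
        = (\<Sum>s\<in>{n - l..i + j}. pterm (\<lambda>s. pterm a b s i j) c n s l)"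
      by (rule sum.mono_neutral_right) (use B S in \<open>auto simp: pterm_def\<close>)
    also have "\<dots> = (\<Sum>q\<le>T. G q)"
    proof (rule sum.reindex_bij_witness[of _ "\<lambda>q. i + j - int q" "\<lambda>s. nat (i + j - s)"])
      fix s assume s: "s \<in> {n - l..i + j}"
      show "i + j - int (nat (i + j - s)) = s" using s by simp
      show "nat (i + j - s) \<in> {..T}" using s T by auto
      have "nat (s + l - n) = T - nat (i + j - s)" using s T by auto
      then show "G (nat (i + j - s)) = pterm (\<lambda>s. pterm a b s i j) c n s l"
        using s by (simp add: G_def pterm_def)
    next
      fix q assume q: "q \<in> {..T}"
      then show "nat (i + j - (i + j - int q)) = q" by simp
      have "int q \<le> int T" using q by simp
      then show "i + j - int q \<in> {n - l..i + j}" using T by auto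
    qed
    finally show ?thesis .
  qed
  define F where "F p q = (of_int i gchoose p) * (of_int j gchoose (T - p)) * of_nat (p choose q)
     * a i * rderivs q (b j) * rderivs (T - q) (c l)" for p q
  have "(\<Sum>t\<in>S. pterm a (\<lambda>t. pterm b c t j l) n i t)
      = (\<Sum>t\<in>{n - i..j + l}. pterm a (\<lambda>t. pterm b c t j l) n i t)"
    by (rule sum.mono_neutral_right) (use B S in \<open>auto simp: pterm_def\<close>)
  also have "\<dots> = (\<Sum>p\<le>T. \<Sum>q\<le>p. F p q)"
  proof (rule sum.reindex_bij_witness[of _ "\<lambda>p. n - i + int p" "\<lambda>t. nat (t + i - n)"])
    fix t assume t: "t \<in> {n - i..j + l}"
    show "n - i + int (nat (t + i - n)) = t" using t by simp
    show "nat (t + i - n) \<in> {..T}" using t T by auto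
    define p where "p = nat (t + i - n)"
    have p: "nat (j + l - t) = T - p" "nat (i + t - n) = p" "p \<le> T" using t T by (auto simp: p_def)
    have "pterm a (\<lambda>t. pterm b c t j l) n i t
       = (of_int i gchoose p) * a i * rderivs p ((of_int j gchoose (T - p)) * (b j * rderivs (T - p) (c l)))"
      using t p by (simp add: pterm_def mult.assoc)
    also have "\<dots> = (of_int i gchoose p) * a i * ((of_int j gchoose (T - p)) *
        (\<Sum>q\<le>p. of_nat (p choose q) * rderivs q (b j) * rderivs (p - q) (rderivs (T - p) (c l))))"
      by (simp only: rderivs_const_mult[OF rderiv_gbinomial] rderivs_mult[of p "b j"])
    also have "\<dots> = (\<Sum>q\<le>p. F p q)"
      unfolding sum_distrib_left
    proof (rule sum.cong)
      fix q assume "q \<in> {..p}"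
      then have "p - q + (T - p) = T - q" using p by auto
      then have "rderivs (p - q) (rderivs (T - p) (c l)) = rderivs (T - q) (c l)"
        by (metis comp_apply funpow_add)
      then show "(of_int i gchoose p) * a i * ((of_int j gchoose (T - p)) *
         (of_nat (p choose q) * rderivs q (b j) * rderivs (p - q) (rderivs (T - p) (c l)))) = F p q"
        by (simp add: F_def ac_simps)
    qed simp
    finally show "(\<Sum>q\<le>nat (t + i - n). F (nat (t + i - n)) q) = pterm a (\<lambda>t. pterm b c t j l) n i t"
      by (simp add: p_def)
  next
    fix p assume p: "p \<in> {..T}"
    then show "nat (n - i + int p + i - n) = p" by simp
    have "int p \<le> int T" using p by simp
    then show "n - i + int p \<in> {n - i..j + l}" using T by auto
  qed
  also have "\<dots> = (\<Sum>(p, q)\<in>(SIGMA p:{..T}. {..p}). F p q)"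
    by (rule sum.Sigma) auto
  also have "\<dots> = (\<Sum>(q, r)\<in>(SIGMA q:{..T}. {0..T - q}). F (q + r) q)"
    by (rule sum.reindex_bij_witness[of _ "\<lambda>(q, r). (q + r, q)" "\<lambda>(p, q). (q, p - q)"]) auto
  also have "\<dots> = (\<Sum>q\<le>T. \<Sum>r=0..T - q. F (q + r) q)"
    by (rule sum.Sigma[symmetric]) auto
  also have "\<dots> = (\<Sum>q\<le>T. G q)"
  proof (rule sum.cong)
    fix q
    have "F (q + r) q = (of_int i gchoose q) * a i * rderivs q (b j) * rderivs (T - q) (c l)
        * ((of_int (i - int q) gchoose r) * (of_int j gchoose (T - q - r)))" for r
    proof -
      have "(of_int i gchoose (q + r)) * (of_nat ((q + r) choose q) :: ratfun)
          = (of_int i gchoose q) * (of_int (i - int q) gchoose r)"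
        using gbinomial_trinomial_revision[of q "q + r" "of_int i :: ratfun"]
        by (simp add: binomial_gbinomial)
      moreover have "F (q + r) q = ((of_int i gchoose (q + r)) * of_nat ((q + r) choose q))
          * ((of_int j gchoose (T - q - r)) * a i * rderivs q (b j) * rderivs (T - q) (c l))"
        by (simp add: F_def ac_simps)
      ultimately show ?thesis by (simp only: ac_simps)
    qed
    then show "(\<Sum>r=0..T - q. F (q + r) q) = G q"
      unfolding G_def by (simp only: sum_distrib_left[symmetric] gbinomial_int_Vandermonde) (simp only: ac_simps)
  qed simp
  finally show ?thesis using L by simp
qed

lemma pterm_sum_left:
  "pterm (\<lambda>s. \<Sum>x\<in>A. f x s) c n i j = (\<Sum>x\<in>A. pterm (f x) c n i j)"
  by (simp add: pterm_def sum_distrib_left sum_distrib_right)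

lemma pterm_sum_right:
  "pterm a (\<lambda>t. \<Sum>x\<in>A. f x t) n i j = (\<Sum>x\<in>A. pterm a (f x) n i j)"
  by (simp add: pterm_def sum_distrib_left rderivs_sum)

lemma pterm_cong: "a i = a' i \<Longrightarrow> b j = b' j \<Longrightarrow> pterm a b n i j = pterm a' b' n i j"
  by (simp add: pterm_def)

lemma pmult_assoc:
  assumes "\<exists>N. \<forall>i>N. a i = 0" "\<exists>N. \<forall>i>N. b i = 0" "\<exists>N. \<forall>i>N. c i = 0"
  shows "pmult (pmult a b) c = pmult a (pmult b c)"
proof
  fix n
  obtain N1 N2 N3 where N: "\<And>i. i > N1 \<Longrightarrow> a i = 0" "\<And>i. i > N2 \<Longrightarrow> b i = 0" "\<And>i. i > N3 \<Longrightarrow> c i = 0"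
    using assms by metis
  define H where "H = max 0 (max N1 (max N2 N3))"
  have H: "\<And>i. i > H \<Longrightarrow> a i = 0" "\<And>i. i > H \<Longrightarrow> b i = 0" "\<And>i. i > H \<Longrightarrow> c i = 0" "H \<ge> 0"
    using N by (auto simp: H_def)
  have H2: "\<And>i. i > 2 * H \<Longrightarrow> pmult a b i = 0" "\<And>i. i > 2 * H \<Longrightarrow> pmult b c i = 0"
    by (rule pmult_bounded[where N = H and M = H]; use H in auto)+
  define I where "I = {n - 2 * H..H}"
  define S where "S = {n - H..2 * H}"
  have fin: "finite I" "finite S" by (auto simp: I_def S_def)
  have *: "(\<Sum>s\<in>S. pterm (\<lambda>s. pterm a b s i j) c n s l) = (\<Sum>t\<in>S. pterm a (\<lambda>t. pterm b c t j l) n i t)"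
    if "i \<in> I" "j \<in> I" "l \<in> I" for i j l
  proof (cases "n \<le> i + j + l")
    case True
    then show ?thesis using that fin by (intro pterm_assoc[of _ H]) (auto simp: I_def S_def)
  next
    case False
    then have "pterm (\<lambda>s. pterm a b s i j) c n s l = 0" "pterm a (\<lambda>t. pterm b c t j l) n i s = 0" for s
      by (auto simp: pterm_def)
    then show ?thesis by simp
  qed
  have "pmult (pmult a b) c n = (\<Sum>s\<in>S. \<Sum>l\<in>I. pterm (pmult a b) c n s l)"
    using H H2 fin by (intro pmult_box[of "2 * H" _ H]) (auto simp: I_def S_def)
  also have "\<dots> = (\<Sum>s\<in>S. \<Sum>l\<in>I. \<Sum>i\<in>I. \<Sum>j\<in>I. pterm (\<lambda>s. pterm a b s i j) c n s l)"
  proof (intro sum.cong refl)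
    fix s l assume s: "s \<in> S"
    have "pmult a b s = (\<Sum>i\<in>I. \<Sum>j\<in>I. pterm a b s i j)"
      using H fin s by (intro pmult_box[of H _ H]) (auto simp: I_def S_def)
    then have "pterm (pmult a b) c n s l = pterm (\<lambda>s. \<Sum>i\<in>I. \<Sum>j\<in>I. pterm a b s i j) c n s l"
      by (intro pterm_cong) auto
    then show "pterm (pmult a b) c n s l = (\<Sum>i\<in>I. \<Sum>j\<in>I. pterm (\<lambda>s. pterm a b s i j) c n s l)"
      by (simp add: pterm_sum_left)
  qed
  also have "\<dots> = (\<Sum>i\<in>I. \<Sum>j\<in>I. \<Sum>l\<in>I. \<Sum>s\<in>S. pterm (\<lambda>s. pterm a b s i j) c n s l)"
  proof -
    have "(\<Sum>s\<in>S. \<Sum>l\<in>I. \<Sum>i\<in>I. \<Sum>j\<in>I. pterm (\<lambda>s. pterm a b s i j) c n s l)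
        = (\<Sum>l\<in>I. \<Sum>s\<in>S. \<Sum>i\<in>I. \<Sum>j\<in>I. pterm (\<lambda>s. pterm a b s i j) c n s l)"
      by (rule sum.swap)
    also have "\<dots> = (\<Sum>l\<in>I. \<Sum>i\<in>I. \<Sum>j\<in>I. \<Sum>s\<in>S. pterm (\<lambda>s. pterm a b s i j) c n s l)"
    proof (rule sum.cong[OF refl])
      fix l
      have "(\<Sum>s\<in>S. \<Sum>i\<in>I. \<Sum>j\<in>I. pterm (\<lambda>s. pterm a b s i j) c n s l)
          = (\<Sum>i\<in>I. \<Sum>s\<in>S. \<Sum>j\<in>I. pterm (\<lambda>s. pterm a b s i j) c n s l)"
        by (rule sum.swap)
      also have "\<dots> = (\<Sum>i\<in>I. \<Sum>j\<in>I. \<Sum>s\<in>S. pterm (\<lambda>s. pterm a b s i j) c n s l)"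
        by (rule sum.cong[OF refl], rule sum.swap)
      finally show "(\<Sum>s\<in>S. \<Sum>i\<in>I. \<Sum>j\<in>I. pterm (\<lambda>s. pterm a b s i j) c n s l)
          = (\<Sum>i\<in>I. \<Sum>j\<in>I. \<Sum>s\<in>S. pterm (\<lambda>s. pterm a b s i j) c n s l)" .
    qed
    also have "\<dots> = (\<Sum>i\<in>I. \<Sum>j\<in>I. \<Sum>l\<in>I. \<Sum>s\<in>S. pterm (\<lambda>s. pterm a b s i j) c n s l)"
    proof -
      have "(\<Sum>l\<in>I. \<Sum>i\<in>I. \<Sum>j\<in>I. \<Sum>s\<in>S. pterm (\<lambda>s. pterm a b s i j) c n s l)
          = (\<Sum>i\<in>I. \<Sum>l\<in>I. \<Sum>j\<in>I. \<Sum>s\<in>S. pterm (\<lambda>s. pterm a b s i j) c n s l)"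
        by (rule sum.swap)
      also have "\<dots> = (\<Sum>i\<in>I. \<Sum>j\<in>I. \<Sum>l\<in>I. \<Sum>s\<in>S. pterm (\<lambda>s. pterm a b s i j) c n s l)"
        by (rule sum.cong[OF refl], rule sum.swap)
      finally show ?thesis .
    qed
    finally show ?thesis .
  qed
  also have "\<dots> = (\<Sum>i\<in>I. \<Sum>j\<in>I. \<Sum>l\<in>I. \<Sum>t\<in>S. pterm a (\<lambda>t. pterm b c t j l) n i t)"
    by (intro sum.cong refl *)
  also have "\<dots> = (\<Sum>i\<in>I. \<Sum>t\<in>S. \<Sum>j\<in>I. \<Sum>l\<in>I. pterm a (\<lambda>t. pterm b c t j l) n i t)"
  proof (rule sum.cong[OF refl])
    fix i
    have "(\<Sum>j\<in>I. \<Sum>l\<in>I. \<Sum>t\<in>S. pterm a (\<lambda>t. pterm b c t j l) n i t)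
        = (\<Sum>j\<in>I. \<Sum>t\<in>S. \<Sum>l\<in>I. pterm a (\<lambda>t. pterm b c t j l) n i t)"
      by (rule sum.cong[OF refl], rule sum.swap)
    also have "\<dots> = (\<Sum>t\<in>S. \<Sum>j\<in>I. \<Sum>l\<in>I. pterm a (\<lambda>t. pterm b c t j l) n i t)"
      by (rule sum.swap)
    finally show "(\<Sum>j\<in>I. \<Sum>l\<in>I. \<Sum>t\<in>S. pterm a (\<lambda>t. pterm b c t j l) n i t)
        = (\<Sum>t\<in>S. \<Sum>j\<in>I. \<Sum>l\<in>I. pterm a (\<lambda>t. pterm b c t j l) n i t)" .
  qed
  also have "\<dots> = (\<Sum>i\<in>I. \<Sum>t\<in>S. pterm a (pmult b c) n i t)"
  proof (intro sum.cong refl)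
    fix i t assume t: "t \<in> S"
    have "pmult b c t = (\<Sum>j\<in>I. \<Sum>l\<in>I. pterm b c t j l)"
      using H fin t by (intro pmult_box[of H _ H]) (auto simp: I_def S_def)
    then have "pterm a (pmult b c) n i t = pterm a (\<lambda>t. \<Sum>j\<in>I. \<Sum>l\<in>I. pterm b c t j l) n i t"
      by (intro pterm_cong) auto
    then show "(\<Sum>j\<in>I. \<Sum>l\<in>I. pterm a (\<lambda>t. pterm b c t j l) n i t) = pterm a (pmult b c) n i t"
      by (simp add: pterm_sum_right)
  qed
  also have "\<dots> = pmult a (pmult b c) n"
    using H H2 fin by (intro pmult_box[of H _ "2 * H", symmetric]) (auto simp: I_def S_def)
  finally show "pmult (pmult a b) c n = pmult a (pmult b c) n" .
qed

lemma pmult_add_left: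
  assumes "\<exists>N. \<forall>i>N. a i = 0" "\<exists>N. \<forall>i>N. b i = 0" "\<exists>N. \<forall>i>N. c i = 0"
  shows "pmult (\<lambda>i. a i + b i) c n = pmult a c n + pmult b c n"
proof -
  obtain N1 N2 N3 where N: "\<And>i. i > N1 \<Longrightarrow> a i = 0" "\<And>i. i > N2 \<Longrightarrow> b i = 0" "\<And>i. i > N3 \<Longrightarrow> c i = 0"
    using assms by metis
  define H where "H = max N1 (max N2 N3)"
  have H: "\<And>i. i > H \<Longrightarrow> a i = 0" "\<And>i. i > H \<Longrightarrow> b i = 0" "\<And>i. i > H \<Longrightarrow> c i = 0"
    using N by (auto simp: H_def)
  have "pterm (\<lambda>i. a i + b i) c n i j = pterm a c n i j + pterm b c n i j" for i j
    by (simp add: pterm_def algebra_simps)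
  then show ?thesis
    using H by (simp add: pmult_box[of H _ H _ "{n - H..H}" n "{n - H..H}"] sum.distrib)
qed

lemma pmult_add_right:
  assumes "\<exists>N. \<forall>i>N. a i = 0" "\<exists>N. \<forall>i>N. b i = 0" "\<exists>N. \<forall>i>N. c i = 0"
  shows "pmult a (\<lambda>i. b i + c i) n = pmult a b n + pmult a c n"
proof -
  obtain N1 N2 N3 where N: "\<And>i. i > N1 \<Longrightarrow> a i = 0" "\<And>i. i > N2 \<Longrightarrow> b i = 0" "\<And>i. i > N3 \<Longrightarrow> c i = 0"
    using assms by metis
  define H where "H = max N1 (max N2 N3)"
  have H: "\<And>i. i > H \<Longrightarrow> a i = 0" "\<And>i. i > H \<Longrightarrow> b i = 0" "\<And>i. i > H \<Longrightarrow> c i = 0"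
    using N by (auto simp: H_def)
  have "pterm a (\<lambda>i. b i + c i) n i j = pterm a b n i j + pterm a c n i j" for i j
    by (simp add: pterm_def rderivs_add algebra_simps)
  then show ?thesis
    using H by (simp add: pmult_box[of H _ H _ "{n - H..H}" n "{n - H..H}"] sum.distrib)
qed

lemma pmult_one_left:
  assumes "\<exists>N. \<forall>i>N. b i = 0"
  shows "pmult (\<lambda>i. if i = 0 then 1 else 0) b n = b n"
proof -
  let ?e = "\<lambda>i::int. if i = 0 then 1 else (0::ratfun)"
  obtain M where M: "\<And>i. i > M \<Longrightarrow> b i = 0" using assms by blast
  let ?I = "insert 0 {n - M..0}" and ?J = "insert n {n..M}"
  have "pmult ?e b n = (\<Sum>i\<in>?I. \<Sum>j\<in>?J. pterm ?e b n i j)"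
    by (rule pmult_box[of 0 _ M]) (use M in auto)
  also have "\<dots> = (\<Sum>i\<in>?I. if i = 0 then \<Sum>j\<in>?J. if j = n then b n else 0 else 0)"
  proof (rule sum.cong[OF refl])
    fix i
    have "pterm ?e b n i j = (if i = 0 then if j = n then b n else 0 else 0)" for j
      by (auto simp: pterm_def gbinomial_0_left)
    then show "(\<Sum>j\<in>?J. pterm ?e b n i j) = (if i = 0 then \<Sum>j\<in>?J. if j = n then b n else 0 else 0)"
      by simp
  qed
  also have "\<dots> = (\<Sum>j\<in>?J. if j = n then b n else 0)"
    by (subst sum.delta) simp_all
  also have "\<dots> = b n"
    by (subst sum.delta) simp_all
  finally show ?thesis .
qed

lemma pmult_one_right:
  assumes "\<exists>N. \<forall>i>N. a i = 0"
  shows "pmult a (\<lambda>i. if i = 0 then 1 else 0) n = a n"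
proof -
  let ?e = "\<lambda>i::int. if i = 0 then 1 else (0::ratfun)"
  obtain M where M: "\<And>i. i > M \<Longrightarrow> a i = 0" using assms by blast
  let ?I = "insert n {n..M}" and ?J = "insert 0 {n - M..0}"
  have "pmult a ?e n = (\<Sum>i\<in>?I. \<Sum>j\<in>?J. pterm a ?e n i j)"
    by (rule pmult_box[of M _ 0]) (use M in auto)
  also have "\<dots> = (\<Sum>i\<in>?I. \<Sum>j\<in>?J. if j = 0 then if i = n then a n else 0 else 0)"
    by (intro sum.cong refl) (auto simp: pterm_def rderivs_1)
  also have "\<dots> = (\<Sum>i\<in>?I. if i = n then a n else 0)"
    by (intro sum.cong refl, subst sum.delta) simp_all
  also have "\<dots> = a n"
    by (subst sum.delta) simp_all
  finally show ?thesis .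
qed

lemma pcoeff_bdd: "\<exists>N. \<forall>i>N. pcoeff P i = 0"
  using pcoeff[of P] by simp

instantiation pdo :: ring_1
begin

lift_definition zero_pdo :: pdo is "\<lambda>_. 0" by simp

lift_definition one_pdo :: pdo is "\<lambda>i. if i = 0 then 1 else 0"
  by (rule exI[of _ 0]) simp

lift_definition plus_pdo :: "pdo \<Rightarrow> pdo \<Rightarrow> pdo" is "\<lambda>a b i. a i + b i"
proof -
  fix a b :: "int \<Rightarrow> ratfun"
  assume "\<exists>N. \<forall>i>N. a i = 0" "\<exists>N. \<forall>i>N. b i = 0"
  then obtain N M where "\<forall>i>N. a i = 0" "\<forall>i>M. b i = 0" by blast
  then show "\<exists>N. \<forall>i>N. a i + b i = 0" by (intro exI[of _ "max N M"]) simp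
qed

lift_definition uminus_pdo :: "pdo \<Rightarrow> pdo" is "\<lambda>a i. - a i" by simp

definition minus_pdo :: "pdo \<Rightarrow> pdo \<Rightarrow> pdo" where "minus_pdo P Q = P + - Q"

lift_definition times_pdo :: "pdo \<Rightarrow> pdo \<Rightarrow> pdo" is pmult
proof -
  fix a b :: "int \<Rightarrow> ratfun"
  assume "\<exists>N. \<forall>i>N. a i = 0" "\<exists>N. \<forall>i>N. b i = 0"
  then obtain N M where "\<And>i. i > N \<Longrightarrow> a i = 0" "\<And>i. i > M \<Longrightarrow> b i = 0" by blast
  then have "\<forall>i>N + M. pmult a b i = 0" using pmult_bounded[of N a M b] by auto
  then show "\<exists>N. \<forall>i>N. pmult a b i = 0" ..
qed

instance
proof
  fix a b c :: pdo
  note coeffs = zero_pdo.rep_eq one_pdo.rep_eq plus_pdo.rep_eq uminus_pdo.rep_eq times_pdo.rep_eq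
  note bdd = pcoeff_bdd[of a] pcoeff_bdd[of b] pcoeff_bdd[of c]
  show "a * b * c = a * (b * c)"
    by (rule pdo_eqI) (simp only: coeffs pmult_assoc[OF bdd])
  show "a + b + c = a + (b + c)" by (rule pdo_eqI) (simp only: coeffs add.assoc)
  show "a + b = b + a" by (rule pdo_eqI) (simp only: coeffs add.commute)
  show "0 + a = a" by (rule pdo_eqI) (simp add: coeffs)
  show "- a + a = 0" by (rule pdo_eqI) (simp add: coeffs)
  show "a - b = a + - b" by (simp only: minus_pdo_def)
  show "(a + b) * c = a * c + b * c"
    by (rule pdo_eqI) (simp only: coeffs pmult_add_left[OF bdd])
  show "a * (b + c) = a * b + a * c"
    by (rule pdo_eqI) (simp only: coeffs pmult_add_right[OF bdd])
  show "1 * a = a" by (rule pdo_eqI) (simp only: coeffs pmult_one_left[OF bdd(1)])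
  show "a * 1 = a" by (rule pdo_eqI) (simp only: coeffs pmult_one_right[OF bdd(1)])
  have "pcoeff 0 0 \<noteq> pcoeff 1 0" by (simp add: coeffs)
  then show "(0::pdo) \<noteq> 1" by metis
qed

end

lemma course_of_values_ex:
  fixes H :: "(nat \<Rightarrow> 'b) \<Rightarrow> nat \<Rightarrow> 'b"
  assumes "\<And>f g m. (\<And>k. k < m \<Longrightarrow> f k = g k) \<Longrightarrow> H f m = H g m"
  shows "\<exists>f. \<forall>m. f m = H f m"
proof -
  have "adm_wf less_than H"
    unfolding adm_wf_def using assms by (metis less_than_iff)
  then have "wfrec less_than H = H (wfrec less_than H)"
    by (intro wfrec_fixpoint wf_less_than)
  then show ?thesis by metis
qed

lemma pdo_right_inverse_ex:
  assumes "P \<noteq> 0"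
  shows "\<exists>Q. P * Q = (1 :: pdo)"
proof -
  define a where "a = pcoeff P"
  have "\<exists>i. a i \<noteq> 0"
    using assms pdo_eqI[of P 0] by (auto simp: a_def zero_pdo.rep_eq)
  then obtain i0 where i0: "a i0 \<noteq> 0" by blast
  obtain M where M: "\<And>i. i > M \<Longrightarrow> a i = 0"
    using pcoeff_bdd[of P] by (auto simp: a_def)
  have "finite {i. i0 \<le> i \<and> a i \<noteq> 0}"
    by (rule finite_subset[of _ "{i0..M}"]) (use M in \<open>auto simp: not_less[symmetric]\<close>)
  moreover have "i0 \<in> {i. i0 \<le> i \<and> a i \<noteq> 0}" using i0 by simp
  ultimately obtain N where N: "a N \<noteq> 0" "\<And>i. i > N \<Longrightarrow> a i = 0"
  proof -
    let ?S = "{i. i0 \<le> i \<and> a i \<noteq> 0}"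
    assume fin: "finite ?S" and mem: "i0 \<in> ?S"
    have "Max ?S \<in> ?S" using fin mem by (intro Max_in) auto
    moreover have "a i = 0" if "i > Max ?S" for i
    proof (rule ccontr)
      assume "a i \<noteq> 0"
      moreover have "i0 \<le> i" using that Max_ge[OF fin mem] by simp
      ultimately have "i \<le> Max ?S" using fin by (intro Max_ge) auto
      then show False using that by simp
    qed
    ultimately show thesis using that by blast
  qed
  define b where "b f j = (if j \<le> - N then f (nat (- N - j)) else (0::ratfun))" for f j
  define R where "R f m = (\<Sum>i\<in>{N - int m..N}. \<Sum>j\<in>{- N - int m<..- N}. pterm a (b f) (- int m) i j)" for f m
  define H where "H f m = ((if m = 0 then 1 else 0) - R f m) / a N" for f m
  have "\<exists>f. \<forall>m. f m = H f m"
  proof (rule course_of_values_ex)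
    fix f g :: "nat \<Rightarrow> ratfun" and m
    assume fg: "\<And>k. k < m \<Longrightarrow> f k = g k"
    have "R f m = R g m"
      unfolding R_def
    proof (intro sum.cong refl pterm_cong)
      fix j assume "j \<in> {- N - int m<..- N}"
      then show "b f j = b g j" by (auto simp: b_def intro!: fg)
    qed
    then show "H f m = H g m" by (simp add: H_def)
  qed
  then obtain f where f: "\<And>m. f m = H f m" by blast
  have bb: "b f j = 0" if "j > - N" for j using that by (simp add: b_def)
  define Q where "Q = Abs_pdo (b f)"
  have Q: "pcoeff Q = b f" unfolding Q_def
    by (rule Abs_pdo_inverse) (use bb in blast)
  have "pmult a (b f) n = (if n = 0 then 1 else 0)" for n
  proof (cases "n > 0")
    case True
    then show ?thesis using pmult_bounded[of N a "- N" "b f" n] N bb by simp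
  next
    case False
    define m where "m = nat (- n)"
    have n: "n = - int m" using False by (simp add: m_def)
    have J: "{- N - int m..- N} = insert (- N - int m) {- N - int m<..- N}" by auto
    have 1: "pterm a (b f) n i (- N - int m) = (if i = N then a N * f m else 0)" if "i \<le> N" for i
      using that by (auto simp: pterm_def n b_def)
    have "pmult a (b f) n = (\<Sum>i\<in>{N - int m..N}. \<Sum>j\<in>{- N - int m..- N}. pterm a (b f) n i j)"
      by (rule pmult_box[of N _ "- N"]) (use N bb n in auto)
    also have "\<dots> = (\<Sum>i\<in>{N - int m..N}. pterm a (b f) n i (- N - int m)) + R f m"
      unfolding J R_def n by (simp add: sum.distrib)
    also have "(\<Sum>i\<in>{N - int m..N}. pterm a (b f) n i (- N - int m))
        = (\<Sum>i\<in>{N - int m..N}. if i = N then a N * f m else 0)"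
      by (rule sum.cong) (auto simp: 1)
    also have "\<dots> = a N * f m" by (subst sum.delta) auto
    also have "a N * f m = (if m = 0 then 1 else 0) - R f m"
      using N(1) by (subst f) (simp add: H_def)
    finally show ?thesis by (simp add: n)
  qed
  then have "P * Q = 1"
    by (intro pdo_eqI) (simp add: times_pdo.rep_eq one_pdo.rep_eq Q a_def)
  then show ?thesis ..
qed

instantiation pdo :: division_ring
begin

definition inverse_pdo :: "pdo \<Rightarrow> pdo"
  where "inverse_pdo P = (if P = 0 then 0 else SOME Q. P * Q = 1)"

definition divide_pdo :: "pdo \<Rightarrow> pdo \<Rightarrow> pdo"
  where "divide_pdo P Q = P * inverse Q"

instance
proof
  have right: "P * inverse P = 1" if "P \<noteq> 0" for P :: pdo
    using that someI_ex[OF pdo_right_inverse_ex] by (simp add: inverse_pdo_def)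
  fix P Q :: pdo
  show "P * inverse P = 1" if "P \<noteq> 0" using that by (rule right)
  show "inverse P * P = 1" if "P \<noteq> 0"
  proof -
    have PQ: "P * inverse P = 1" using that by (rule right)
    then have "inverse P \<noteq> 0" by auto
    then have S: "inverse P * inverse (inverse P) = 1" by (rule right)
    have "inverse P * P = inverse P * (P * inverse P) * inverse (inverse P)"
      by (simp only: mult.assoc S mult_1_right)
    then show ?thesis by (simp add: PQ S)
  qed
  show "P div Q = P * inverse Q" by (rule divide_pdo_def)
  show "inverse (0::pdo) = 0" by (simp add: inverse_pdo_def)
qed

end

definition pmonom :: "ratfun \<Rightarrow> int \<Rightarrow> pdo"
  where "pmonom f k = Abs_pdo (\<lambda>i. if i = k then f else 0)"

lemma pcoeff_pmonom: "pcoeff (pmonom f k) = (\<lambda>i. if i = k then f else 0)"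
  unfolding pmonom_def by (rule Abs_pdo_inverse) (auto intro: exI[of _ k])

definition pfun :: "ratfun \<Rightarrow> pdo" where "pfun f = pmonom f 0"

definition pconst :: "complex \<Rightarrow> pdo" where "pconst c = pfun (to_fract [:c:])"

definition pZ :: pdo where "pZ = pfun (to_fract [:0, 1:])"

definition pD :: pdo where "pD = pmonom 1 1"

lemma pmonom_mult_coeff:
  "pcoeff (pmonom f k * pmonom g l) n =
     (if n \<le> k + l then (of_int k gchoose nat (k + l - n)) * f * rderivs (nat (k + l - n)) g else 0)"
proof -
  have "pcoeff (pmonom f k * pmonom g l) n
      = (\<Sum>i\<in>insert k {n - l..k}. \<Sum>j\<in>insert l {n - k..l}.
           pterm (pcoeff (pmonom f k)) (pcoeff (pmonom g l)) n i j)"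
    unfolding times_pdo.rep_eq by (rule pmult_box[of k _ l]) (auto simp: pcoeff_pmonom)
  also have "\<dots> = (\<Sum>i\<in>insert k {n - l..k}. if i = k then
      \<Sum>j\<in>insert l {n - k..l}. if j = l then
        pterm (pcoeff (pmonom f k)) (pcoeff (pmonom g l)) n k l else 0 else 0)"
  proof (rule sum.cong[OF refl])
    fix i
    have "pterm (pcoeff (pmonom f k)) (pcoeff (pmonom g l)) n i j = (if i = k then if j = l then
        pterm (pcoeff (pmonom f k)) (pcoeff (pmonom g l)) n k l else 0 else 0)" for j
      by (auto simp: pterm_def pcoeff_pmonom)
    then show "(\<Sum>j\<in>insert l {n - k..l}. pterm (pcoeff (pmonom f k)) (pcoeff (pmonom g l)) n i j)
       = (if i = k then \<Sum>j\<in>insert l {n - k..l}. if j = l then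
        pterm (pcoeff (pmonom f k)) (pcoeff (pmonom g l)) n k l else 0 else 0)"
      by simp
  qed
  also have "\<dots> = (\<Sum>j\<in>insert l {n - k..l}. if j = l then
        pterm (pcoeff (pmonom f k)) (pcoeff (pmonom g l)) n k l else 0)"
    by (subst sum.delta) simp_all
  also have "\<dots> = pterm (pcoeff (pmonom f k)) (pcoeff (pmonom g l)) n k l"
    by (subst sum.delta) simp_all
  finally show ?thesis by (simp add: pterm_def pcoeff_pmonom)
qed

lemma pD_pfun: "pD * pfun f = pfun f * pD + pfun (rderiv f)"
proof (rule pdo_eqI)
  fix n :: int
  consider "n > 1" | "n = 1" | "n = 0" | "n < 0" by linarith
  then show "pcoeff (pD * pfun f) n = pcoeff (pfun f * pD + pfun (rderiv f)) n"
  proof cases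
    case 4
    then have "nat (1 - n) = Suc (Suc (nat (- 1 - n)))" by simp
    then obtain k where k: "nat (1 - n) = Suc (Suc k)" by blast
    have "(1 :: ratfun) gchoose Suc (Suc k) = 0"
      using of_nat_gbinomial[of 1 "Suc (Suc k)", where 'a = ratfun] by (simp add: gbinomial_binomial)
    with 4 k show ?thesis
      by (simp add: pD_def pfun_def plus_pdo.rep_eq pmonom_mult_coeff pcoeff_pmonom gbinomial_0_left)
  qed (simp_all add: pD_def pfun_def plus_pdo.rep_eq pmonom_mult_coeff pcoeff_pmonom gbinomial_0_left rderivs_1)
qed

section \<open>Differential operators and fractional ideals of the Weyl algebra\<close>

text \<open>\<open>\<complex>(z)[\<partial>]\<close> and \<open>A = \<complex>[z, \<partial>]\<close>, as subrings of the skew field above.\<close>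

definition diffops :: "pdo set"
  where "diffops = {P. \<forall>i<0. pcoeff P i = 0}"

definition weyl :: "pdo set"
  where "weyl = {P \<in> diffops. \<forall>i. pcoeff P i \<in> range to_fract}"

definition act :: "pdo \<Rightarrow> ratfun \<Rightarrow> ratfun"
  where "act P f = (\<Sum>i | pcoeff P (int i) \<noteq> 0. pcoeff P (int i) * rderivs i f)"

definition right_weyl_module :: "pdo set \<Rightarrow> bool"
  where "right_weyl_module M \<longleftrightarrow>
    0 \<in> M \<and> (\<forall>x\<in>M. \<forall>y\<in>M. x + y \<in> M) \<and> (\<forall>x\<in>M. \<forall>a\<in>weyl. x * a \<in> M)"

definition right_weyl_iso :: "pdo set \<Rightarrow> pdo set \<Rightarrow> bool"
  where "right_weyl_iso M N \<longleftrightarrow> (\<exists>\<phi>. bij_betw \<phi> M N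
    \<and> (\<forall>x\<in>M. \<forall>y\<in>M. \<phi> (x + y) = \<phi> x + \<phi> y) \<and> (\<forall>x\<in>M. \<forall>a\<in>weyl. \<phi> (x * a) = \<phi> x * a))"

definition iso_class :: "pdo set \<Rightarrow> pdo set set"
  where "iso_class M = {N. right_weyl_module N \<and> right_weyl_iso M N}"

section \<open>The adelic Grassmannian\<close>

interpretation cpoly: vector_space "Polynomial.smult :: complex \<Rightarrow> complex poly \<Rightarrow> complex poly"
  by unfold_locales (simp_all add: smult_add_right smult_add_left)

definition primary :: "complex \<Rightarrow> complex poly set \<Rightarrow> bool"
  where "primary l V \<longleftrightarrow> cpoly.subspace V \<and> (\<exists>N. \<forall>p. [:- l, 1:] ^ N * p \<in> V)"

text \<open>Codimension as the dimension of a complement; only used for subspaces of finite codimension.\<close>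

definition codim :: "complex poly set \<Rightarrow> nat"
  where "codim V = (THE d. \<exists>C. cpoly.subspace C \<and> V \<inter> C = {0}
     \<and> (\<forall>p. \<exists>u\<in>V. \<exists>c\<in>C. p = u + c) \<and> cpoly.dim C = d)"

definition adelic_point :: "(complex \<Rightarrow> complex poly set) \<Rightarrow> ratfun set"
  where "adelic_point V =
    (\<lambda>p. inverse (\<Prod>l | V l \<noteq> UNIV. to_fract [:- l, 1:] ^ codim (V l)) * to_fract p) ` (\<Inter>l. V l)"

definition Gr_ad :: "ratfun set set"
  where "Gr_ad = {adelic_point V | V. (\<forall>l. primary l (V l)) \<and> finite {l. V l \<noteq> UNIV}}"

definition alpha :: "ratfun set \<Rightarrow> pdo set set"
  where "alpha W = iso_class {P \<in> diffops. \<forall>p. act P (to_fract p) \<in> W}"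

section \<open>Calogero-Moser spaces and the bijection with the adelic Grassmannian\<close>

text \<open>The rank condition cannot hold for \<open>m = 0\<close>; \<open>\<C>\<^sub>0\<close> is a point by convention.\<close>

definition cm_pairs :: "nat \<Rightarrow> (complex mat \<times> complex mat) set"
  where "cm_pairs m = {(X, Y). X \<in> carrier_mat m m \<and> Y \<in> carrier_mat m m
     \<and> (m = 0 \<or> vec_space.rank m (X * Y - Y * X + 1\<^sub>m m) = 1)}"

definition conj_rel :: "nat \<Rightarrow> ((complex mat \<times> complex mat) \<times> (complex mat \<times> complex mat)) set"
  where "conj_rel m = {((X, Y), (X', Y')). (X, Y) \<in> cm_pairs m
     \<and> (\<exists>P Q. similar_mat_wit X' X P Q \<and> similar_mat_wit Y' Y P Q)}"

definition calogero_moser :: "nat \<Rightarrow> (complex mat \<times> complex mat) set set"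
  where "calogero_moser m = cm_pairs m // conj_rel m"

text \<open>\<open>det (M - t I)\<close> as a polynomial in \<open>t\<close>, evaluated at an operator.\<close>

definition shift_det :: "complex mat \<Rightarrow> complex poly"
  where "shift_det M = det (map_mat (\<lambda>c. [:c:]) M - [:0, 1:] \<cdot>\<^sub>m 1\<^sub>m (dim_row M))"

definition eval_at :: "complex poly \<Rightarrow> pdo \<Rightarrow> pdo"
  where "eval_at p T = (\<Sum>i\<le>Polynomial.degree p. pconst (Polynomial.coeff p i) * T ^ i)"

definition shift_mat :: "complex mat \<Rightarrow> pdo \<Rightarrow> pdo mat"
  where "shift_mat M T = map_mat pconst M - T \<cdot>\<^sub>m 1\<^sub>m (dim_row M)"

definition inv_mat :: "pdo mat \<Rightarrow> pdo mat"
  where "inv_mat M = (THE B. B \<in> carrier_mat (dim_row M) (dim_row M) \<and> inverts_mat M B \<and> inverts_mat B M)"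

definition kappa :: "complex mat \<Rightarrow> complex mat \<Rightarrow> complex mat \<Rightarrow> complex mat \<Rightarrow> pdo"
  where "kappa X Y v w = 1 - (map_mat pconst w * inv_mat (shift_mat Y pZ) * inv_mat (shift_mat X pD)
      * map_mat pconst v) $$ (0, 0)"

definition cm_ideal :: "complex mat \<Rightarrow> complex mat \<Rightarrow> complex mat \<Rightarrow> complex mat \<Rightarrow> pdo set"
  where "cm_ideal X Y v w =
    {eval_at (shift_det Y) pZ * a + kappa X Y v w * eval_at (shift_det X) pD * b | a b. a \<in> weyl \<and> b \<in> weyl}"

text \<open>
  The graph of \<open>\<beta>\<close>: the class attached to the conjugacy class \<open>c\<close> is \<open>\<alpha> W\<close>. For \<open>0 \<times> 0\<close> matrices
  both determinants and \<open>\<kappa>\<close> are \<open>1\<close>, and \<open>cm_ideal\<close> is \<open>A\<close>.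
\<close>

definition beta_graph :: "((complex mat \<times> complex mat) set \<times> ratfun set) set"
  where "beta_graph = {(c, W). W \<in> Gr_ad \<and> (\<exists>m. c \<in> calogero_moser m \<and> (\<exists>(X, Y) \<in> c. \<exists>v w.
      v \<in> carrier_mat m 1 \<and> w \<in> carrier_mat 1 m \<and> X * Y - Y * X + 1\<^sub>m m = v * w
      \<and> iso_class (cm_ideal X Y v w) = alpha W))}"

section \<open>The local contributions\<close>

definition vanishing_orders :: "complex \<Rightarrow> complex poly set \<Rightarrow> nat set"
  where "vanishing_orders l V = {r. \<exists>p\<in>V. p \<noteq> 0 \<and> Polynomial.order l p = r}"

definition vanishing_seq :: "complex \<Rightarrow> complex poly set \<Rightarrow> nat \<Rightarrow> nat"
  where "vanishing_seq l V = enumerate (vanishing_orders l V)"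

definition num_gaps :: "complex \<Rightarrow> complex poly set \<Rightarrow> nat"
  where "num_gaps l V = card (- vanishing_orders l V)"

text \<open>The sum over all \<open>i\<close>, restricted to its nonzero terms, with integer values to avoid truncation.\<close>

definition local_index :: "complex \<Rightarrow> complex poly set \<Rightarrow> int"
  where "local_index l V = (\<Sum>i | vanishing_seq l V i \<noteq> num_gaps l V + i.
      int (num_gaps l V) + int i - int (vanishing_seq l V i))"

end

theory Submission
  imports Defs "Jordan_Normal_Form.Char_Poly"
begin

text \<open>
  For a right submodule \<open>M\<close> of the skew field, the leading coefficients of its elements of order at most \<open>i\<close>
  form a fractional ideal \<open>L\<^sub>i(M)\<close> of \<open>\<complex>[z]\<close>, increasing in \<open>i\<close>. An isomorphism of fractional right ideals
  is left multiplication by some \<open>q\<close> (Ore condition), which only shifts the index and multiplies all \<open>L\<^sub>i\<close>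
  by the leading coefficient of \<open>q\<close>. Hence the total colength of the \<open>L\<^sub>i\<close> in their union is an invariant
  of the isomorphism class; it is computed on both sides.

  Calogero-Moser side: with \<open>U = Y - z\<close>, \<open>T = X - \<partial>\<close> one has \<open>TU - UT = vw\<close>, and the ideal of \<open>(X, Y)\<close> is the
  module of all \<open>a + w U\<^sup>-\<^sup>1 r\<close> with \<open>T r + v a \<in> U A\<^sup>n\<close>: it is contained in that module with finite codimension,
  and a nonzero \<open>A\<close>-module is infinite-dimensional. Reducing \<open>r\<close> modulo \<open>U A\<^sup>n\<close> to constant coefficients
  shows that its \<open>L\<^sub>i\<close> are those of the kernel of \<open>A \<rightarrow> \<complex>\<^sup>n\<close>, \<open>z\<^sup>j \<partial>\<^sup>i \<mapsto> X\<^sup>i Y\<^sup>j v\<close>. This map is onto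
  because \<open>v\<close> is cyclic, so the total colength is \<open>n\<close>.

  Grassmannian side: if \<open>z\<^sup>s q(z\<partial>) + \<dots>\<close> (lowest term at \<open>\<lambda> = 0\<close>) maps \<open>\<complex>[z]\<close> into \<open>V\<^sub>\<lambda>\<close>, then \<open>q(m) = 0\<close> whenever
  \<open>m + s\<close> is not a vanishing order, which bounds the degree of \<open>q\<close> below; conversely the higher terms
  can be found one after the other by interpolation. So the order of vanishing of \<open>L\<^sub>i\<close> at \<open>\<lambda>\<close> depends only on
  the gaps, and the sum over \<open>i\<close> is a count of pairs of a vanishing order below a gap.
\<close>

text \<open>The ideal arises from a three-term complex: \<open>c\<close> goes to
  \<open>(- w c, U c, T c)\<close>, and \<open>(a, r, s)\<close> goes to
  \<open>T r + v a - U s\<close>. The composite vanishes because \<open>T U - U T = v w\<close>, and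
  \<open>a + w U^-1 r\<close> kills the image of the first map; so \<open>r\<close> can be changed
  by \<open>U c\<close> if \<open>a\<close> is changed by \<open>w c\<close>. The generators are the
  solutions with \<open>r = 0\<close>, \<open>a = det U\<close> and with
  \<open>r = - adj(T) v\<close>, \<open>a = det T\<close>. The obstacle is that the functional
  sending \<open>z^j \<partial>^i\<close> to \<open>\<xi> X^i Y^j v\<close> is compatible with left
  multiplication by z, but with \<partial> only on constant coefficients, which the reduction modulo
  U provides. On the Grassmannian side \<open>z - \<lambda>\<close> has weight 1 and \<partial>
  weight -1: an operator of weight s multiplies the power m by a polynomial in m and raises the
  exponent by s. The leading ideals have different unions on the two sides: all of C[z] for the
  Calogero-Moser ideal, but for the other module the polynomials vanishing at each \<lambda> to the
  order given by the number of gaps. Hence only quotients of generators are compared.\<close>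

hide_const (open) Module.module.smult Coset.order

section \<open>Leading coefficients\<close>

text \<open>An upper bound on the order instead of the order itself: zero satisfies every bound and
  bounds survive sums, so cancelling top terms needs no case distinction.\<close>

definition ordle :: "pdo \<Rightarrow> int \<Rightarrow> bool"
  where "ordle P i \<longleftrightarrow> (\<forall>k>i. pcoeff P k = 0)"

lemma ordle_mono: "ordle P i \<Longrightarrow> i \<le> j \<Longrightarrow> ordle P j"
  by (simp add: ordle_def)

lemma ordle_ex: "\<exists>i. ordle P i"
  using pcoeff_bdd[of P] by (simp add: ordle_def)

lemma ordle_ex_nat: "\<exists>i::nat. ordle P (int i)"
proof -
  obtain i where "ordle P i" using ordle_ex by blast
  then have "ordle P (int (nat i))" by (rule ordle_mono) simp
  then show ?thesis ..
qed

lemma pcoeff_0 [simp]: "pcoeff 0 k = 0"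
  by (simp add: zero_pdo.rep_eq)

lemma pcoeff_add [simp]: "pcoeff (P + Q) k = pcoeff P k + pcoeff Q k"
  by (simp add: plus_pdo.rep_eq)

lemma pcoeff_uminus [simp]: "pcoeff (- P) k = - pcoeff P k"
  by (simp add: uminus_pdo.rep_eq)

lemma pcoeff_diff [simp]: "pcoeff (P - Q) k = pcoeff P k - pcoeff Q k"
  unfolding diff_conv_add_uminus by (simp del: add_uminus_conv_diff)

lemma pcoeff_sum [simp]: "pcoeff (sum f A) k = (\<Sum>x\<in>A. pcoeff (f x) k)"
  by (induction A rule: infinite_finite_induct) auto

lemma ordle_0 [simp]: "ordle 0 i" by (simp add: ordle_def)
lemma ordle_add: "ordle P i \<Longrightarrow> ordle Q i \<Longrightarrow> ordle (P + Q) i" by (simp add: ordle_def)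
lemma ordle_diff: "ordle P i \<Longrightarrow> ordle Q i \<Longrightarrow> ordle (P - Q) i" by (simp add: ordle_def)
lemma ordle_pred: "ordle P i \<Longrightarrow> pcoeff P i = 0 \<Longrightarrow> ordle P (i - 1)"
  unfolding ordle_def by (metis linorder_neqE zle_diff1_eq not_le)

lemma pcoeff_mult_top:
  assumes "ordle P i" "ordle Q j"
  shows "pcoeff (P * Q) (i + j) = pcoeff P i * pcoeff Q j"
proof -
  have "pcoeff (P * Q) (i + j) = (\<Sum>i\<in>{i}. \<Sum>k\<in>{j}. pterm (pcoeff P) (pcoeff Q) (i + j) i k)"
    unfolding times_pdo.rep_eq
    by (subst pmult_box[of i _ j _ "{i}" "i + j" "{j}"]) (use assms in \<open>auto simp: ordle_def\<close>)
  then show ?thesis by (simp add: pterm_def)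
qed

lemma ordle_mult: "ordle P i \<Longrightarrow> ordle Q j \<Longrightarrow> ordle (P * Q) (i + j)"
  unfolding ordle_def times_pdo.rep_eq by (auto intro!: pmult_bounded)

text \<open>Orders are bounded above only. If every bound could be improved by one, iterating would
  kill all coefficients.\<close>

lemma top_ex:
  assumes "P \<noteq> 0" shows "\<exists>i. ordle P i \<and> pcoeff P i \<noteq> 0"
proof (rule ccontr)
  assume *: "\<not> ?thesis"
  obtain i where i: "ordle P i" using ordle_ex by blast
  have "ordle P (i - int k)" for k
  proof (induction k)
    case (Suc k)
    then have "ordle P (i - int k - 1)" using * by (blast intro: ordle_pred)
    then show ?case by (simp add: algebra_simps)
  qed (use i in simp)
  then have ord: "ordle P (i - int (nat (i - k + 1)))" for k by blast
  have "pcoeff P k = 0" for k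
    using ord[of k] unfolding ordle_def by simp
  then show False using assms pdo_eqI[of P 0] by simp
qed

lemma pcoeff_pfun_mult [simp]: "pcoeff (pfun f * P) k = f * pcoeff P k"
proof -
  obtain M where M: "ordle P M" using ordle_ex by blast
  have "pcoeff (pfun f * P) k = (\<Sum>i\<in>{0}. \<Sum>j\<in>insert k {k..M}. pterm (pcoeff (pfun f)) (pcoeff P) k i j)"
  proof -
    have "pcoeff (pfun f * P) k = (\<Sum>i\<in>insert 0 {k-M..0}. \<Sum>j\<in>insert k {k..M}. pterm (pcoeff (pfun f)) (pcoeff P) k i j)"
      unfolding times_pdo.rep_eq
      by (rule pmult_box[of 0 _ M]) (use M in \<open>auto simp: ordle_def pfun_def pcoeff_pmonom\<close>)
    also have "\<dots> = (\<Sum>i\<in>{0}. \<Sum>j\<in>insert k {k..M}. pterm (pcoeff (pfun f)) (pcoeff P) k i j)"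
      by (rule sum.mono_neutral_right) (auto simp: pfun_def pcoeff_pmonom pterm_def)
    finally show ?thesis .
  qed
  also have "\<dots> = (\<Sum>j\<in>insert k {k..M}. if j = k then f * pcoeff P k else 0)"
    by (simp only: sum.insert[OF finite.emptyI empty_iff[THEN iffD1, THEN notI]] sum.empty)
       (rule trans[OF add.right_neutral sum.cong], auto simp: pterm_def pfun_def pcoeff_pmonom gbinomial_0_left)
  also have "\<dots> = f * pcoeff P k" by (subst sum.delta) auto
  finally show ?thesis .
qed

lemma pcoeff_pD: "pcoeff pD k = (if k = 1 then 1 else 0)"
  by (simp add: pD_def pcoeff_pmonom)

lemma pcoeff_mult_pD [simp]: "pcoeff (P * pD) k = pcoeff P (k - 1)"
proof -
  obtain M where M: "ordle P M" using ordle_ex by blast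
  have "pcoeff (P * pD) k = (\<Sum>i\<in>insert (k-1) {k-1..M}. \<Sum>j\<in>insert 1 {k-M..1}. pterm (pcoeff P) (pcoeff pD) k i j)"
      unfolding times_pdo.rep_eq
      by (rule pmult_box[of M _ 1]) (use M in \<open>auto simp: ordle_def pD_def pcoeff_pmonom\<close>)
  also have "\<dots> = (\<Sum>i\<in>insert (k-1) {k-1..M}. if i = k - 1 then pcoeff P (k-1) else 0)"
  proof (rule sum.cong[OF refl])
    fix i
    have pt: "pterm (pcoeff P) (pcoeff pD) k i j = (if j = 1 then (if i = k - 1 then pcoeff P (k-1) else 0) else 0)" for j
    proof (cases "j = 1")
      case True
      have "rderivs (nat (i + 1 - k)) 1 = 0" if "k < i + 1"
        using that by (subst rderivs_1) simp
      then show ?thesis using True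
        by (cases k "i + 1" rule: linorder_cases) (simp_all add: pterm_def pcoeff_pD del: funpow.simps)
    qed (simp add: pterm_eq_0 pcoeff_pD)
    have "(\<Sum>j\<in>insert 1 {k-M..1}. pterm (pcoeff P) (pcoeff pD) k i j)
      = (\<Sum>j\<in>insert 1 {k-M..1}. if j = 1 then (if i = k - 1 then pcoeff P (k-1) else 0) else 0)"
      by (rule sum.cong[OF refl pt])
    also have "\<dots> = (if i = k - 1 then pcoeff P (k-1) else 0)" by (subst sum.delta) auto
    finally show "(\<Sum>j\<in>insert 1 {k-M..1}. pterm (pcoeff P) (pcoeff pD) k i j) = \<dots>" .
  qed
  also have "\<dots> = pcoeff P (k-1)" by (subst sum.delta) auto
  finally show ?thesis .
qed

lemma pcoeff_mult_pD_power [simp]: "pcoeff (P * pD ^ m) k = pcoeff P (k - int m)"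
  by (induction m arbitrary: P) (simp_all add: mult.assoc[symmetric], simp add: algebra_simps)

lemma pfun_add: "pfun (f + g) = pfun f + pfun g"
  by (rule pdo_eqI) (simp add: pfun_def pcoeff_pmonom)

lemma pfun_0 [simp]: "pfun 0 = 0" by (rule pdo_eqI) (simp add: pfun_def pcoeff_pmonom)
lemma pfun_1 [simp]: "pfun 1 = 1" by (rule pdo_eqI) (simp add: pfun_def pcoeff_pmonom one_pdo.rep_eq)

lemma pfun_sum: "pfun (sum f A) = (\<Sum>k\<in>A. pfun (f k))"
  by (induction A rule: infinite_finite_induct) (auto simp: pfun_add)

lemma pcoeff_pfun: "pcoeff (pfun f) k = (if k = 0 then f else 0)"
  by (simp add: pfun_def pcoeff_pmonom)

lemma pfun_mult: "pfun (f * g) = pfun f * pfun g"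
  by (rule pdo_eqI) (simp add: pcoeff_pfun)

lemma pcoeff_1: "pcoeff 1 k = (if k = 0 then 1 else 0)" by (simp add: one_pdo.rep_eq)

text \<open>All derivatives of a constant vanish, so constants are central; this lets complex matrix
  entries be moved past any operator.\<close>

lemma pconst_commute: "pconst c * P = P * pconst c"
proof (rule pdo_eqI)
  fix k
  obtain M where M: "ordle P M" using ordle_ex by blast
  have r0: "rderivs m (to_fract [:c:]) = (if m = 0 then to_fract [:c:] else 0)" for m
    by (induction m) (auto simp: rderiv_to_fract)
  have "pcoeff (P * pconst c) k = (\<Sum>i\<in>insert k {k..M}. \<Sum>j\<in>insert 0 {k-M..0}. pterm (pcoeff P) (pcoeff (pconst c)) k i j)"
      unfolding times_pdo.rep_eq
      by (rule pmult_box[of M _ 0]) (use M in \<open>auto simp: ordle_def pconst_def pcoeff_pfun\<close>)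
  also have "\<dots> = (\<Sum>i\<in>insert k {k..M}. if i = k then pcoeff P k * to_fract [:c:] else 0)"
  proof (rule sum.cong[OF refl])
    fix i
    have "(\<Sum>j\<in>insert 0 {k-M..0}. pterm (pcoeff P) (pcoeff (pconst c)) k i j)
      = (\<Sum>j\<in>insert 0 {k-M..0}. if j = 0 then (if i = k then pcoeff P k * to_fract [:c:] else 0) else 0)"
      by (rule sum.cong) (auto simp: pterm_def pconst_def pcoeff_pfun r0)
    also have "\<dots> = (if i = k then pcoeff P k * to_fract [:c:] else 0)" by (subst sum.delta) auto
    finally show "(\<Sum>j\<in>insert 0 {k-M..0}. pterm (pcoeff P) (pcoeff (pconst c)) k i j) = \<dots>" .
  qed
  also have "\<dots> = pcoeff P k * to_fract [:c:]" by (subst sum.delta) auto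
  finally show "pcoeff (pconst c * P) k = pcoeff (P * pconst c) k"
    by (simp add: pconst_def mult.commute)
qed

lemma to_fract_pCons: "to_fract (pCons a p) = to_fract [:a:] + to_fract [:0,1:] * to_fract p"
  by (simp flip: to_fract_mult to_fract_add)

lemma pconst_0 [simp]: "pconst 0 = 0" by (simp add: pconst_def)
lemma pconst_1 [simp]: "pconst 1 = 1" by (simp add: pconst_def one_pCons[symmetric])
lemma pconst_add: "pconst (a + b) = pconst a + pconst b"
  by (simp add: pconst_def pfun_add[symmetric] to_fract_add[symmetric] del: to_fract_add)
lemma pconst_mult: "pconst (a * b) = pconst a * pconst b"
  by (simp add: pconst_def pfun_mult[symmetric] to_fract_mult[symmetric] mult.commute del: to_fract_mult)
lemma pconst_uminus: "pconst (- a) = - pconst a"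
  using pconst_add[of a "- a"] by (simp add: eq_neg_iff_add_eq_0 add.commute)
lemma pconst_diff: "pconst (a - b) = pconst a - pconst b"
  using pconst_add[of a "- b"] by (simp add: pconst_uminus)
lemma pconst_sum: "pconst (sum f A) = (\<Sum>x\<in>A. pconst (f x))"
  by (induction A rule: infinite_finite_induct) (auto simp: pconst_add)

lemma pD_pZ: "pD * pZ = pZ * pD + 1"
  unfolding pZ_def pD_pfun by (simp add: rderiv_to_fract pderiv_pCons one_pCons[symmetric])

section \<open>The Weyl algebra\<close>

lemma weyl_iff: "P \<in> weyl \<longleftrightarrow> (\<forall>i<0. pcoeff P i = 0) \<and> (\<forall>i. pcoeff P i \<in> range to_fract)"
  by (simp add: weyl_def diffops_def)

lemma range_to_fract_closed:
  "f \<in> range to_fract \<Longrightarrow> g \<in> range to_fract \<Longrightarrow> f + g \<in> range (to_fract :: complex poly \<Rightarrow> _)"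
  "f \<in> range to_fract \<Longrightarrow> g \<in> range to_fract \<Longrightarrow> f * g \<in> range (to_fract :: complex poly \<Rightarrow> _)"
  "f \<in> range to_fract \<Longrightarrow> - f \<in> range (to_fract :: complex poly \<Rightarrow> _)"
  "0 \<in> range (to_fract :: complex poly \<Rightarrow> _)" "1 \<in> range (to_fract :: complex poly \<Rightarrow> _)"
  "f \<in> range to_fract \<Longrightarrow> rderiv f \<in> range (to_fract :: complex poly \<Rightarrow> _)"
      apply (auto simp flip: to_fract_add to_fract_mult to_fract_uminus simp: rderiv_to_fract)
  by (metis to_fract_1 rangeI)

lemma range_to_fract_sum: "(\<And>x. x \<in> A \<Longrightarrow> h x \<in> range to_fract) \<Longrightarrow> sum h A \<in> range (to_fract :: complex poly \<Rightarrow> _)"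
  by (induction A rule: infinite_finite_induct) (simp_all add: range_to_fract_closed)

lemma range_to_fract_rderivs: "f \<in> range to_fract \<Longrightarrow> rderivs k f \<in> range (to_fract :: complex poly \<Rightarrow> _)"
  by (induction k) (simp_all add: range_to_fract_closed)

lemma range_to_fract_of_nat: "of_nat k \<in> range (to_fract :: complex poly \<Rightarrow> _)"
  by (induction k) (simp_all add: range_to_fract_closed)

lemma weyl_0 [simp]: "0 \<in> weyl" by (simp add: weyl_iff range_to_fract_closed)
lemma weyl_1 [simp]: "1 \<in> weyl" by (simp add: weyl_iff pcoeff_1 range_to_fract_closed)
lemma weyl_add: "P \<in> weyl \<Longrightarrow> Q \<in> weyl \<Longrightarrow> P + Q \<in> weyl"
  by (simp add: weyl_iff range_to_fract_closed)
lemma weyl_uminus: "P \<in> weyl \<Longrightarrow> - P \<in> weyl" by (simp add: weyl_iff range_to_fract_closed)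
lemma weyl_diff: "P \<in> weyl \<Longrightarrow> Q \<in> weyl \<Longrightarrow> P - Q \<in> weyl"
  using weyl_add[of P "- Q"] weyl_uminus by simp
lemma weyl_sum: "(\<And>x. x \<in> A \<Longrightarrow> f x \<in> weyl) \<Longrightarrow> sum f A \<in> weyl"
  by (induction A rule: infinite_finite_induct) (auto intro: weyl_add)
lemma weyl_pfun: "pfun (to_fract p) \<in> weyl"
  by (simp add: weyl_iff pcoeff_pfun range_to_fract_closed)
lemma weyl_pconst: "pconst c \<in> weyl" by (simp add: pconst_def weyl_pfun)
lemma weyl_pZ: "pZ \<in> weyl" by (simp add: pZ_def weyl_pfun)
lemma weyl_pD: "pD \<in> weyl" by (simp add: weyl_iff pcoeff_pD range_to_fract_closed)

text \<open>For i >= 0 the generalized binomial coefficient is an ordinary one: a natural number,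
  and zero when i + j - n exceeds i, as happens for n < 0 <= j.\<close>

lemma weyl_mult:
  assumes P: "P \<in> weyl" and Q: "Q \<in> weyl"
  shows "P * Q \<in> weyl"
proof -
  let ?S = "\<lambda>n. {(i, j). pcoeff P i \<noteq> 0 \<and> pcoeff Q j \<noteq> 0 \<and> n \<le> i + j}"
  have c: "pcoeff (P * Q) n = (\<Sum>(i, j)\<in>?S n. pterm (pcoeff P) (pcoeff Q) n i j)" for n
    unfolding times_pdo.rep_eq pmult_def ..
  have g: "(of_int i gchoose k :: ratfun) = of_nat (nat i choose k)" if "i \<ge> 0" for i k
    using that binomial_gbinomial[of "nat i" k, where 'a = ratfun] by simp
  have "pcoeff (P * Q) n = 0" if "n < 0" for n
    unfolding c
  proof (rule sum.neutral, safe)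
    fix i j assume ij: "pcoeff P i \<noteq> 0" "pcoeff Q j \<noteq> 0" "n \<le> i + j"
    then have "i \<ge> 0" "j \<ge> 0" using P Q by (auto simp: weyl_iff) (meson not_le)+
    moreover from this that have "nat i < nat (i + j - n)" by simp
    ultimately show "pterm (pcoeff P) (pcoeff Q) n i j = 0"
      by (simp add: pterm_def g binomial_eq_0)
  qed
  moreover have "pcoeff (P * Q) n \<in> range to_fract" for n
    unfolding c
  proof (rule range_to_fract_sum, safe)
    fix i j assume ij: "pcoeff P i \<noteq> 0" "pcoeff Q j \<noteq> 0" "n \<le> i + j"
    then have "i \<ge> 0" "j \<ge> 0" using P Q by (auto simp: weyl_iff) (meson not_le)+
    moreover have "pcoeff P i \<in> range to_fract" "pcoeff Q j \<in> range to_fract"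
      using P Q by (auto simp: weyl_iff)
    ultimately show "pterm (pcoeff P) (pcoeff Q) n i j \<in> range to_fract"
      by (auto simp add: pterm_def g simp del: funpow.simps
        intro!: range_to_fract_closed range_to_fract_of_nat range_to_fract_rderivs)
  qed
  ultimately show ?thesis by (simp add: weyl_iff)
qed

lemma weyl_power: "P \<in> weyl \<Longrightarrow> P ^ k \<in> weyl"
  by (induction k) (auto intro: weyl_mult)

lemmas weyl_intros = weyl_0 weyl_1 weyl_add weyl_uminus weyl_diff weyl_sum weyl_pfun weyl_pconst weyl_pZ weyl_pD
  weyl_mult weyl_power

definition wcoeff :: "pdo \<Rightarrow> nat \<Rightarrow> complex poly"
  where "wcoeff P i = inv_into UNIV to_fract (pcoeff P (int i))"

lemma inj_to_fract: "inj (to_fract :: complex poly \<Rightarrow> _)"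
  by (rule injI) simp

lemma wcoeff: "P \<in> weyl \<Longrightarrow> to_fract (wcoeff P i) = pcoeff P (int i)"
  unfolding wcoeff_def by (rule f_inv_into_f) (simp add: weyl_iff)

lemma wcoeff_eqI: "pcoeff P (int i) = to_fract p \<Longrightarrow> wcoeff P i = p"
  by (simp add: wcoeff_def inv_f_f inj_to_fract)

lemma weyl_eqI: "P \<in> weyl \<Longrightarrow> Q \<in> weyl \<Longrightarrow> (\<And>i. wcoeff P i = wcoeff Q i) \<Longrightarrow> P = Q"
  by (rule pdo_eqI) (metis nat_0_le not_le wcoeff weyl_iff)

definition wop :: "nat \<Rightarrow> (nat \<Rightarrow> complex poly) \<Rightarrow> pdo"
  where "wop N f = (\<Sum>i<N. pfun (to_fract (f i)) * pD ^ i)"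

lemma pcoeff_wop: "pcoeff (wop N f) k = (if 0 \<le> k \<and> k < int N then to_fract (f (nat k)) else 0)"
proof -
  have "pcoeff (wop N f) k = (\<Sum>i<N. if i = nat k \<and> 0 \<le> k then to_fract (f i) else 0)"
    unfolding wop_def pcoeff_sum by (rule sum.cong) (auto simp: pcoeff_pfun simp del: pcoeff_pfun_mult)
  also have "\<dots> = (if 0 \<le> k \<and> k < int N then to_fract (f (nat k)) else 0)"
    by (cases "0 \<le> k") (auto simp: sum.delta)
  finally show ?thesis .
qed

lemma weyl_wop: "wop N f \<in> weyl"
  unfolding wop_def by (intro weyl_intros)

lemma wcoeff_wop: "wcoeff (wop N f) i = (if i < N then f i else 0)"
  by (rule wcoeff_eqI) (simp add: pcoeff_wop)

lemma ordle_iff_wcoeff: "P \<in> weyl \<Longrightarrow> ordle P (int e) \<longleftrightarrow> (\<forall>i>e. wcoeff P i = 0)"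
  unfolding ordle_def
proof safe
  fix i assume "P \<in> weyl" "\<forall>k>int e. pcoeff P k = 0" "e < i"
  then show "wcoeff P i = 0" by (intro wcoeff_eqI) simp
next
  fix k assume *: "P \<in> weyl" "\<forall>i>e. wcoeff P i = 0" "int e < k"
  then have "wcoeff P (nat k) = 0" by simp
  with wcoeff[OF *(1), of "nat k"] * show "pcoeff P k = 0" by simp
qed

section \<open>Isomorphisms of fractional ideals\<close>

lemma ordle_pfun: "ordle (pfun f) 0" by (simp add: ordle_def pcoeff_pfun)
lemma ordle_pD_power: "ordle (pD ^ k) (int k)"
  using pcoeff_mult_pD_power[of 1 k] by (simp add: ordle_def pcoeff_1)

lemma pfun_eq_0_iff [simp]: "pfun f = 0 \<longleftrightarrow> f = 0"
  by (metis pcoeff_0 pcoeff_pfun pfun_0)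

text \<open>A Euclidean step: with \<alpha> and \<beta> the top coefficients of \<open>a\<close> and
  \<open>b\<close>, the operators \<open>a \<beta>\<close> and
  \<open>b \<partial>^(k-m) \<alpha>\<close> share order and top coefficient, so their difference
  has lower order. Induction on the sum of the orders.\<close>

lemma weyl_ore_aux:
  assumes "a \<in> weyl" "b \<in> weyl" "ordle a (int k)" "ordle b (int m)"
    "pcoeff a (int k) \<noteq> 0" "pcoeff b (int m) \<noteq> 0"
  shows "\<exists>c\<in>weyl. \<exists>d\<in>weyl. a * c = b * d \<and> a * c \<noteq> 0"
  using assms
proof (induction "k + m" arbitrary: a b k m rule: less_induct)
  case less
  \<comment> \<open>Stated for \<open>m \<le> k\<close> with the induction hypothesis as a premise,
    so that the other case follows by exchanging \<open>a\<close> and \<open>b\<close>;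
    \<open>k0 + m0\<close> is the measure of the outer induction.\<close>
  have main: "\<exists>c\<in>weyl. \<exists>d\<in>weyl. a * c = b * d \<and> a * c \<noteq> 0"
    if mk: "m \<le> k" and km: "k + m = k0 + m0" and w: "a \<in> weyl" "b \<in> weyl"
      and o: "ordle a (int k)" "ordle b (int m)" "pcoeff a (int k) \<noteq> 0" "pcoeff b (int m) \<noteq> 0"
      and IH: "\<And>a b k m. k + m < k0 + m0 \<Longrightarrow> a \<in> weyl \<Longrightarrow> b \<in> weyl \<Longrightarrow> ordle a (int k) \<Longrightarrow>
        ordle b (int m) \<Longrightarrow> pcoeff a (int k) \<noteq> 0 \<Longrightarrow> pcoeff b (int m) \<noteq> 0 \<Longrightarrow>
        \<exists>c\<in>weyl. \<exists>d\<in>weyl. a * c = b * d \<and> a * c \<noteq> 0"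
    for a b k m and k0 m0 :: nat
  proof -
    define \<alpha> where "\<alpha> = pfun (pcoeff a (int k))"
    define \<beta> where "\<beta> = pfun (pcoeff b (int m))"
    have w': "\<alpha> \<in> weyl" "\<beta> \<in> weyl"
      using wcoeff[OF w(1), of k] wcoeff[OF w(2), of m] weyl_pfun unfolding \<alpha>_def \<beta>_def by metis+
    have nz: "\<alpha> \<noteq> 0" "\<beta> \<noteq> 0" "a \<noteq> 0" "b \<noteq> 0" using o by (auto simp: \<alpha>_def \<beta>_def)
    define e where "e = pD ^ (k - m) * \<alpha>"
    have e: "e \<in> weyl" using w' by (auto simp: e_def intro: weyl_intros)
    have oe: "ordle e (int (k - m))" unfolding e_def \<alpha>_def
      using ordle_mult[OF ordle_pD_power ordle_pfun] by simp
    have ce: "pcoeff e (int (k - m)) = pcoeff a (int k)" unfolding e_def \<alpha>_def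
      using pcoeff_mult_top[OF ordle_pD_power[of "k-m"] ordle_pfun] pcoeff_mult_pD_power[of 1 "k-m" "int (k-m)"]
      by (simp add: pcoeff_pfun pcoeff_1)
    define r where "r = a * \<beta> - b * e"
    have rw: "r \<in> weyl" using w w' e by (auto simp: r_def intro: weyl_intros)
    have ok: "ordle (a * \<beta>) (int k)" using ordle_mult[OF o(1) ordle_pfun] by (simp add: \<beta>_def)
    have ok2: "ordle (b * e) (int k)" using ordle_mult[OF o(2) oe] mk by (simp add: of_nat_diff)
    have "pcoeff r (int k) = 0"
      using pcoeff_mult_top[OF o(1) ordle_pfun[of "pcoeff b (int m)"]] pcoeff_mult_top[OF o(2) oe] mk ce
      by (simp add: r_def \<beta>_def pcoeff_pfun of_nat_diff mult.commute)
    then have or: "ordle r (int k - 1)" using ordle_pred ordle_diff[OF ok ok2] by (simp add: r_def)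
    show ?thesis
    proof (cases "r = 0")
      case True
      then show ?thesis using w' e nz by (intro bexI[of _ \<beta>] bexI[of _ e]) (auto simp: r_def)
    next
      case False
      then obtain j where j: "ordle r j" "pcoeff r j \<noteq> 0" using top_ex by blast
      then have "j \<ge> 0" using rw by (auto simp: weyl_iff) (meson not_le)
      moreover have "j < int k" using or j by (auto simp: ordle_def) (meson not_le zle_diff1_eq)
      ultimately have j': "j = int (nat j)" "nat j < k" by simp_all
      have "\<exists>c\<in>weyl. \<exists>d\<in>weyl. r * c = b * d \<and> r * c \<noteq> 0"
        by (rule IH[of "nat j" m r b]) (use j j' km rw w o in auto)
      then obtain c d where cd: "c \<in> weyl" "d \<in> weyl" "r * c = b * d" "r * c \<noteq> 0" by blast
      have "a * (\<beta> * c) = r * c + b * (e * c)" by (simp add: r_def algebra_simps)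
      also have "\<dots> = b * (d + e * c)" using cd by (simp add: algebra_simps)
      finally have "a * (\<beta> * c) = b * (d + e * c)" .
      moreover have "a * (\<beta> * c) \<noteq> 0" using nz cd by auto
      ultimately show ?thesis using cd w' e
        by (intro bexI[of _ "\<beta> * c"] bexI[of _ "d + e * c"]) (auto intro: weyl_intros)
    qed
  qed
  show ?case
  proof (cases "m \<le> k")
    case True
    show ?thesis by (rule main[of m k k m]) (use True less in auto)
  next
    case False
    have "\<exists>c\<in>weyl. \<exists>d\<in>weyl. b * c = a * d \<and> b * c \<noteq> 0"
      by (rule main[of k m k m]) (use False less in auto)
    then show ?thesis by metis
  qed
qed

lemma weyl_ore:
  assumes "a \<in> weyl" "b \<in> weyl" "a \<noteq> 0" "b \<noteq> 0"
  shows "\<exists>c\<in>weyl. \<exists>d\<in>weyl. a * c = b * d \<and> a * c \<noteq> 0"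
proof -
  have *: "\<exists>k. ordle a (int k) \<and> pcoeff a (int k) \<noteq> 0" if "a \<in> weyl" "a \<noteq> 0" for a
  proof -
    obtain j where j: "ordle a j" "pcoeff a j \<noteq> 0" using top_ex \<open>a \<noteq> 0\<close> by blast
    then have "j = int (nat j)" using that by (cases "j < 0") (auto simp: weyl_iff)
    then show ?thesis using j by metis
  qed
  obtain k m where "ordle a (int k)" "pcoeff a (int k) \<noteq> 0" "ordle b (int m)" "pcoeff b (int m) \<noteq> 0"
    using *[OF assms(1,3)] *[OF assms(2,4)] by blast
  then show ?thesis by (intro weyl_ore_aux[OF assms(1,2)])
qed

text \<open>Compare any x with the fixed \<open>x0\<close>: the Ore condition gives
  \<open>x c = x0 d\<close>, and linearity turns this into \<open>\<phi> x c = \<phi> x0 d\<close>,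
  so \<phi> is left multiplication by the ratio of \<open>\<phi> x0\<close> to \<open>x0\<close>.
  The common denominator \<open>s\<close> moves both elements into the Weyl algebra, where the Ore
  condition is available.\<close>

lemma right_weyl_iso_left_mult:
  assumes iso: "right_weyl_iso M N" and s: "s \<noteq> 0" "\<And>x. x \<in> M \<Longrightarrow> s * x \<in> weyl"
    and M: "0 \<in> M" "x0 \<in> M" "x0 \<noteq> 0"
  shows "\<exists>q. q \<noteq> 0 \<and> N = (\<lambda>x. q * x) ` M"
proof -
  obtain \<phi> where bij: "bij_betw \<phi> M N" and lin: "\<And>x a. x \<in> M \<Longrightarrow> a \<in> weyl \<Longrightarrow> \<phi> (x * a) = \<phi> x * a"
    using iso unfolding right_weyl_iso_def by blast
  have \<phi>0: "\<phi> 0 = 0" using lin[OF M(2), of 0] by simp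
  define q where "q = \<phi> x0 * inverse x0"
  have "\<phi> x0 \<noteq> 0" using bij M \<phi>0 unfolding bij_betw_def inj_on_def by metis
  then have q: "q \<noteq> 0" "q * x0 = \<phi> x0" using M by (auto simp: q_def mult.assoc)
  have "\<phi> x = q * x" if x: "x \<in> M" for x
  proof (cases "x = 0")
    case False
    then obtain c d where cd: "c \<in> weyl" "d \<in> weyl" "s * x * c = s * x0 * d" "s * x * c \<noteq> 0"
      using weyl_ore[OF s(2)[OF x] s(2)[OF M(2)]] s(1) M(3) by (metis no_zero_divisors)
    then have "x * c = x0 * d" using s(1) by (simp add: mult.assoc)
    then have "\<phi> x * c = \<phi> x0 * d" using lin x M cd by metis
    also have "\<dots> = q * (x0 * d)" by (simp add: q(2)[symmetric] mult.assoc)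
    also have "\<dots> = q * x * c" using \<open>x * c = x0 * d\<close> by (simp add: mult.assoc)
    finally show ?thesis using cd by auto
  qed (simp add: \<phi>0)
  then have "N = (\<lambda>x. q * x) ` M" using bij unfolding bij_betw_def by (metis (no_types, lifting) image_cong)
  with q show ?thesis by blast
qed

definition lead :: "pdo set \<Rightarrow> int \<Rightarrow> ratfun set"
  where "lead M i = {pcoeff P i | P. P \<in> M \<and> ordle P i}"

lemma leadI: "P \<in> M \<Longrightarrow> ordle P i \<Longrightarrow> pcoeff P i \<in> lead M i"
  by (auto simp: lead_def)

text \<open>Top coefficients multiply and rational functions have no zero divisors, so
  \<open>q\<close> shifts every order by exactly \<open>o'\<close>.\<close>

lemma lead_left_mult:
  assumes "ordle q o'" "pcoeff q o' \<noteq> 0"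
  shows "lead ((\<lambda>x. q * x) ` M) (o' + i) = (\<lambda>f. pcoeff q o' * f) ` lead M i"
proof -
  have iff: "ordle (q * x) (o' + i) \<longleftrightarrow> ordle x i" for x
  proof
    assume *: "ordle (q * x) (o' + i)"
    show "ordle x i"
    proof (cases "x = 0")
      case False
      then obtain j where j: "ordle x j" "pcoeff x j \<noteq> 0" using top_ex by blast
      then have "pcoeff (q * x) (o' + j) \<noteq> 0" using assms pcoeff_mult_top by simp
      then have "j \<le> i" using * by (auto simp: ordle_def) (meson add_less_cancel_left not_le)
      then show ?thesis using j ordle_mono by blast
    qed simp
  next
    assume "ordle x i" then show "ordle (q * x) (o' + i)" using ordle_mult assms by blast
  qed
  have "pcoeff (q * x) (o' + i) = pcoeff q o' * pcoeff x i" if "ordle x i" for x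
    using pcoeff_mult_top that assms by blast
  note c = this
  show ?thesis
  proof safe
    fix f assume "f \<in> lead ((\<lambda>x. q * x) ` M) (o' + i)"
    then obtain x where "x \<in> M" "ordle (q * x) (o' + i)" "f = pcoeff (q * x) (o' + i)"
      by (auto simp: lead_def)
    then show "f \<in> (\<lambda>f. pcoeff q o' * f) ` lead M i" using iff c leadI by blast
  next
    fix f assume "f \<in> lead M i"
    then obtain x where "x \<in> M" "ordle x i" "f = pcoeff x i" by (auto simp: lead_def)
    then show "pcoeff q o' * f \<in> lead ((\<lambda>x. q * x) ` M) (o' + i)"
      using iff[of x] c[of x] leadI[of "q * x" "(\<lambda>x. q * x) ` M" "o' + i"] by auto
  qed
qed

lemma right_weyl_iso_refl: "right_weyl_iso M M"
  unfolding right_weyl_iso_def by (rule exI[of _ id]) auto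

text \<open>By reflexivity \<open>M\<close> lies in its own class, hence in that of
  \<open>N\<close>.\<close>

lemma iso_class_eqD: "right_weyl_module M \<Longrightarrow> iso_class M = iso_class N \<Longrightarrow> right_weyl_iso N M"
  unfolding iso_class_def using right_weyl_iso_refl by blast

lemma poly_ideal_principal:
  fixes I :: "complex poly set"
  assumes add: "\<And>p q. p \<in> I \<Longrightarrow> q \<in> I \<Longrightarrow> p + q \<in> I" and mult: "\<And>p q. p \<in> I \<Longrightarrow> p * q \<in> I"
    and nz: "p0 \<in> I" "p0 \<noteq> 0"
  shows "\<exists>h. h \<noteq> 0 \<and> (\<forall>p. p \<in> I \<longleftrightarrow> h dvd p)"
proof -
  obtain h where h: "h \<in> I" "h \<noteq> 0" and min: "\<And>p. p \<in> I \<Longrightarrow> p \<noteq> 0 \<Longrightarrow> degree h \<le> degree p"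
    using ex_has_least_nat[of "\<lambda>p. p \<in> I \<and> p \<noteq> 0" p0 degree] nz by blast
  have "h dvd p" if "p \<in> I" for p
  proof -
    have "p mod h = p + h * (- (p div h))" by (simp add: minus_mult_div_eq_mod[symmetric])
    then have "p mod h \<in> I" using add mult that h by metis
    then have "p mod h = 0" using min degree_mod_less[OF h(2), of p] by (metis not_le)
    then show ?thesis by (simp add: mod_eq_0_iff_dvd)
  qed
  moreover have "p \<in> I" if "h dvd p" for p using that mult[OF h(1)] by (auto elim!: dvdE)
  ultimately show ?thesis using h(2) by blast
qed

lemma lead_add:
  assumes "right_weyl_module M" "f \<in> lead M i" "g \<in> lead M i" shows "f + g \<in> lead M i"
proof -
  obtain P Q where "P \<in> M" "ordle P i" "f = pcoeff P i" "Q \<in> M" "ordle Q i" "g = pcoeff Q i"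
    using assms by (auto simp: lead_def)
  then show ?thesis using leadI[of "P + Q" M i] assms(1) by (auto simp: right_weyl_module_def ordle_add)
qed

lemma lead_mult:
  assumes "right_weyl_module M" "f \<in> lead M i" shows "f * to_fract p \<in> lead M i"
proof -
  obtain P where P: "P \<in> M" "ordle P i" "f = pcoeff P i" using assms by (auto simp: lead_def)
  have "P * pfun (to_fract p) \<in> M" using P assms(1) weyl_pfun by (auto simp: right_weyl_module_def)
  moreover have "ordle (P * pfun (to_fract p)) i" using ordle_mult[OF P(2) ordle_pfun] by simp
  ultimately show ?thesis using leadI[of "P * pfun (to_fract p)" M i] pcoeff_mult_top[OF P(2) ordle_pfun] P
    by (simp add: pcoeff_pfun)
qed

text \<open>Right multiplication by \<partial> raises the order and keeps the top coefficient; hence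
  the leading ideals increase.\<close>

lemma lead_Suc:
  assumes "right_weyl_module M" "f \<in> lead M i" shows "f \<in> lead M (i + int m)"
proof -
  obtain P where P: "P \<in> M" "ordle P i" "f = pcoeff P i" using assms by (auto simp: lead_def)
  have "P * pD ^ m \<in> M" using P assms(1) weyl_power[OF weyl_pD] by (auto simp: right_weyl_module_def)
  moreover have "ordle (P * pD ^ m) (i + int m)" using P by (simp add: ordle_def)
  ultimately show ?thesis using leadI[of "P * pD ^ m" M "i + int m"] P by simp
qed

section \<open>Evaluation of constant-coefficient polynomials\<close>

lemma eval_at_lessThan:
  assumes "\<And>i. i \<ge> N \<Longrightarrow> coeff p i = 0"
  shows "eval_at p T = (\<Sum>i<N. pconst (coeff p i) * T ^ i)"
proof -
  have "eval_at p T = (\<Sum>i\<in>{..degree p} \<union> {..<N}. pconst (coeff p i) * T ^ i)"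
    unfolding eval_at_def by (rule sum.mono_neutral_left) (auto simp: coeff_eq_0)
  also have "\<dots> = (\<Sum>i<N. pconst (coeff p i) * T ^ i)"
    by (rule sum.mono_neutral_right) (auto simp: assms)
  finally show ?thesis .
qed

lemma eval_at_0 [simp]: "eval_at 0 T = 0" by (simp add: eval_at_def)

lemma eval_at_add: "eval_at (p + q) T = eval_at p T + eval_at q T"
proof -
  let ?N = "Suc (max (degree p) (degree q))"
  have "coeff p i = 0" "coeff q i = 0" if "i \<ge> ?N" for i
    using that by (auto intro: coeff_eq_0)
  then show ?thesis
    by (simp add: eval_at_lessThan[of ?N] pconst_add distrib_right sum.distrib del: sum.lessThan_Suc)
qed

lemma eval_at_smult: "eval_at (smult c p) T = pconst c * eval_at p T"
proof -
  let ?N = "Suc (degree p)"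
  have "coeff p i = 0" if "i \<ge> ?N" for i
    using that by (auto intro: coeff_eq_0)
  then show ?thesis
    by (simp add: eval_at_lessThan[of ?N] pconst_mult sum_distrib_left mult.assoc del: sum.lessThan_Suc)
qed

lemma eval_at_pCons: "eval_at (pCons a p) T = pconst a + T * eval_at p T"
proof -
  let ?N = "Suc (degree p)"
  have c: "coeff p i = 0" if "i \<ge> ?N" for i
    using that by (auto intro: coeff_eq_0)
  then have "coeff (pCons a p) i = 0" if "i \<ge> Suc ?N" for i
    using that by (cases i) auto
  then have "eval_at (pCons a p) T = (\<Sum>i<Suc ?N. pconst (coeff (pCons a p) i) * T ^ i)"
    by (rule eval_at_lessThan)
  also have "\<dots> = pconst a + (\<Sum>i<?N. pconst (coeff p i) * (T * T ^ i))"
    by (subst sum.lessThan_Suc_shift) simp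
  also have "(\<Sum>i<?N. pconst (coeff p i) * (T * T ^ i)) = T * (\<Sum>i<?N. pconst (coeff p i) * T ^ i)"
    unfolding sum_distrib_left by (rule sum.cong) (metis mult.assoc pconst_commute)+
  finally show ?thesis using eval_at_lessThan[OF c] by simp
qed

lemma eval_at_const [simp]: "eval_at [:c:] T = pconst c"
  by (simp add: eval_at_pCons)

text \<open>Centrality of the constants makes substitution of an operator a ring homomorphism. Thus
  adjugate identities, proved over the commutative ring of polynomials, carry over to matrices over
  the skew field.\<close>

lemma eval_at_mult: "eval_at (p * q) T = eval_at p T * eval_at q T"
  by (induction p) (simp_all add: eval_at_add eval_at_smult eval_at_pCons distrib_right mult.assoc)

lemma eval_at_sum: "eval_at (sum f A) T = (\<Sum>x\<in>A. eval_at (f x) T)"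
  by (induction A rule: infinite_finite_induct) (auto simp: eval_at_add)

lemma eval_at_uminus: "eval_at (- p) T = - eval_at p T"
  using eval_at_add[of p "- p" T] by (simp add: eq_neg_iff_add_eq_0 add.commute)

lemma eval_at_diff: "eval_at (p - q) T = eval_at p T - eval_at q T"
  using eval_at_add[of p "- q" T] by (simp add: eval_at_uminus)

lemma eval_at_pZ: "eval_at p pZ = pfun (to_fract p)"
  by (induction p) (simp_all add: eval_at_pCons pZ_def pconst_def
      pfun_mult[symmetric] pfun_add[symmetric] to_fract_pCons[symmetric])

lemma pcoeff_pconst: "pcoeff (pconst c) k = (if k = 0 then to_fract [:c:] else 0)"
  by (simp add: pconst_def pcoeff_pfun)

lemma weyl_eval_pD: "eval_at p pD \<in> weyl"
  unfolding eval_at_def by (intro weyl_intros)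

lemma wcoeff_eval_pD: "wcoeff (eval_at p pD) i = [:coeff p i:]"
proof (induction p arbitrary: i)
  case 0
  then show ?case by (simp add: wcoeff_eqI)
next
  case (pCons a p)
  have "pD * eval_at p pD = eval_at p pD * pD"
  proof -
    have "eval_at ([:0,1:] * p) pD = eval_at (p * [:0,1:]) pD" by (simp only: mult.commute)
    then show ?thesis unfolding eval_at_mult by (simp add: eval_at_pCons)
  qed
  then have e: "eval_at (pCons a p) pD = pconst a + eval_at p pD * pD" by (simp add: eval_at_pCons)
  show ?case
  proof (rule wcoeff_eqI)
    have "pcoeff (eval_at p pD) (-1) = 0" using weyl_eval_pD[of p] by (auto simp: weyl_iff)
    then show "pcoeff (eval_at (pCons a p) pD) (int i) = to_fract [:coeff (pCons a p) i:]"
      unfolding e by (cases i) (auto simp: pcoeff_pconst pCons.IH wcoeff[OF weyl_eval_pD, symmetric])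
  qed
qed

lemma wcoeff_0 [simp]: "wcoeff 0 i = 0" by (rule wcoeff_eqI) simp

lemma eval_at_pD_eq_0_iff [simp]: "eval_at p pD = 0 \<longleftrightarrow> p = 0"
proof
  assume "eval_at p pD = 0"
  then have "[:coeff p i:] = 0" for i using wcoeff_eval_pD[of p i] by simp
  then show "p = 0" by (intro poly_eqI) simp
qed simp

lemma wcoeff_add: "P \<in> weyl \<Longrightarrow> Q \<in> weyl \<Longrightarrow> wcoeff (P + Q) i = wcoeff P i + wcoeff Q i"
  by (rule wcoeff_eqI) (simp add: wcoeff)
lemma wcoeff_diff: "P \<in> weyl \<Longrightarrow> Q \<in> weyl \<Longrightarrow> wcoeff (P - Q) i = wcoeff P i - wcoeff Q i"
  by (rule wcoeff_eqI) (simp add: wcoeff)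
lemma wcoeff_sum: "(\<And>x. x \<in> A \<Longrightarrow> f x \<in> weyl) \<Longrightarrow> wcoeff (sum f A) i = (\<Sum>x\<in>A. wcoeff (f x) i)"
  by (induction A rule: infinite_finite_induct) (auto simp: wcoeff_add weyl_sum)
lemma wcoeff_pfun: "P \<in> weyl \<Longrightarrow> wcoeff (pfun (to_fract p) * P) i = p * wcoeff P i"
  by (rule wcoeff_eqI) (simp add: wcoeff)
lemma wcoeff_pconst: "P \<in> weyl \<Longrightarrow> wcoeff (pconst c * P) i = smult c (wcoeff P i)"
  by (simp add: pconst_def wcoeff_pfun)
lemma wcoeff_pZ: "P \<in> weyl \<Longrightarrow> wcoeff (pZ * P) i = pCons 0 (wcoeff P i)"
  by (simp add: pZ_def wcoeff_pfun)

section \<open>Pairing operators with arrays\<close>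

definition bnd :: "nat \<Rightarrow> pdo \<Rightarrow> bool"
  where "bnd N P \<longleftrightarrow> (\<forall>i j. i \<ge> N \<or> j \<ge> N \<longrightarrow> coeff (wcoeff P i) j = 0)"

text \<open>\<open>e i j\<close> is the value on \<open>z\<^sup>j \<partial>\<^sup>i\<close>. The bound only makes the sum finite: any valid bound gives the same value.\<close>
definition pairing :: "pdo \<Rightarrow> (nat \<Rightarrow> nat \<Rightarrow> complex) \<Rightarrow> complex"
  where "pairing P e = (\<Sum>i<(LEAST N. bnd N P). \<Sum>j<(LEAST N. bnd N P). coeff (wcoeff P i) j * e i j)"

lemma bnd_mono: "bnd N P \<Longrightarrow> N \<le> M \<Longrightarrow> bnd M P"
  unfolding bnd_def by (meson order_trans)

lemma bnd_ex: assumes "P \<in> weyl" shows "\<exists>N. bnd N P"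
proof -
  obtain e where "ordle P (int e)" using ordle_ex_nat by blast
  then have e: "wcoeff P i = 0" if "i > e" for i using that assms by (simp add: ordle_iff_wcoeff)
  define N where "N = Suc (max e (Max ((\<lambda>i. degree (wcoeff P i)) ` {..e})))"
  have "coeff (wcoeff P i) j = 0" if "i \<ge> N \<or> j \<ge> N" for i j
  proof (cases "i > e")
    case False
    then have "degree (wcoeff P i) \<le> Max ((\<lambda>i. degree (wcoeff P i)) ` {..e})"
      by (intro Max_ge) auto
    also have "\<dots> < N" by (simp add: N_def less_Suc_eq_le)
    also have "N \<le> j"
    proof -
      have "e < N" by (simp add: N_def)
      then show ?thesis using that False by linarith
    qed
    finally have "degree (wcoeff P i) < j" .
    then show ?thesis by (rule coeff_eq_0)
  qed (simp add: e)
  then show ?thesis unfolding bnd_def by blast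
qed

lemma pairing_eq:
  assumes "bnd N P"
  shows "pairing P e = (\<Sum>i<N. \<Sum>j<N. coeff (wcoeff P i) j * e i j)"
proof -
  define L where "L = (LEAST N. bnd N P)"
  have "bnd L P" and LN: "L \<le> N" unfolding L_def using assms by (auto intro: LeastI Least_le)
  then have L: "\<And>i j. i \<ge> L \<or> j \<ge> L \<Longrightarrow> coeff (wcoeff P i) j = 0" unfolding bnd_def by blast
  have "(\<Sum>i<N. \<Sum>j<N. coeff (wcoeff P i) j * e i j)
     = (\<Sum>i<N. \<Sum>j<L. coeff (wcoeff P i) j * e i j)"
    by (rule sum.cong[OF refl], rule sum.mono_neutral_right) (use L LN in auto)
  also have "\<dots> = (\<Sum>i<L. \<Sum>j<L. coeff (wcoeff P i) j * e i j)"
    by (rule sum.mono_neutral_right) (use L LN in auto)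
  finally show ?thesis by (simp add: pairing_def L_def)
qed

lemma pairing_add:
  assumes "P \<in> weyl" "Q \<in> weyl"
  shows "pairing (P + Q) e = pairing P e + pairing Q e"
proof -
  obtain N M where "bnd N P" "bnd M Q" using bnd_ex assms by blast
  then have b: "bnd (max N M) P" "bnd (max N M) Q" by (auto intro: bnd_mono)
  then have "bnd (max N M) (P + Q)" using assms by (simp add: bnd_def wcoeff_add)
  then show ?thesis using b assms by (simp add: pairing_eq[of "max N M"] wcoeff_add distrib_right sum.distrib)
qed

lemma pairing_0 [simp]: "pairing 0 e = 0"
  using pairing_add[of 0 0 e] by simp

lemma pairing_pconst:
  assumes "P \<in> weyl"
  shows "pairing (pconst c * P) e = c * pairing P e"
proof -
  obtain N where b: "bnd N P" using bnd_ex assms by blast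
  then have "bnd N (pconst c * P)" using assms by (simp add: bnd_def wcoeff_pconst)
  then show ?thesis using b assms by (simp add: pairing_eq[of N] wcoeff_pconst sum_distrib_left mult.assoc)
qed

lemma pairing_uminus: "P \<in> weyl \<Longrightarrow> pairing (- P) e = - pairing P e"
  using pairing_add[of P "- P" e] weyl_uminus by (simp add: eq_neg_iff_add_eq_0 add.commute)

lemma pairing_diff: "P \<in> weyl \<Longrightarrow> Q \<in> weyl \<Longrightarrow> pairing (P - Q) e = pairing P e - pairing Q e"
  using pairing_add[of P "- Q" e] by (simp add: weyl_uminus pairing_uminus)

lemma pairing_sum:
  "(\<And>x. x \<in> A \<Longrightarrow> f x \<in> weyl) \<Longrightarrow> pairing (sum f A) e = (\<Sum>x\<in>A. pairing (f x) e)"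
  by (induction A rule: infinite_finite_induct) (auto simp: pairing_add weyl_sum)

lemma pairing_pZ:
  assumes "P \<in> weyl"
  shows "pairing (pZ * P) e = pairing P (\<lambda>i j. e i (Suc j))"
proof -
  obtain N where b: "bnd N P" using bnd_ex assms by blast
  then have b': "bnd (Suc N) P" by (rule bnd_mono) simp
  have "coeff (wcoeff (pZ * P) i) j = 0" if "i \<ge> Suc N \<or> j \<ge> Suc N" for i j
    using that b assms by (cases j) (auto simp: bnd_def wcoeff_pZ)
  then have "bnd (Suc N) (pZ * P)" unfolding bnd_def by blast
  then have "pairing (pZ * P) e = (\<Sum>i<Suc N. \<Sum>j<Suc N. coeff (wcoeff (pZ * P) i) j * e i j)"
    by (rule pairing_eq)
  also have "\<dots> = (\<Sum>i<Suc N. \<Sum>j<N. coeff (wcoeff P i) j * e i (Suc j))"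
    by (rule sum.cong[OF refl], subst sum.lessThan_Suc_shift) (simp add: wcoeff_pZ assms)
  also have "\<dots> = (\<Sum>i<Suc N. \<Sum>j<Suc N. coeff (wcoeff P i) j * e i (Suc j))"
    by (rule sum.cong[OF refl]) (use b in \<open>auto simp: bnd_def\<close>)
  also have "\<dots> = pairing P (\<lambda>i j. e i (Suc j))"
    using pairing_eq[OF b'] by simp
  finally show ?thesis .
qed

lemma pairing_array_sum:
  "(\<Sum>k\<in>A. c k * pairing P (e k)) = pairing P (\<lambda>i j. \<Sum>k\<in>A. c k * e k i j)"
proof -
  have "(\<Sum>k\<in>A. c k * (\<Sum>i<N. \<Sum>j<N. f i j * e k i j)) = (\<Sum>i<N. \<Sum>j<N. f i j * (\<Sum>k\<in>A. c k * e k i j))"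
    for N :: nat and f :: "nat \<Rightarrow> nat \<Rightarrow> complex"
    unfolding sum_distrib_left
    by (simp add: sum_distrib_left sum.swap[of _ _ A] ac_simps)
  then show ?thesis unfolding pairing_def .
qed

lemma pairing_top:
  assumes "P \<in> weyl" "\<And>i j. coeff (wcoeff P i) j * e i j = 0"
  shows "pairing P e = 0"
  using assms by (simp add: pairing_def)

lemma pairing_eval_pD: "pairing (eval_at p pD) e = (\<Sum>i\<le>degree p. coeff p i * e i 0)"
proof -
  let ?N = "Suc (degree p)"
  have "bnd ?N (eval_at p pD)"
    by (auto simp: bnd_def wcoeff_eval_pD coeff_eq_0 coeff_pCons split: nat.splits)
  then have "pairing (eval_at p pD) e = (\<Sum>i<?N. \<Sum>j<?N. coeff (wcoeff (eval_at p pD) i) j * e i j)"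
    by (rule pairing_eq)
  also have "\<dots> = (\<Sum>i<?N. coeff p i * e i 0)"
    by (intro sum.cong refl, subst sum.lessThan_Suc_shift) (simp add: wcoeff_eval_pD)
  finally show ?thesis by (simp add: lessThan_Suc_atMost)
qed

text \<open>Left multiplication by \<partial> is an index shift only on constant coefficients: in
  general \<open>\<partial> z^j = z^j \<partial> + j z^(j-1)\<close> produces a second term.\<close>

lemma pairing_pD_eval: "pairing (pD * eval_at p pD) e = pairing (eval_at p pD) (\<lambda>i j. e (Suc i) j)"
proof -
  have "pD * eval_at p pD = eval_at (pCons 0 p) pD" by (simp add: eval_at_pCons)
  then have "pairing (pD * eval_at p pD) e = (\<Sum>i\<le>degree (pCons 0 p). coeff (pCons 0 p) i * e i 0)"
    by (simp only: pairing_eval_pD)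
  also have "\<dots> = (\<Sum>i\<le>Suc (degree p). coeff (pCons 0 p) i * e i 0)"
    by (rule sum.mono_neutral_left) (auto simp: coeff_eq_0)
  also have "\<dots> = pairing (eval_at p pD) (\<lambda>i j. e (Suc i) j)"
    by (subst sum.atMost_Suc_shift) (simp add: pairing_eval_pD)
  finally show ?thesis .
qed

section \<open>Division of vectors of polynomials by a linear matrix pencil\<close>

lemma vec_degree_bound:
  fixes p :: "nat \<Rightarrow> complex poly"
  shows "\<exists>D. \<forall>k<n. \<forall>j\<ge>D. coeff (p k) j = 0"
proof (intro exI allI impI)
  fix k j assume "k < n" and j: "Suc (\<Sum>k<n. degree (p k)) \<le> j"
  then have "degree (p k) \<le> (\<Sum>k<n. degree (p k))" by (intro member_le_sum) auto
  then show "coeff (p k) j = 0" using j by (intro coeff_eq_0) simp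
qed

text \<open>Division by the matrix \<open>A - z\<close> with a constant remainder. The induction on
  the degree bound strips the constant coefficients and divides what is left.\<close>

lemma vec_poly_div:
  fixes A :: "nat \<Rightarrow> nat \<Rightarrow> complex"
  assumes "\<forall>k<n. \<forall>j\<ge>D. coeff (p k) j = 0"
  shows "\<exists>s c. (\<forall>k<n. p k = (\<Sum>l<n. smult (A k l) (s l)) - pCons 0 (s k) + [:c k:])
     \<and> (\<forall>k<n. \<forall>j. Suc j \<ge> D \<longrightarrow> coeff (s k) j = 0) \<and> (D = 0 \<longrightarrow> (\<forall>k<n. c k = 0))"
  using assms
proof (induction D arbitrary: p)
  case 0
  then have "\<forall>k<n. p k = 0" by (auto intro: poly_eqI)
  then show ?case by (intro exI[of _ "\<lambda>_. 0"]) auto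
next
  case (Suc D)
  define p1 where "p1 k = poly_shift 1 (p k)" for k
  have p: "p k = pCons (coeff (p k) 0) (p1 k)" for k
    by (rule poly_eqI) (simp add: p1_def coeff_pCons coeff_poly_shift split: nat.splits)
  have "\<forall>k<n. \<forall>j\<ge>D. coeff (p1 k) j = 0"
    using Suc.prems by (auto simp: p1_def coeff_poly_shift)
  from Suc.IH[OF this] obtain s c where "\<forall>k<n. p1 k = (\<Sum>l<n. smult (A k l) (s l)) - pCons 0 (s k) + [:c k:]"
     "\<forall>k<n. \<forall>j. Suc j \<ge> D \<longrightarrow> coeff (s k) j = 0" and D0: "D = 0 \<longrightarrow> (\<forall>k<n. c k = 0)"
    by (elim exE conjE)
  then have sc: "\<And>k. k < n \<Longrightarrow> p1 k = (\<Sum>l<n. smult (A k l) (s l)) - pCons 0 (s k) + [:c k:]"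
     "\<And>k j. k < n \<Longrightarrow> Suc j \<ge> D \<Longrightarrow> coeff (s k) j = 0" by blast+
  \<comment> \<open>If \<open>p1 = (A - z) s + c\<close>, then
    \<open>p0 + z p1 = (A - z) (z s - c) + (p0 + A c)\<close>.\<close>
  define s' where "s' k = pCons (- c k) (s k)" for k
  define c' where "c' k = coeff (p k) 0 + (\<Sum>l<n. A k l * c l)" for k
  have "p k = (\<Sum>l<n. smult (A k l) (s' l)) - pCons 0 (s' k) + [:c' k:]" if k: "k < n" for k
  proof -
    have 1: "(\<Sum>l\<in>L. smult (A k l) (s' l)) = pCons (- (\<Sum>l\<in>L. A k l * c l)) (\<Sum>l\<in>L. smult (A k l) (s l))" for L
      by (induction L rule: infinite_finite_induct) (auto simp: s'_def)
    show ?thesis unfolding 1 by (subst p, subst sc(1)[OF k]) (simp add: s'_def c'_def)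
  qed
  moreover have "coeff (s' k) j = 0" if "k < n" "Suc j \<ge> Suc D" for k j
    using that sc(2)[of k "j - 1"] D0 by (cases j) (simp_all add: s'_def)
  ultimately show ?case by (intro exI[of _ s'] exI[of _ c'] conjI) simp_all
qed

section \<open>The operators attached to a Calogero-Moser pair\<close>

lemma mat_mult_entry:
  fixes A B :: "'a::semiring_0 mat"
  assumes "A \<in> carrier_mat nr m" "B \<in> carrier_mat m nc" "i < nr" "j < nc"
  shows "(A * B) $$ (i, j) = (\<Sum>k<m. A $$ (i, k) * B $$ (k, j))"
proof -
  have "(A * B) $$ (i, j) = (\<Sum>k = 0..<m. A $$ (i, k) * B $$ (k, j))"
    using assms by (simp add: scalar_prod_def)
  then show ?thesis by (simp add: atLeast0LessThan)
qed

text \<open>Adjugate and determinant are taken here, over a commutative ring, before an operator is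
  substituted for the variable.\<close>

definition pencil :: "complex mat \<Rightarrow> complex poly mat"
  where "pencil M = map_mat (\<lambda>c. [:c:]) M - [:0, 1:] \<cdot>\<^sub>m 1\<^sub>m (dim_row M)"

lemma pencil_carrier: "M \<in> carrier_mat n n \<Longrightarrow> pencil M \<in> carrier_mat n n"
  unfolding pencil_def by (rule minus_carrier_mat) auto

lemma pencil_entry:
  "M \<in> carrier_mat n n \<Longrightarrow> i < n \<Longrightarrow> j < n \<Longrightarrow> pencil M $$ (i, j) = [:M $$ (i, j):] - (if i = j then [:0, 1:] else 0)"
  by (simp add: pencil_def one_pCons)

lemma pencil_sum:
  assumes "M \<in> carrier_mat n n" "k < n"
  shows "(\<Sum>l<n. eval_at (pencil M $$ (k, l)) T * s l) = (\<Sum>l<n. pconst (M $$ (k, l)) * s l) - T * s k"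
proof -
  have "(\<Sum>l<n. eval_at (pencil M $$ (k, l)) T * s l)
    = (\<Sum>l<n. pconst (M $$ (k, l)) * s l - (if k = l then T * s l else 0))"
    by (rule sum.cong) (use assms in \<open>auto simp: pencil_entry eval_at_diff eval_at_pCons left_diff_distrib\<close>)
  then show ?thesis using assms(2) by (simp add: sum_subtractf sum.delta')
qed

lemma shift_det_pencil: "shift_det M = det (pencil M)"
  by (simp add: shift_det_def pencil_def)

lemma pencil_adj:
  assumes "M \<in> carrier_mat n n" "i < n" "j < n"
  shows "(\<Sum>k<n. pencil M $$ (i, k) * adj_mat (pencil M) $$ (k, j)) = (if i = j then shift_det M else 0)"
    and "(\<Sum>k<n. adj_mat (pencil M) $$ (i, k) * pencil M $$ (k, j)) = (if i = j then shift_det M else 0)"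
proof -
  note P = pencil_carrier[OF assms(1)]
  note a = adj_mat[OF P]
  show "(\<Sum>k<n. pencil M $$ (i, k) * adj_mat (pencil M) $$ (k, j)) = (if i = j then shift_det M else 0)"
    using mat_mult_entry[OF P a(1) assms(2,3)] assms(2,3)
    by (cases "i = j") (simp_all add: a(2) shift_det_pencil)
  show "(\<Sum>k<n. adj_mat (pencil M) $$ (i, k) * pencil M $$ (k, j)) = (if i = j then shift_det M else 0)"
    using mat_mult_entry[OF a(1) P assms(2,3)] assms(2,3)
    by (cases "i = j") (simp_all add: a(3) shift_det_pencil)
qed

lemma shift_det_nonzero: assumes "M \<in> carrier_mat n n" shows "shift_det M \<noteq> 0"
proof -
  have "char_poly_matrix M = (-1) \<cdot>\<^sub>m pencil M"
    using assms by (intro eq_matI) (auto simp: char_poly_matrix_def pencil_def)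
  then have "char_poly M = (-1) ^ n * shift_det M"
    using det_smult[of "-1" "pencil M"] pencil_carrier[OF assms] by (simp add: char_poly_def shift_det_pencil)
  moreover have "char_poly M \<noteq> 0" using degree_monic_char_poly[OF assms] by auto
  ultimately show ?thesis by auto
qed

lemma shift_mat_carrier: "M \<in> carrier_mat n n \<Longrightarrow> shift_mat M T \<in> carrier_mat n n"
  unfolding shift_mat_def by (rule minus_carrier_mat) auto

lemma shift_mat_entry:
  "M \<in> carrier_mat n n \<Longrightarrow> i < n \<Longrightarrow> j < n \<Longrightarrow> shift_mat M T $$ (i, j) = eval_at (pencil M $$ (i, j)) T"
  by (simp add: shift_mat_def pencil_entry eval_at_diff eval_at_pCons)

lemma inv_mat_eqI:
  fixes A B :: "pdo mat"
  assumes "A \<in> carrier_mat n n" "B \<in> carrier_mat n n" "A * B = 1\<^sub>m n" "B * A = 1\<^sub>m n"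
  shows "inv_mat A = B"
  unfolding inv_mat_def
proof (rule the_equality)
  show "B \<in> carrier_mat (dim_row A) (dim_row A) \<and> inverts_mat A B \<and> inverts_mat B A"
    using assms by (auto simp: inverts_mat_def)
next
  fix C assume *: "C \<in> carrier_mat (dim_row A) (dim_row A) \<and> inverts_mat A C \<and> inverts_mat C A"
  then have C: "C \<in> carrier_mat n n" "C * A = 1\<^sub>m n" using assms by (auto simp: inverts_mat_def)
  have "C = C * (A * B)" using C assms by simp
  also have "\<dots> = C * A * B" using C assms by (intro assoc_mult_mat[symmetric])
  also have "\<dots> = B" unfolding C(2) using assms(2) by simp
  finally show "C = B" .
qed

text \<open>Cramer's rule survives in the skew field because all entries are polynomials in the
  single operator \<open>T\<close>: they commute with each other and with the inverse of the
  determinant.\<close>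

lemma inv_mat_shift:
  assumes M: "M \<in> carrier_mat n n" and d: "eval_at (shift_det M) T \<noteq> 0"
  shows "inv_mat (shift_mat M T) = Matrix.mat n n (\<lambda>(i, j). eval_at (adj_mat (pencil M) $$ (i, j)) T * inverse (eval_at (shift_det M) T))"
    (is "_ = ?B")
proof (rule inv_mat_eqI)
  let ?d = "eval_at (shift_det M) T"
  show S: "shift_mat M T \<in> carrier_mat n n" using M by (rule shift_mat_carrier)
  show B: "?B \<in> carrier_mat n n" by simp
  have comm: "inverse ?d * eval_at p T = eval_at p T * inverse ?d" for p
  proof -
    have "?d * eval_at p T = eval_at p T * ?d" by (metis eval_at_mult mult.commute)
    then have "inverse ?d * (?d * eval_at p T) * inverse ?d = inverse ?d * (eval_at p T * ?d) * inverse ?d" by simp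
    moreover have "inverse ?d * (?d * eval_at p T) = eval_at p T"
      using d by (simp add: mult.assoc[symmetric])
    moreover have "inverse ?d * (eval_at p T * ?d) * inverse ?d = inverse ?d * eval_at p T"
      using d by (simp add: mult.assoc)
    ultimately show ?thesis by simp
  qed
  show "shift_mat M T * ?B = 1\<^sub>m n"
  proof (rule eq_matI)
    fix i j assume "i < dim_row (1\<^sub>m n :: pdo mat)" "j < dim_col (1\<^sub>m n :: pdo mat)"
    then have ij: "i < n" "j < n" by auto
    have "(shift_mat M T * ?B) $$ (i, j) = (\<Sum>k<n. eval_at (pencil M $$ (i, k) * adj_mat (pencil M) $$ (k, j)) T) * inverse ?d"
      using ij by (simp add: mat_mult_entry[OF S B ij] shift_mat_entry[OF M] eval_at_mult sum_distrib_right mult.assoc)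
    also have "\<dots> = eval_at (if i = j then shift_det M else 0) T * inverse ?d"
      by (simp only: eval_at_sum[symmetric] pencil_adj[OF M ij])
    also have "\<dots> = (1\<^sub>m n :: pdo mat) $$ (i, j)" using ij d by auto
    finally show "(shift_mat M T * ?B) $$ (i, j) = (1\<^sub>m n :: pdo mat) $$ (i, j)" .
  qed (use S in auto)
  show "?B * shift_mat M T = 1\<^sub>m n"
  proof (rule eq_matI)
    fix i j assume "i < dim_row (1\<^sub>m n :: pdo mat)" "j < dim_col (1\<^sub>m n :: pdo mat)"
    then have ij: "i < n" "j < n" by auto
    have "(?B * shift_mat M T) $$ (i, j) = (\<Sum>k<n. eval_at (adj_mat (pencil M) $$ (i, k) * pencil M $$ (k, j)) T) * inverse ?d"
      using ij by (simp add: mat_mult_entry[OF B S ij] shift_mat_entry[OF M] eval_at_mult sum_distrib_right mult.assoc comm)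
    also have "\<dots> = eval_at (if i = j then shift_det M else 0) T * inverse ?d"
      by (simp only: eval_at_sum[symmetric] pencil_adj[OF M ij])
    also have "\<dots> = (1\<^sub>m n :: pdo mat) $$ (i, j)" using ij d by auto
    finally show "(?B * shift_mat M T) $$ (i, j) = (1\<^sub>m n :: pdo mat) $$ (i, j)" .
  qed (use S in auto)
qed

lemma smult_sum2: "smult c (sum f A) = (\<Sum>x\<in>A. smult c (f x))"
  by (induction A rule: infinite_finite_induct) (auto simp: smult_add_right)

text \<open>The factored relation makes sense for \<open>n = 0\<close> as well, so the point
  \<open>\<C>\<^sub>0\<close> needs no separate argument.\<close>

locale cm_data =
  fixes n :: nat and X Y v w :: "complex mat"
  assumes X: "X \<in> carrier_mat n n" and Y: "Y \<in> carrier_mat n n"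
    and v: "v \<in> carrier_mat n 1" and w: "w \<in> carrier_mat 1 n"
    and rel: "X * Y - Y * X + 1\<^sub>m n = v * w"
begin

abbreviation dX where "dX \<equiv> shift_det X"
abbreviation dY where "dY \<equiv> shift_det Y"

definition vv :: "nat \<Rightarrow> pdo" where "vv k = pconst (v $$ (k, 0))"
definition ww :: "nat \<Rightarrow> pdo" where "ww k = pconst (w $$ (0, k))"

definition Uop :: "(nat \<Rightarrow> pdo) \<Rightarrow> nat \<Rightarrow> pdo"
  where "Uop s k = (\<Sum>l<n. pconst (Y $$ (k, l)) * s l) - pZ * s k"

definition Top :: "(nat \<Rightarrow> pdo) \<Rightarrow> nat \<Rightarrow> pdo"
  where "Top r k = (\<Sum>l<n. pconst (X $$ (k, l)) * r l) - pD * r k"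

lemma rel_entry:
  assumes "i < n" "j < n"
  shows "(\<Sum>k<n. X $$ (i, k) * Y $$ (k, j)) - (\<Sum>k<n. Y $$ (i, k) * X $$ (k, j)) + (if i = j then 1 else 0)
    = v $$ (i, 0) * w $$ (0, j)"
proof -
  have "(X * Y - Y * X + 1\<^sub>m n) $$ (i, j) = (v * w) $$ (i, j)" by (simp only: rel)
  moreover have "(X * Y - Y * X + 1\<^sub>m n) $$ (i, j) = (X * Y) $$ (i, j) - (Y * X) $$ (i, j) + (if i = j then 1 else 0)"
    using X Y assms by simp
  ultimately show ?thesis
    using mat_mult_entry[OF X Y assms] mat_mult_entry[OF Y X assms] mat_mult_entry[OF v w assms] by simp
qed

lemma Uop_pencil: "k < n \<Longrightarrow> Uop s k = (\<Sum>l<n. eval_at (pencil Y $$ (k, l)) pZ * s l)"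
  by (simp add: Uop_def pencil_sum[OF Y])

lemma Top_pencil: "k < n \<Longrightarrow> Top s k = (\<Sum>l<n. eval_at (pencil X $$ (k, l)) pD * s l)"
  by (simp add: Top_def pencil_sum[OF X])

text \<open>\<open>[X - \<partial>, Y - z] = [X, Y] + [\<partial>, z] = [X, Y] + 1 = v w\<close>;
  the mixed commutators vanish because matrix entries are central.\<close>

lemma Top_Uop:
  assumes k: "k < n"
  shows "Top (Uop c) k = Uop (Top c) k + vv k * (\<Sum>l<n. ww l * c l)"
proof -
  have mm: "(\<Sum>l<n. pconst (A $$ (k, l)) * ((\<Sum>m<n. pconst (B $$ (l, m)) * c m) - T * c l))
    = (\<Sum>m<n. pconst (\<Sum>l<n. A $$ (k, l) * B $$ (l, m)) * c m) - T * (\<Sum>l<n. pconst (A $$ (k, l)) * c l)" for A B T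
  proof -
    have "(\<Sum>l<n. pconst (A $$ (k, l)) * (T * c l)) = T * (\<Sum>l<n. pconst (A $$ (k, l)) * c l)"
      unfolding sum_distrib_left by (rule sum.cong) (metis mult.assoc pconst_commute)+
    moreover have "(\<Sum>l<n. pconst (A $$ (k, l)) * (\<Sum>m<n. pconst (B $$ (l, m)) * c m))
      = (\<Sum>m<n. pconst (\<Sum>l<n. A $$ (k, l) * B $$ (l, m)) * c m)"
      unfolding sum_distrib_left pconst_sum sum_distrib_right pconst_mult
      by (subst sum.swap) (simp add: mult.assoc)
    ultimately show ?thesis by (simp add: right_diff_distrib sum_subtractf)
  qed
  have pc: "pD * (pZ * c k) = pZ * (pD * c k) + c k"
    using pD_pZ by (simp add: mult.assoc[symmetric] distrib_right)
  have "Top (Uop c) k - Uop (Top c) k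
    = (\<Sum>m<n. pconst (\<Sum>l<n. X $$ (k, l) * Y $$ (l, m)) * c m) - (\<Sum>m<n. pconst (\<Sum>l<n. Y $$ (k, l) * X $$ (l, m)) * c m) + c k"
    unfolding Top_def[of "Uop c"] Uop_def[of "Top c"] Uop_def[of c] Top_def[of c] mm
    by (simp add: right_diff_distrib pc)
  also have "\<dots> = (\<Sum>m<n. pconst (\<Sum>l<n. X $$ (k, l) * Y $$ (l, m)) * c m - pconst (\<Sum>l<n. Y $$ (k, l) * X $$ (l, m)) * c m
       + (if k = m then c m else 0))"
    using k by (simp add: sum.distrib sum_subtractf sum.delta')
  also have "\<dots> = (\<Sum>m<n. pconst (v $$ (k, 0) * w $$ (0, m)) * c m)"
    by (rule sum.cong) (simp_all add: rel_entry[OF k, symmetric] pconst_add pconst_diff distrib_right left_diff_distrib)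
  also have "\<dots> = vv k * (\<Sum>l<n. ww l * c l)"
    by (simp add: vv_def ww_def pconst_mult sum_distrib_left mult.assoc)
  finally show ?thesis by (simp add: algebra_simps)
qed

lemma Uop_add: "Uop (\<lambda>l. a l + b l) k = Uop a k + Uop b k"
  by (simp add: Uop_def distrib_left sum.distrib)
lemma Uop_diff: "Uop (\<lambda>l. a l - b l) k = Uop a k - Uop b k"
  by (simp add: Uop_def right_diff_distrib sum_subtractf)
lemma Top_add: "Top (\<lambda>l. a l + b l) k = Top a k + Top b k"
  by (simp add: Top_def distrib_left sum.distrib)
lemma Top_uminus: "Top (\<lambda>l. - a l) k = - Top a k"
  by (simp add: Top_def sum_negf)
lemma Uop_mult_right: "Uop (\<lambda>l. a l * b) k = Uop a k * b"
  by (simp add: Uop_def sum_distrib_right mult.assoc left_diff_distrib)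
lemma Top_mult_right: "Top (\<lambda>l. a l * b) k = Top a k * b"
  by (simp add: Top_def sum_distrib_right mult.assoc left_diff_distrib)
lemma Top_cong: "(\<And>l. l < n \<Longrightarrow> a l = b l) \<Longrightarrow> k < n \<Longrightarrow> Top a k = Top b k"
  by (simp add: Top_def)

text \<open>The row vector \<open>w (Y - z)^-1\<close>, written with Cramer's rule.\<close>

definition uf :: "nat \<Rightarrow> ratfun"
  where "uf k = to_fract (\<Sum>l<n. smult (w $$ (0, l)) (adj_mat (pencil Y) $$ (l, k))) / to_fract dY"

definition u :: "nat \<Rightarrow> pdo" where "u k = pfun (uf k)"

lemma to_fract_dY: "to_fract dY \<noteq> 0" using shift_det_nonzero[OF Y] by simp

text \<open>In matrix form \<open>u U = w\<close>, from \<open>adj(U) U = det U\<close> divided by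
  the determinant.\<close>

lemma sum_u_Uop: "(\<Sum>k<n. u k * Uop c k) = (\<Sum>l<n. ww l * c l)"
proof -
  have key: "(\<Sum>k<n. uf k * to_fract (pencil Y $$ (k, l))) = to_fract [:w $$ (0, l):]" if l: "l < n" for l
  proof -
    have "(\<Sum>k<n. (\<Sum>m<n. smult (w $$ (0, m)) (adj_mat (pencil Y) $$ (m, k))) * pencil Y $$ (k, l))
      = (\<Sum>m<n. smult (w $$ (0, m)) (\<Sum>k<n. adj_mat (pencil Y) $$ (m, k) * pencil Y $$ (k, l)))"
      unfolding sum_distrib_right by (subst sum.swap) (simp add: smult_sum2)
    also have "\<dots> = (\<Sum>m<n. smult (w $$ (0, m)) (if m = l then dY else 0))"
      by (rule sum.cong) (simp_all add: pencil_adj[OF Y _ l])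
    also have "\<dots> = (\<Sum>m<n. if m = l then smult (w $$ (0, l)) dY else 0)"
      by (rule sum.cong) auto
    also have "\<dots> = smult (w $$ (0, l)) dY" using l by simp
    finally have s: "(\<Sum>k<n. (\<Sum>m<n. smult (w $$ (0, m)) (adj_mat (pencil Y) $$ (m, k))) * pencil Y $$ (k, l))
       = [:w $$ (0, l):] * dY" by simp
    have "(\<Sum>k<n. uf k * to_fract (pencil Y $$ (k, l)))
       = (\<Sum>k<n. to_fract ((\<Sum>m<n. smult (w $$ (0, m)) (adj_mat (pencil Y) $$ (m, k))) * pencil Y $$ (k, l))) / to_fract dY"
      unfolding uf_def sum_divide_distrib by (rule sum.cong) simp_all
    also have "\<dots> = to_fract ([:w $$ (0, l):] * dY) / to_fract dY" by (simp only: to_fract_sum[symmetric] s)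
    also have "\<dots> = to_fract [:w $$ (0, l):]" using to_fract_dY by (simp only: to_fract_mult) simp
    finally show ?thesis .
  qed
  have "(\<Sum>k<n. u k * Uop c k) = (\<Sum>k<n. \<Sum>l<n. pfun (uf k * to_fract (pencil Y $$ (k, l))) * c l)"
    by (rule sum.cong) (simp_all add: Uop_pencil u_def eval_at_pZ sum_distrib_left pfun_mult mult.assoc)
  also have "\<dots> = (\<Sum>l<n. (\<Sum>k<n. pfun (uf k * to_fract (pencil Y $$ (k, l)))) * c l)"
    by (subst sum.swap) (simp add: sum_distrib_right)
  also have "\<dots> = (\<Sum>l<n. ww l * c l)"
  proof (rule sum.cong[OF refl])
    fix l assume l: "l \<in> {..<n}"
    show "(\<Sum>k<n. pfun (uf k * to_fract (pencil Y $$ (k, l)))) * c l = ww l * c l"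
      using key l by (simp add: pfun_sum[symmetric] ww_def pconst_def)
  qed
  finally show ?thesis .
qed

text \<open>This is \<open>- adj(X - \<partial>) v\<close>, chosen so that
  \<open>T r + v det T = 0\<close>.\<close>

definition rX :: "nat \<Rightarrow> pdo"
  where "rX k = - (\<Sum>j<n. eval_at (adj_mat (pencil X) $$ (k, j)) pD * vv j)"

text \<open>The factor \<open>det(X - \<partial>)\<close> on the right cancels the denominator of
  the inverse of \<open>X - \<partial>\<close>, which leaves its adjugate.\<close>

lemma kappa_dX: "kappa X Y v w * eval_at dX pD = eval_at dX pD + (\<Sum>k<n. u k * rX k)"
proof -
  let ?IY = "inv_mat (shift_mat Y pZ)" and ?IX = "inv_mat (shift_mat X pD)"
  have dX0: "eval_at dX pD \<noteq> 0" and dY0: "eval_at dY pZ \<noteq> 0"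
    using shift_det_nonzero[OF X] shift_det_nonzero[OF Y] by (simp_all add: eval_at_pZ)
  note IX = inv_mat_shift[OF X dX0] and IY = inv_mat_shift[OF Y dY0]
  have c: "?IX \<in> carrier_mat n n" "?IY \<in> carrier_mat n n" by (simp_all add: IX IY)
  have cw: "map_mat pconst w \<in> carrier_mat 1 n" "map_mat pconst v \<in> carrier_mat n 1" using w v by auto
  have z: "(0::nat) < 1" by simp
  have inv: "inverse (eval_at dY pZ) = pfun (inverse (to_fract dY))"
  proof -
    have "eval_at dY pZ * pfun (inverse (to_fract dY)) = 1"
      using to_fract_dY by (simp add: eval_at_pZ pfun_mult[symmetric])
    then show ?thesis by (rule inverse_unique)
  qed
  have wIY: "(map_mat pconst w * ?IY) $$ (0, k) = u k" if k: "k < n" for k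
  proof -
    have "(map_mat pconst w * ?IY) $$ (0, k) = (\<Sum>l<n. pfun (to_fract (smult (w $$ (0, l)) (adj_mat (pencil Y) $$ (l, k)))) * pfun (inverse (to_fract dY)))"
      unfolding mat_mult_entry[OF cw(1) c(2) z k]
    proof (rule sum.cong[OF refl])
      fix l assume "l \<in> {..<n}"
      then have l: "l < n" by simp
      have "pconst (w $$ (0, l)) * eval_at (adj_mat (pencil Y) $$ (l, k)) pZ = eval_at (smult (w $$ (0, l)) (adj_mat (pencil Y) $$ (l, k))) pZ"
        by (simp add: eval_at_smult)
      then show "map_mat pconst w $$ (0, l) * ?IY $$ (l, k) = pfun (to_fract (smult (w $$ (0, l)) (adj_mat (pencil Y) $$ (l, k)))) * pfun (inverse (to_fract dY))"
        using w k l by (simp add: IY inv[unfolded eval_at_pZ] mult.assoc[symmetric] eval_at_pZ)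
    qed
    also have "\<dots> = pfun ((\<Sum>l<n. to_fract (smult (w $$ (0, l)) (adj_mat (pencil Y) $$ (l, k)))) * inverse (to_fract dY))"
      by (simp only: pfun_mult[symmetric] pfun_sum[symmetric] sum_distrib_right)
    also have "\<dots> = u k" by (simp add: u_def uf_def to_fract_sum divide_inverse)
    finally show ?thesis .
  qed
  have cIY: "map_mat pconst w * ?IY \<in> carrier_mat 1 n" using cw c by (rule_tac mult_carrier_mat)
  have "(map_mat pconst w * ?IY * ?IX * map_mat pconst v) $$ (0, 0) = (map_mat pconst w * ?IY * (?IX * map_mat pconst v)) $$ (0, 0)"
    using assoc_mult_mat[OF cIY c(1) cw(2)] by simp
  also have "\<dots> = (\<Sum>k<n. u k * (?IX * map_mat pconst v) $$ (k, 0))"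
    using mat_mult_entry[OF cIY mult_carrier_mat[OF c(1) cw(2)], of 0 0] wIY by simp
  also have "\<dots> = (\<Sum>k<n. u k * (- rX k * inverse (eval_at dX pD)))"
  proof (rule sum.cong[OF refl])
    fix k assume "k \<in> {..<n}"
    then have k: "k < n" by simp
    have "(?IX * map_mat pconst v) $$ (k, 0) = (\<Sum>j<n. eval_at (adj_mat (pencil X) $$ (k, j)) pD * vv j * inverse (eval_at dX pD))"
      unfolding mat_mult_entry[OF c(1) cw(2) k z]
    proof (rule sum.cong[OF refl])
      fix j assume "j \<in> {..<n}"
      then show "?IX $$ (k, j) * map_mat pconst v $$ (j, 0) = eval_at (adj_mat (pencil X) $$ (k, j)) pD * vv j * inverse (eval_at dX pD)"
        using k v by (simp add: IX vv_def mult.assoc pconst_commute)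
    qed
    then show "u k * (?IX * map_mat pconst v) $$ (k, 0) = u k * (- rX k * inverse (eval_at dX pD))"
      by (simp add: rX_def sum_distrib_right)
  qed
  finally have "kappa X Y v w = 1 + (\<Sum>k<n. u k * rX k) * inverse (eval_at dX pD)"
    by (simp add: kappa_def sum_distrib_right mult.assoc sum_negf)
  then show ?thesis using dX0 by (simp add: distrib_right mult.assoc)
qed

lemma Top_rX: "k < n \<Longrightarrow> Top rX k + vv k * eval_at dX pD = 0"
proof -
  assume k: "k < n"
  have "Top rX k = - (\<Sum>l<n. \<Sum>j<n. eval_at (pencil X $$ (k, l) * adj_mat (pencil X) $$ (l, j)) pD * vv j)"
    by (simp add: Top_pencil[OF k] rX_def sum_distrib_left sum_negf eval_at_mult mult.assoc)
  also have "\<dots> = - (\<Sum>j<n. eval_at (\<Sum>l<n. pencil X $$ (k, l) * adj_mat (pencil X) $$ (l, j)) pD * vv j)"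
    by (subst sum.swap) (simp add: eval_at_sum sum_distrib_right)
  also have "\<dots> = - (\<Sum>j<n. if j = k then eval_at dX pD * vv k else 0)"
    by (rule arg_cong[of _ _ uminus], rule sum.cong) (auto simp: pencil_adj[OF X k])
  also have "\<dots> = - (vv k * eval_at dX pD)" using k by (simp add: vv_def pconst_commute)
  finally show ?thesis by simp
qed

text \<open>This is \<open>adj(Y - z) v\<close>, the witness that \<open>det(Y - z)\<close> belongs
  to the module with \<open>r = 0\<close>.\<close>

definition sY :: "nat \<Rightarrow> pdo"
  where "sY k = (\<Sum>j<n. eval_at (adj_mat (pencil Y) $$ (k, j)) pZ * vv j)"

lemma Uop_sY: "k < n \<Longrightarrow> Uop sY k = vv k * eval_at dY pZ"
proof -
  assume k: "k < n"
  have "Uop sY k = (\<Sum>l<n. \<Sum>j<n. eval_at (pencil Y $$ (k, l) * adj_mat (pencil Y) $$ (l, j)) pZ * vv j)"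
    by (simp add: Uop_pencil[OF k] sY_def sum_distrib_left eval_at_mult mult.assoc)
  also have "\<dots> = (\<Sum>j<n. eval_at (\<Sum>l<n. pencil Y $$ (k, l) * adj_mat (pencil Y) $$ (l, j)) pZ * vv j)"
    by (subst sum.swap) (simp add: eval_at_sum sum_distrib_right)
  also have "\<dots> = (\<Sum>j<n. if j = k then eval_at dY pZ * vv k else 0)"
    by (rule sum.cong) (auto simp: pencil_adj[OF Y k])
  also have "\<dots> = vv k * eval_at dY pZ" using k by (simp add: vv_def pconst_commute)
  finally show ?thesis .
qed

lemma weyl_vv: "vv k \<in> weyl" by (simp add: vv_def weyl_pconst)
lemma weyl_ww: "ww k \<in> weyl" by (simp add: ww_def weyl_pconst)
lemma weyl_sY: "sY k \<in> weyl" unfolding sY_def eval_at_pZ by (intro weyl_intros weyl_vv)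
lemma weyl_rX: "rX k \<in> weyl" unfolding rX_def by (intro weyl_intros weyl_vv weyl_eval_pD)

lemma weyl_Uop: "(\<And>l. l < n \<Longrightarrow> s l \<in> weyl) \<Longrightarrow> k < n \<Longrightarrow> Uop s k \<in> weyl"
  unfolding Uop_def by (intro weyl_intros) auto
lemma weyl_Top: "(\<And>l. l < n \<Longrightarrow> s l \<in> weyl) \<Longrightarrow> k < n \<Longrightarrow> Top s k \<in> weyl"
  unfolding Top_def by (intro weyl_intros) auto

end

lemma pairing_monomial:
  "pairing (pfun (to_fract p) * pD ^ i) e = (\<Sum>j\<le>degree p. coeff p j * e i j)"
proof -
  let ?P = "pfun (to_fract p) * pD ^ i"
  let ?N = "Suc (max i (degree p))"
  have wc: "wcoeff ?P m = (if m = i then p else 0)" for m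
    by (rule wcoeff_eqI) (auto simp: pcoeff_pfun simp del: pcoeff_pfun_mult)
  have "bnd ?N ?P" unfolding bnd_def wc by (auto simp: coeff_eq_0)
  then have "pairing ?P e = (\<Sum>m<?N. \<Sum>j<?N. coeff (wcoeff ?P m) j * e m j)"
    by (rule pairing_eq)
  also have "\<dots> = (\<Sum>m<?N. if m = i then \<Sum>j<?N. coeff p j * e i j else 0)"
    by (rule sum.cong) (auto simp: wc)
  also have "\<dots> = (\<Sum>j<?N. coeff p j * e i j)" by (subst sum.delta) auto
  also have "\<dots> = (\<Sum>j\<le>degree p. coeff p j * e i j)"
    by (rule sum.mono_neutral_right) (auto simp: coeff_eq_0)
  finally show ?thesis .
qed

lemma weyl_monomial: "pfun (to_fract p) * pD ^ i \<in> weyl" by (intro weyl_intros)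

lemma weyl_lincomb: "(\<And>l. l < (n::nat) \<Longrightarrow> s l \<in> weyl) \<Longrightarrow> (\<Sum>l<n. pconst (c l) * s l) \<in> weyl"
  by (intro weyl_intros) auto

lemma pairing_lincomb:
  "(\<And>l. l < (n::nat) \<Longrightarrow> s l \<in> weyl) \<Longrightarrow> pairing (\<Sum>l<n. pconst (c l) * s l) e = (\<Sum>l<n. c l * pairing (s l) e)"
  by (subst pairing_sum) (auto simp: pairing_pconst weyl_pconst intro: weyl_mult)

lemma wcoeff_lincomb:
  "(\<And>l. l < (n::nat) \<Longrightarrow> s l \<in> weyl) \<Longrightarrow> wcoeff (\<Sum>l<n. pconst (c l) * s l) i = (\<Sum>l<n. smult (c l) (wcoeff (s l) i))"
  by (subst wcoeff_sum) (auto simp: wcoeff_pconst weyl_pconst intro: weyl_mult)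

text \<open>In characteristic zero each derivative lowers the degree by exactly one until a nonzero
  constant is reached. This stands in twice for the absence of nonzero finite-dimensional modules:
  for the annihilator of a quotient of right modules, and for the cyclicity of
  \<open>v\<close>.\<close>

lemma pderiv_descent:
  fixes p :: "complex poly"
  assumes "p \<noteq> 0" "P p" "\<And>p. P p \<Longrightarrow> P (pderiv p)"
  shows "\<exists>c. c \<noteq> 0 \<and> P [:c:]"
  using assms(1,2)
proof (induction "degree p" arbitrary: p rule: less_induct)
  case less
  show ?case
  proof (cases "degree p = 0")
    case True
    then obtain c where "p = [:c:]" by (metis degree_eq_zeroE)
    then show ?thesis using less.prems by auto
  next
    case False
    then have "pderiv p \<noteq> 0" by (simp add: pderiv_eq_0_iff)
    moreover have "degree (pderiv p) < degree p" using False by (simp add: degree_pderiv)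
    ultimately show ?thesis using less.hyps less.prems assms(3) by blast
  qed
qed

section \<open>The solution module and the two generators of the ideal\<close>

context cm_data
begin

abbreviation cst :: "(nat \<Rightarrow> complex poly) \<Rightarrow> nat \<Rightarrow> pdo"
  where "cst p k \<equiv> eval_at (p k) pD"

text \<open>The kernel of \<open>(T, v, -U) : A\<^sup>2\<^sup>n\<^sup>+\<^sup>1 \<rightarrow> A\<^sup>n\<close>; \<open>elt\<close> maps it onto the ideal, with \<open>u = w U\<^sup>-\<^sup>1\<close>.\<close>
definition mem :: "pdo \<Rightarrow> (nat \<Rightarrow> pdo) \<Rightarrow> (nat \<Rightarrow> pdo) \<Rightarrow> bool"
  where "mem a r s \<longleftrightarrow> a \<in> weyl \<and> (\<forall>k<n. r k \<in> weyl) \<and> (\<forall>k<n. s k \<in> weyl)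
     \<and> (\<forall>k<n. Top r k + vv k * a = Uop s k)"

definition elt :: "pdo \<Rightarrow> (nat \<Rightarrow> pdo) \<Rightarrow> pdo"
  where "elt a r = a + (\<Sum>k<n. u k * r k)"

definition M0 :: "pdo set" where "M0 = {elt a r | a r. \<exists>s. mem a r s}"

lemma M0I: "mem a r s \<Longrightarrow> elt a r \<in> M0" by (auto simp: M0_def)

lemma M0_module: "right_weyl_module M0"
  unfolding right_weyl_module_def
proof (intro conjI ballI)
  have "mem 0 (\<lambda>_. 0) (\<lambda>_. 0)" by (simp add: mem_def Top_def Uop_def)
  then have "elt 0 (\<lambda>_. 0) \<in> M0" by (rule M0I)
  then show "0 \<in> M0" by (simp add: elt_def)
next
  fix x y assume "x \<in> M0" "y \<in> M0"
  then obtain a r s a' r' s' where *: "mem a r s" "x = elt a r" "mem a' r' s'" "y = elt a' r'"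
    by (auto simp: M0_def)
  have "mem (a + a') (\<lambda>l. r l + r' l) (\<lambda>l. s l + s' l)"
    unfolding mem_def
  proof (intro conjI allI impI)
    fix k assume "k < n"
    then have "Top r k + vv k * a = Uop s k" "Top r' k + vv k * a' = Uop s' k" using * by (auto simp: mem_def)
    then show "Top (\<lambda>l. r l + r' l) k + vv k * (a + a') = Uop (\<lambda>l. s l + s' l) k"
      unfolding Top_add Uop_add by (simp add: algebra_simps)
  qed (use * in \<open>auto simp: mem_def intro: weyl_add\<close>)
  moreover have "x + y = elt (a + a') (\<lambda>l. r l + r' l)"
    by (simp add: * elt_def distrib_left sum.distrib)
  ultimately show "x + y \<in> M0" using M0I by simp
next
  fix x b assume "x \<in> M0" and b: "b \<in> weyl"
  then obtain a r s where *: "mem a r s" "x = elt a r" by (auto simp: M0_def)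
  have "mem (a * b) (\<lambda>l. r l * b) (\<lambda>l. s l * b)"
    unfolding mem_def
  proof (intro conjI allI impI)
    fix k assume "k < n"
    then have "Top r k + vv k * a = Uop s k" using * by (auto simp: mem_def)
    then show "Top (\<lambda>l. r l * b) k + vv k * (a * b) = Uop (\<lambda>l. s l * b) k"
      unfolding Top_mult_right Uop_mult_right by (metis distrib_right mult.assoc)
  qed (use * b in \<open>auto simp: mem_def intro: weyl_mult\<close>)
  moreover have "x * b = elt (a * b) (\<lambda>l. r l * b)"
    by (simp add: * elt_def distrib_right sum_distrib_right mult.assoc)
  ultimately show "x * b \<in> M0" using M0I by simp
qed

lemma M0_add: "x \<in> M0 \<Longrightarrow> y \<in> M0 \<Longrightarrow> x + y \<in> M0"
  and M0_mult: "x \<in> M0 \<Longrightarrow> a \<in> weyl \<Longrightarrow> x * a \<in> M0"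
  using M0_module by (auto simp: right_weyl_module_def)

lemma M0_diff: "x \<in> M0 \<Longrightarrow> y \<in> M0 \<Longrightarrow> x - y \<in> M0"
  using M0_add[of x "y * (- 1)"] M0_mult[of y "- 1"] weyl_uminus[OF weyl_1] by simp

lemma dY_in_M0: "eval_at dY pZ \<in> M0"
proof -
  have "mem (eval_at dY pZ) (\<lambda>_. 0) sY"
    by (simp add: mem_def eval_at_pZ weyl_pfun weyl_sY Uop_sY Top_def)
  then have "elt (eval_at dY pZ) (\<lambda>_. 0) \<in> M0" by (rule M0I)
  then show ?thesis by (simp add: elt_def)
qed

lemma mem_kappa: "mem (eval_at dX pD) rX (\<lambda>_. 0)"
  by (simp add: mem_def weyl_eval_pD weyl_rX Top_rX Uop_def)

abbreviation gX where "gX \<equiv> kappa X Y v w * eval_at dX pD"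

lemma kappa_in_M0: "gX \<in> M0"
  using M0I[OF mem_kappa] by (simp add: kappa_dX elt_def)

abbreviation M where "M \<equiv> cm_ideal X Y v w"

lemma M_subset_M0: "M \<subseteq> M0"
  unfolding cm_ideal_def using dY_in_M0 kappa_in_M0 by (auto intro: M0_add M0_mult)

lemma M_add: "x \<in> M \<Longrightarrow> y \<in> M \<Longrightarrow> x + y \<in> M"
proof -
  assume "x \<in> M" "y \<in> M"
  then obtain a b a' b' where "x = eval_at dY pZ * a + gX * b"
     "y = eval_at dY pZ * a' + gX * b'" "a \<in> weyl" "b \<in> weyl" "a' \<in> weyl" "b' \<in> weyl"
    by (auto simp: cm_ideal_def)
  then have "x + y = eval_at dY pZ * (a + a') + gX * (b + b')"
     "a + a' \<in> weyl" "b + b' \<in> weyl" by (auto simp: algebra_simps weyl_add)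
  then show ?thesis unfolding cm_ideal_def by blast
qed

lemma M_mult: "x \<in> M \<Longrightarrow> c \<in> weyl \<Longrightarrow> x * c \<in> M"
proof -
  assume "x \<in> M" and c: "c \<in> weyl"
  then obtain a b where "x = eval_at dY pZ * a + gX * b" "a \<in> weyl" "b \<in> weyl"
    by (auto simp: cm_ideal_def)
  then have "x * c = eval_at dY pZ * (a * c) + gX * (b * c)"
     "a * c \<in> weyl" "b * c \<in> weyl" using c by (auto simp: algebra_simps weyl_mult)
  then show ?thesis unfolding cm_ideal_def by blast
qed

lemma M_diff: "x \<in> M \<Longrightarrow> y \<in> M \<Longrightarrow> x - y \<in> M"
  using M_add[of x "y * (- 1)"] M_mult[of y "- 1"] weyl_uminus[OF weyl_1] by simp

lemma M_gens: "c \<in> weyl \<Longrightarrow> eval_at dY pZ * c \<in> M"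
  "c \<in> weyl \<Longrightarrow> gX * c \<in> M"
proof -
  assume c: "c \<in> weyl"
  have "eval_at dY pZ * c = eval_at dY pZ * c + gX * 0" by simp
  then show "eval_at dY pZ * c \<in> M" unfolding cm_ideal_def using c weyl_0 by blast
next
  assume c: "c \<in> weyl"
  have "gX * c = eval_at dY pZ * 0 + gX * c" by simp
  then show "gX * c \<in> M" unfolding cm_ideal_def using c weyl_0 by blast
qed

section \<open>Functionals on vectors of operators, and the normal form of elements\<close>

definition row :: "complex mat \<Rightarrow> (nat \<Rightarrow> complex) \<Rightarrow> nat \<Rightarrow> complex"
  where "row A \<xi> m = (if m < n then \<Sum>k<n. \<xi> k * A $$ (k, m) else 0)"

text \<open>\<open>rows \<xi> i j\<close> is the row vector \<open>\<xi> X\<^sup>i Y\<^sup>j\<close>, so \<open>yy \<xi> i j = \<xi> X\<^sup>i Y\<^sup>j v\<close>; rows are zero-extended functions on \<open>nat\<close>.\<close>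
definition rows :: "(nat \<Rightarrow> complex) \<Rightarrow> nat \<Rightarrow> nat \<Rightarrow> nat \<Rightarrow> complex"
  where "rows \<xi> i j = (row Y ^^ j) ((row X ^^ i) \<xi>)"

definition yy :: "(nat \<Rightarrow> complex) \<Rightarrow> nat \<Rightarrow> nat \<Rightarrow> complex"
  where "yy \<xi> i j = (\<Sum>k<n. rows \<xi> i j k * v $$ (k, 0))"

definition supp :: "(nat \<Rightarrow> complex) \<Rightarrow> bool" where "supp \<xi> \<longleftrightarrow> (\<forall>m\<ge>n. \<xi> m = 0)"

text \<open>A linear subspace of codimension n, hence for n > 0 not a right ideal; it is its leading
  coefficients that agree with those of \<open>M0\<close>.\<close>

definition K :: "pdo set" where "K = {a \<in> weyl. \<forall>\<xi>. supp \<xi> \<longrightarrow> pairing a (yy \<xi>) = 0}"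

abbreviation psum :: "(nat \<Rightarrow> pdo) \<Rightarrow> (nat \<Rightarrow> nat \<Rightarrow> nat \<Rightarrow> complex) \<Rightarrow> complex"
  where "psum y e \<equiv> \<Sum>k<n. pairing (y k) (\<lambda>i j. e i j k)"

text \<open>Left multiplication by z shifts the second index of the array, and by hypothesis so does
  \<open>Y\<close>; hence the functional kills the image of \<open>Y - z\<close>. The array is kept
  general because truncations of \<open>rows\<close> are used too.\<close>

lemma pairing_Uop:
  assumes e: "\<And>i j m. m < n \<Longrightarrow> (\<Sum>k<n. e i j k * Y $$ (k, m)) = e i (Suc j) m"
    and s: "\<And>k. k < n \<Longrightarrow> s k \<in> weyl"
  shows "psum (Uop s) e = 0"
proof -
  have "(\<Sum>k<n. pairing (Uop s k) (\<lambda>i j. e i j k))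
     = (\<Sum>k<n. (\<Sum>l<n. Y $$ (k, l) * pairing (s l) (\<lambda>i j. e i j k)) - pairing (s k) (\<lambda>i j. e i (Suc j) k))"
    unfolding Uop_def
    by (rule sum.cong) (simp_all add: pairing_diff pairing_lincomb pairing_pZ s weyl_lincomb weyl_mult weyl_pZ)
  also have "\<dots> = (\<Sum>l<n. \<Sum>k<n. Y $$ (k, l) * pairing (s l) (\<lambda>i j. e i j k)) - (\<Sum>k<n. pairing (s k) (\<lambda>i j. e i (Suc j) k))"
    unfolding sum_subtractf by (subst sum.swap) simp
  also have "(\<Sum>l<n. \<Sum>k<n. Y $$ (k, l) * pairing (s l) (\<lambda>i j. e i j k)) = (\<Sum>l<n. pairing (s l) (\<lambda>i j. e i (Suc j) l))"
    unfolding pairing_array_sum by (rule sum.cong) (simp_all add: mult.commute[of "Y $$ _"] e)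
  finally show ?thesis by simp
qed

text \<open>Constant-coefficient operators meet only entries with second index 0, so compatibility
  with \<open>X\<close> is demanded just there.\<close>

lemma pairing_Top:
  assumes e: "\<And>i m. m < n \<Longrightarrow> (\<Sum>k<n. e i 0 k * X $$ (k, m)) = e (Suc i) 0 m"
  shows "psum (Top (cst p)) e = 0"
proof -
  have p0: "pairing (eval_at q pD) f = pairing (eval_at q pD) g" if "\<And>i. f i 0 = g i 0" for q f g
    using that by (simp add: pairing_eval_pD)
  have "(\<Sum>k<n. pairing (Top (cst p) k) (\<lambda>i j. e i j k))
     = (\<Sum>k<n. (\<Sum>l<n. X $$ (k, l) * pairing (eval_at (p l) pD) (\<lambda>i j. e i j k)) - pairing (eval_at (p k) pD) (\<lambda>i j. e (Suc i) j k))"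
    unfolding Top_def
    by (rule sum.cong) (simp_all add: pairing_diff pairing_lincomb pairing_pD_eval weyl_eval_pD weyl_lincomb weyl_mult weyl_pD)
  also have "\<dots> = (\<Sum>l<n. \<Sum>k<n. X $$ (k, l) * pairing (eval_at (p l) pD) (\<lambda>i j. e i j k)) - (\<Sum>k<n. pairing (eval_at (p k) pD) (\<lambda>i j. e (Suc i) j k))"
    unfolding sum_subtractf by (subst sum.swap) simp
  also have "(\<Sum>l<n. \<Sum>k<n. X $$ (k, l) * pairing (eval_at (p l) pD) (\<lambda>i j. e i j k)) = (\<Sum>l<n. pairing (eval_at (p l) pD) (\<lambda>i j. e (Suc i) j l))"
    unfolding pairing_array_sum by (intro sum.cong refl p0) (simp add: mult.commute[of "X $$ _"] e)
  finally show ?thesis by simp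
qed

lemma rows_Y: "m < n \<Longrightarrow> (\<Sum>k<n. rows \<xi> i j k * Y $$ (k, m)) = rows \<xi> i (Suc j) m"
  by (simp add: rows_def row_def)

text \<open>Restricted to second index 0: in \<open>\<xi> X^i Y^j\<close> a further \<open>X\<close>
  on the right joins the other powers of \<open>X\<close> only if no \<open>Y\<close> stands
  between.\<close>

lemma rows_X: "m < n \<Longrightarrow> (\<Sum>k<n. rows \<xi> i 0 k * X $$ (k, m)) = rows \<xi> (Suc i) 0 m"
  by (simp add: rows_def row_def)

lemma pairing_vv:
  assumes "a \<in> weyl"
  shows "psum (\<lambda>k. vv k * a) (rows \<xi>) = pairing a (yy \<xi>)"
proof -
  have "psum (\<lambda>k. vv k * a) (rows \<xi>) = pairing a (\<lambda>i j. \<Sum>k<n. v $$ (k, 0) * rows \<xi> i j k)"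
    by (simp add: vv_def pairing_pconst assms pairing_array_sum)
  also have "(\<lambda>i j. \<Sum>k<n. v $$ (k, 0) * rows \<xi> i j k) = yy \<xi>"
    by (intro ext) (simp add: yy_def mult.commute)
  finally show ?thesis .
qed

text \<open>Left multiplication by \<open>Y - z\<close> acts on the coefficient vector of each power
  of \<partial> separately, so the division is done power by power; the constant remainders assemble
  to polynomials in \<partial>.\<close>

lemma weyl_reduce_U:
  assumes y: "\<And>k. k < n \<Longrightarrow> y k \<in> weyl"
  shows "\<exists>c p. (\<forall>k<n. c k \<in> weyl) \<and> (\<forall>k<n. y k = Uop c k + eval_at (p k) pD)"
proof -
  have "\<forall>i. \<exists>sc. \<forall>k<n. wcoeff (y k) i = (\<Sum>l<n. smult (Y $$ (k, l)) (fst sc l)) - pCons 0 (fst sc k) + [:snd sc k:]"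
  proof
    fix i
    obtain D where "\<forall>k<n. \<forall>j\<ge>D. coeff (wcoeff (y k) i) j = 0"
      using vec_degree_bound[of n "\<lambda>k. wcoeff (y k) i"] ..
    from vec_poly_div[OF this, of "\<lambda>k l. Y $$ (k, l)"]
    show "\<exists>sc. \<forall>k<n. wcoeff (y k) i = (\<Sum>l<n. smult (Y $$ (k, l)) (fst sc l)) - pCons 0 (fst sc k) + [:snd sc k:]"
      by (elim exE conjE) (rule exI[of _ "(_, _)"], simp only: fst_conv snd_conv)
  qed
  from choice[OF this] obtain sc where
    sc: "\<And>i k. k < n \<Longrightarrow> wcoeff (y k) i = (\<Sum>l<n. smult (Y $$ (k, l)) (fst (sc i) l)) - pCons 0 (fst (sc i) k) + [:snd (sc i) k:]"
    by blast
  have "\<exists>N. \<forall>i\<ge>N. wcoeff (y k) i = 0" if "k < n" for k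
  proof -
    obtain e where "ordle (y k) (int e)" using ordle_ex_nat by blast
    then show ?thesis using y[OF that] by (intro exI[of _ "Suc e"]) (auto simp: ordle_iff_wcoeff)
  qed
  then have "\<forall>k. \<exists>N. k < n \<longrightarrow> (\<forall>i\<ge>N. wcoeff (y k) i = 0)" by blast
  from choice[OF this] obtain Nf where Nf: "\<And>k i. k < n \<Longrightarrow> i \<ge> Nf k \<Longrightarrow> wcoeff (y k) i = 0" by blast
  define N where "N = (\<Sum>k<n. Nf k)"
  have N: "wcoeff (y k) i = 0" if "k < n" "i \<ge> N" for k i
  proof -
    have "Nf k \<le> N" unfolding N_def using that by (intro member_le_sum) auto
    then show ?thesis using Nf that by simp
  qed
  define c where "c l = wop N (\<lambda>i. fst (sc i) l)" for l
  define p where "p k = (\<Sum>i<N. monom (snd (sc i) k) i)" for k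
  have cp: "coeff (p k) i = (if i < N then snd (sc i) k else 0)" for k i
    by (simp add: p_def coeff_sum)
  have "y k = Uop c k + eval_at (p k) pD" if k: "k < n" for k
  proof (rule weyl_eqI)
    show "y k \<in> weyl" by (rule y[OF k])
    have cw: "c l \<in> weyl" for l by (simp add: c_def weyl_wop)
    have Uw: "Uop c k \<in> weyl" by (rule weyl_Uop) (use cw k in auto)
    then show "Uop c k + eval_at (p k) pD \<in> weyl" by (intro weyl_add weyl_eval_pD)
    fix i
    have "wcoeff (Uop c k) i = (\<Sum>l<n. smult (Y $$ (k, l)) (wcoeff (c l) i)) - pCons 0 (wcoeff (c k) i)"
      unfolding Uop_def by (subst wcoeff_diff) (simp_all add: cw wcoeff_lincomb wcoeff_pZ weyl_lincomb weyl_mult weyl_pZ)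
    then show "wcoeff (y k) i = wcoeff (Uop c k + eval_at (p k) pD) i"
      using N[OF k] by (simp add: wcoeff_add[OF Uw weyl_eval_pD] wcoeff_eval_pD cp c_def wcoeff_wop sc[OF k])
  qed
  then show ?thesis using weyl_wop by (intro exI[of _ c] exI[of _ p]) (simp add: c_def)
qed

text \<open>Apply a functional that kills \<open>U A\<^sup>n\<close> and isolates the coefficient of \<open>\<partial>\<^sup>d\<close>.\<close>
lemma mem_degree:
  assumes m: "mem a (cst p) s" and a: "ordle a (int e)"
  shows "\<forall>k<n. \<forall>i\<ge>e. coeff (p k) i = 0"
proof -
  have step: "\<forall>k<n. coeff (p k) d = 0" if d: "d \<ge> e" and p: "\<forall>k<n. coeff (p k) (Suc d) = 0" for d
  proof (intro allI impI)
    fix l assume l: "l < n"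
    define \<xi> where "\<xi> = (\<lambda>k. if k = l then 1 else 0 :: complex)"
    \<comment> \<open>The array is supported in row d + 1. There \<open>X p - \<partial> p\<close>
      contributes minus the d-th coefficient of p, since the next one vanishes, and
      \<open>v a\<close> contributes nothing because \<open>a\<close> has order at most d.\<close>
    define f where "f i j k = (if i = Suc d then rows \<xi> 0 j k else 0)" for i j k
    have mw: "a \<in> weyl" "\<And>k. k < n \<Longrightarrow> s k \<in> weyl"
      and eq: "\<And>k. k < n \<Longrightarrow> Top (cst p) k + vv k * a = Uop s k"
      using m by (auto simp: mem_def)
    have Tw: "Top (cst p) k \<in> weyl" if "k < n" for k
      using that by (intro weyl_Top weyl_eval_pD)
    have "0 = psum (Uop s) f"
      by (rule pairing_Uop[symmetric]) (use mw rows_Y in \<open>auto simp: f_def\<close>)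
    also have "\<dots> = (\<Sum>k<n. pairing (Top (cst p) k) (\<lambda>i j. f i j k) + pairing (vv k * a) (\<lambda>i j. f i j k))"
      by (rule sum.cong) (simp_all add: eq[symmetric] pairing_add Tw weyl_mult weyl_vv mw)
    also have "\<dots> = (\<Sum>k<n. - (coeff (p k) d * \<xi> k))"
    proof (rule sum.cong[OF refl])
      fix k assume "k \<in> {..<n}"
      then have k: "k < n" by simp
      have "wcoeff a (Suc d) = 0" using a d mw by (simp add: ordle_iff_wcoeff)
      then have 1: "pairing (vv k * a) (\<lambda>i j. f i j k) = 0"
        by (intro pairing_top) (auto simp: vv_def mw wcoeff_pconst f_def intro!: weyl_intros)
      define q where "q = (\<Sum>l<n. smult (X $$ (k, l)) (p l)) - pCons 0 (p k)"
      have "Top (cst p) k = eval_at q pD"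
        by (simp add: Top_def q_def eval_at_diff eval_at_sum eval_at_smult eval_at_pCons)
      moreover have "pairing (eval_at q pD) (\<lambda>i j. f i j k) = coeff q (Suc d) * \<xi> k"
      proof -
        have "(\<Sum>i\<le>degree q. coeff q i * f i 0 k)
          = (\<Sum>i\<le>degree q. if i = Suc d then coeff q (Suc d) * \<xi> k else 0)"
          by (rule sum.cong) (auto simp: f_def rows_def)
        also have "\<dots> = coeff q (Suc d) * \<xi> k"
          by (subst sum.delta) (auto simp: coeff_eq_0)
        finally show ?thesis by (simp add: pairing_eval_pD)
      qed
      moreover have "coeff q (Suc d) = - coeff (p k) d"
        using p k by (simp add: q_def coeff_sum)
      ultimately show "pairing (Top (cst p) k) (\<lambda>i j. f i j k) + pairing (vv k * a) (\<lambda>i j. f i j k) = - (coeff (p k) d * \<xi> k)"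
        using 1 by simp
    qed
    also have "\<dots> = (\<Sum>k<n. if k = l then - coeff (p l) d else 0)"
      by (rule sum.cong) (auto simp: \<xi>_def)
    also have "\<dots> = - coeff (p l) d" using l by simp
    finally show "coeff (p l) d = 0" by simp
  qed
  obtain D where D: "\<forall>k<n. \<forall>i\<ge>D. coeff (p k) i = 0" using vec_degree_bound[of n p] ..
  \<comment> \<open>Descending induction on the degree, organised by the distance \<open>t\<close>
    below the bound \<open>D\<close>.\<close>
  have "\<forall>k<n. \<forall>i\<ge>e. i + t \<ge> D \<longrightarrow> coeff (p k) i = 0" for t
  proof (induction t)
    case (Suc t)
    show ?case
    proof (intro allI impI)
      fix k i assume "k < n" "e \<le> i" "D \<le> i + Suc t"
      then have "\<forall>k<n. coeff (p k) (Suc i) = 0" using Suc by auto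
      then show "coeff (p k) i = 0" using step \<open>k < n\<close> \<open>e \<le> i\<close> by blast
    qed
  qed (use D in auto)
  from this[of D] show ?thesis by simp
qed

text \<open>By the degree bound the entries of \<open>p\<close> have lower order than the bound on
  \<open>a\<close>, and those of \<open>u\<close> are functions, so the correction cannot reach the
  top term.\<close>

lemma elt_lead:
  assumes m: "mem a (cst p) s" and a: "ordle a e"
  shows "ordle (elt a (cst p)) e \<and> pcoeff (elt a (cst p)) e = pcoeff a e"
proof -
  \<comment> \<open>For negative \<open>e\<close> the bound becomes 0, which forces \<open>p\<close>
    to vanish.\<close>
  define e' where "e' = nat e"
  have aw: "a \<in> weyl" using m by (simp add: mem_def)
  have "ordle a (int e')" using a by (rule ordle_mono) (simp add: e'_def)
  then have z: "coeff (p k) i = 0" if "k < n" "i \<ge> e'" for k i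
    using mem_degree[OF m] that by blast
  have z2: "pcoeff (eval_at (p k) pD) i = 0" if "k < n" "i \<ge> e" for k i
  proof (cases "i < 0")
    case True
    then show ?thesis using weyl_eval_pD[of "p k"] by (simp add: weyl_iff)
  next
    case False
    then have "pcoeff (eval_at (p k) pD) i = to_fract [:coeff (p k) (nat i):]"
      using wcoeff[OF weyl_eval_pD, of "p k" "nat i"] by (simp add: wcoeff_eval_pD)
    moreover have "nat i \<ge> e'" using that False by (simp add: e'_def)
    ultimately show ?thesis using z[OF that(1)] by simp
  qed
  have "pcoeff (elt a (cst p)) i = pcoeff a i" if "i \<ge> e" for i
    using z2[OF _ that] by (simp add: elt_def u_def)
  then show ?thesis using a by (auto simp: ordle_def)
qed

text \<open>Divide \<open>v a\<close> by U and then the constant-coefficient remainder by T; a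
  complex vector b is left. The functionals given by \<open>rows\<close> vanish on both images and
  read off b, so \<open>a \<in> K\<close> forces b = 0.\<close>

lemma K_lift:
  assumes "a \<in> K"
  shows "\<exists>p s. mem a (cst p) s"
proof -
  have aw: "a \<in> weyl" using assms by (simp add: K_def)
  have "vv k * a \<in> weyl" for k using weyl_vv aw by (rule weyl_mult)
  from weyl_reduce_U[of "\<lambda>k. vv k * a", OF this] obtain c p where
    cw: "\<And>k. k < n \<Longrightarrow> c k \<in> weyl" and red: "\<And>k. k < n \<Longrightarrow> vv k * a = Uop c k + eval_at (p k) pD" by blast
  obtain D where "\<forall>k<n. \<forall>j\<ge>D. coeff (p k) j = 0" using vec_degree_bound[of n p] ..
  from vec_poly_div[OF this, of "\<lambda>k l. X $$ (k, l)"] obtain t b where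
    "\<forall>k<n. p k = (\<Sum>l<n. smult (X $$ (k, l)) (t l)) - pCons 0 (t k) + [:b k:]"
    by (elim exE conjE)
  then have pt: "eval_at (p k) pD = Top (cst t) k + pconst (b k)" if "k < n" for k
    using that by (simp add: Top_def eval_at_add eval_at_diff eval_at_sum eval_at_smult eval_at_pCons)
  have "b l = 0" if l: "l < n" for l
  proof -
    define \<xi> where "\<xi> = (\<lambda>k. if k = l then 1 else 0 :: complex)"
    have Tw: "Top (cst t) k \<in> weyl" if "k < n" for k
      using that by (intro weyl_Top weyl_eval_pD)
    have "0 = psum (\<lambda>k. vv k * a) (rows \<xi>)"
      using assms l by (simp add: pairing_vv[OF aw] K_def supp_def \<xi>_def)
    also have "\<dots> = (\<Sum>k<n. pairing (Uop c k) (\<lambda>i j. rows \<xi> i j k) + (pairing (Top (cst t) k) (\<lambda>i j. rows \<xi> i j k)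
        + pairing (pconst (b k)) (\<lambda>i j. rows \<xi> i j k)))"
      by (rule sum.cong) (simp_all add: red pt pairing_add weyl_Uop cw Tw weyl_pconst weyl_add)
    also have "\<dots> = psum (\<lambda>k. pconst (b k)) (rows \<xi>)"
      unfolding sum.distrib
      using pairing_Uop[of "\<lambda>i j k. rows \<xi> i j k" c] pairing_Top[of "\<lambda>i j k. rows \<xi> i j k" t] rows_Y rows_X cw by simp
    also have "\<dots> = (\<Sum>k<n. if k = l then b l else 0)"
    proof (rule sum.cong[OF refl])
      fix k
      show "pairing (pconst (b k)) (\<lambda>i j. rows \<xi> i j k) = (if k = l then b l else 0)"
        using pairing_eval_pD[of "[:b k:]" "\<lambda>i j. rows \<xi> i j k"] by (simp add: rows_def \<xi>_def)
    qed
    also have "\<dots> = b l" using l by simp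
    finally show ?thesis by simp
  qed
  then have "Top (\<lambda>l. eval_at (- t l) pD) k + vv k * a = Uop c k" if "k < n" for k
    using red[OF that] pt[OF that] that by (simp add: eval_at_uminus Top_uminus)
  then have "mem a (\<lambda>l. eval_at (- t l) pD) c" using aw cw by (simp add: mem_def weyl_eval_pD)
  then show ?thesis by (intro exI[of _ "\<lambda>l. - t l"] exI[of _ c])
qed

text \<open>Replacing \<open>r = U c + p\<close> by \<open>p\<close> is compensated by adding
  \<open>w c\<close> to \<open>a\<close>, because \<open>u U = w\<close>, and by subtracting
  \<open>T c\<close> from \<open>s\<close>, because \<open>T U c = U T c + v w c\<close>. Pairing
  the new relation with \<open>rows\<close> puts the new \<open>a\<close> into
  \<open>K\<close>.\<close>

lemma M0_normal_form:
  assumes "x \<in> M0"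
  shows "\<exists>a p s. a \<in> K \<and> mem a (cst p) s \<and> x = elt a (cst p)"
proof -
  obtain a r s where m: "mem a r s" and x: "x = elt a r" using assms by (auto simp: M0_def)
  then have rw: "\<And>k. k < n \<Longrightarrow> r k \<in> weyl" and sw: "\<And>k. k < n \<Longrightarrow> s k \<in> weyl" and aw: "a \<in> weyl"
    and eq: "\<And>k. k < n \<Longrightarrow> Top r k + vv k * a = Uop s k" by (auto simp: mem_def)
  from weyl_reduce_U[of r, OF rw] obtain c p where
    cw: "\<And>k. k < n \<Longrightarrow> c k \<in> weyl" and red: "\<And>k. k < n \<Longrightarrow> r k = Uop c k + eval_at (p k) pD" by blast
  define a' where "a' = a + (\<Sum>l<n. ww l * c l)"
  have a'w: "a' \<in> weyl" unfolding a'_def using aw cw weyl_ww by (intro weyl_intros) auto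
  have "elt a' (cst p) = a + (\<Sum>k<n. u k * (Uop c k + eval_at (p k) pD))"
    by (simp add: elt_def a'_def sum_u_Uop[symmetric] distrib_left sum.distrib)
  also have "\<dots> = x" unfolding x elt_def using red by simp
  finally have xe: "x = elt a' (cst p)" by simp
  define s' where "s' k = s k - Top c k" for k
  have s'w: "s' k \<in> weyl" if "k < n" for k
    using sw[OF that] weyl_Top[OF cw that] by (auto simp: s'_def intro: weyl_intros)
  have eq': "Top (cst p) k + vv k * a' = Uop s' k" if k: "k < n" for k
  proof -
    have "Top r k = Top (\<lambda>l. Uop c l + eval_at (p l) pD) k" by (rule Top_cong) (use red k in auto)
    also have "\<dots> = Uop (Top c) k + vv k * (\<Sum>l<n. ww l * c l) + Top (cst p) k"
      by (simp add: Top_add Top_Uop[OF k])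
    finally show ?thesis using eq[OF k] by (simp add: s'_def[abs_def] Uop_diff a'_def algebra_simps)
  qed
  have m': "mem a' (cst p) s'"
    using a'w s'w eq' by (simp add: mem_def weyl_eval_pD)
  have "pairing a' (yy \<xi>) = 0" for \<xi>
  proof -
    have Tw: "Top (cst p) k \<in> weyl" if "k < n" for k
      using that by (intro weyl_Top weyl_eval_pD)
    have "0 = psum (Uop s') (rows \<xi>)"
      using pairing_Uop[of "\<lambda>i j k. rows \<xi> i j k" s'] rows_Y s'w by simp
    also have "\<dots> = (\<Sum>k<n. pairing (Top (cst p) k) (\<lambda>i j. rows \<xi> i j k) + pairing (vv k * a') (\<lambda>i j. rows \<xi> i j k))"
      by (rule sum.cong) (simp_all add: eq'[symmetric] pairing_add Tw weyl_mult weyl_vv a'w)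
    also have "\<dots> = pairing a' (yy \<xi>)"
      unfolding sum.distrib using pairing_Top[of "\<lambda>i j k. rows \<xi> i j k" p] rows_X pairing_vv[OF a'w] by simp
    finally show ?thesis by simp
  qed
  then have "a' \<in> K" using a'w by (simp add: K_def)
  then show ?thesis using m' xe by blast
qed

text \<open>One \<open>a\<close> serves all bounds at once: were its exact order above a bound for
  \<open>x\<close>, \<open>elt_lead\<close> would give \<open>x\<close> a nonzero coefficient
  there.\<close>

lemma M0_lead_aux:
  assumes "x \<in> M0"
  shows "\<exists>a\<in>K. \<forall>e. ordle x e \<longrightarrow> ordle a e \<and> pcoeff a e = pcoeff x e"
proof -
  obtain a p s where a: "a \<in> K" "mem a (cst p) s" "x = elt a (cst p)"
    using M0_normal_form[OF assms] by blast
  have "ordle a e \<and> pcoeff a e = pcoeff x e" if x: "ordle x e" for e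
  proof -
    have "ordle a e"
    proof (cases "a = 0")
      case False
      then obtain e0 where e0: "ordle a e0" "pcoeff a e0 \<noteq> 0" using top_ex by blast
      then have "pcoeff x e0 \<noteq> 0" using elt_lead[OF a(2)] a(3) by metis
      then have "e0 \<le> e" using x by (auto simp: ordle_def not_less[symmetric])
      then show ?thesis using e0 ordle_mono by blast
    qed simp
    then show ?thesis using elt_lead[OF a(2)] a(3) by metis
  qed
  then show ?thesis using a(1) by blast
qed

lemma lead_M0: "lead M0 i = lead K i"
proof safe
  fix f assume "f \<in> lead M0 i"
  then obtain x where "x \<in> M0" "ordle x i" "f = pcoeff x i" by (auto simp: lead_def)
  then show "f \<in> lead K i" using M0_lead_aux leadI by metis
next
  fix f assume "f \<in> lead K i"
  then obtain a where a: "a \<in> K" "ordle a i" "f = pcoeff a i" by (auto simp: lead_def)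
  obtain p s where m: "mem a (cst p) s" using K_lift a by blast
  show "f \<in> lead M0 i" using elt_lead[OF m a(2)] leadI[OF M0I[OF m]] a(3) by metis
qed

end

text \<open>Gaussian elimination, one unknown per equation. It is applied in both directions: to
  find an operator killed by functionals, and a functional killing operators.\<close>

lemma homogeneous_system:
  fixes f :: "'i \<Rightarrow> 'j \<Rightarrow> 'a::field"
  assumes "finite I" "finite J" "card I < card J"
  shows "\<exists>c. (\<exists>j\<in>J. c j \<noteq> 0) \<and> (\<forall>i\<in>I. (\<Sum>j\<in>J. f i j * c j) = 0)"
  using assms
proof (induction I arbitrary: f J rule: finite_induct)
  case empty
  then have "J \<noteq> {}" by auto
  then show ?case by (intro exI[of _ "\<lambda>_. 1"]) auto
next
  case (insert i I)
  show ?case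
  proof (cases "\<exists>j0\<in>J. f i j0 \<noteq> 0")
    case False
    have "card I < card J" using insert.prems insert.hyps by simp
    then obtain c where "\<exists>j\<in>J. c j \<noteq> 0" "\<forall>i\<in>I. (\<Sum>j\<in>J. f i j * c j) = 0"
      using insert.IH insert.prems by blast
    then show ?thesis using False by (intro exI[of _ c]) simp
  next
    case True
    then obtain j0 where j0: "j0 \<in> J" "f i j0 \<noteq> 0" by blast
    define g where "g i' j = f i' j - f i' j0 * f i j / f i j0" for i' j
    have "finite (J - {j0})" "card I < card (J - {j0})" using insert.prems insert.hyps j0 by simp_all
    then obtain c where c: "\<exists>j\<in>J - {j0}. c j \<noteq> 0" "\<forall>i'\<in>I. (\<Sum>j\<in>J - {j0}. g i' j * c j) = 0"
      using insert.IH[of "J - {j0}" g] by blast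
    define S where "S = (\<Sum>j\<in>J - {j0}. f i j * c j)"
    define c' where "c' j = (if j = j0 then - S / f i j0 else c j)" for j
    have sum: "(\<Sum>j\<in>J. f i' j * c' j) = f i' j0 * (- S / f i j0) + (\<Sum>j\<in>J - {j0}. f i' j * c j)" for i'
    proof -
      have "(\<Sum>j\<in>J. f i' j * c' j) = f i' j0 * c' j0 + (\<Sum>j\<in>J - {j0}. f i' j * c' j)"
        using j0 insert.prems by (simp add: sum.remove)
      also have "(\<Sum>j\<in>J - {j0}. f i' j * c' j) = (\<Sum>j\<in>J - {j0}. f i' j * c j)"
        by (rule sum.cong) (auto simp: c'_def)
      finally show ?thesis by (simp add: c'_def)
    qed
    have "(\<Sum>j\<in>J. f i' j * c' j) = 0" if i': "i' \<in> insert i I" for i'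
    proof (cases "i' = i")
      case True
      then show ?thesis using j0 by (simp add: sum S_def)
    next
      case False
      then have "(\<Sum>j\<in>J - {j0}. g i' j * c j) = 0" using c i' by simp
      moreover have "(\<Sum>j\<in>J - {j0}. g i' j * c j) = (\<Sum>j\<in>J - {j0}. f i' j * c j) - f i' j0 * (S / f i j0)"
        unfolding S_def g_def sum_divide_distrib sum_distrib_left sum_subtractf[symmetric]
        by (rule sum.cong) (auto simp: algebra_simps)
      ultimately show ?thesis by (simp add: sum)
    qed
    moreover have "\<exists>j\<in>J. c' j \<noteq> 0" using c(1) by (auto simp: c'_def)
    ultimately show ?thesis by blast
  qed
qed

section \<open>Equality of the ideal with the solution module, cyclicity, and colength\<close>

context cm_data
begin

lemma K_weyl: "a \<in> K \<Longrightarrow> a \<in> weyl" by (simp add: K_def)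

lemma lead_M0_poly: assumes "x \<in> M0" "ordle x i" shows "\<exists>p. pcoeff x i = to_fract p"
proof -
  have "pcoeff x i \<in> lead K i" using leadI[OF assms] lead_M0 by simp
  then obtain a where a: "a \<in> K" "pcoeff x i = pcoeff a i" by (auto simp: lead_def)
  then have "pcoeff a i \<in> range to_fract" using K_weyl[OF a(1)] by (simp add: weyl_iff)
  then show ?thesis using a(2) by (auto elim: rangeE)
qed

text \<open>The operator in \<open>K\<close> with the same top coefficient has none in negative
  degree.\<close>

lemma M0_neg: assumes "x \<in> M0" "ordle x (-1)" shows "x = 0"
proof (rule ccontr)
  assume "x \<noteq> 0"
  then obtain j where j: "ordle x j" "pcoeff x j \<noteq> 0" using top_ex by blast
  obtain a where a: "a \<in> K" "\<And>e. ordle x e \<Longrightarrow> ordle a e \<and> pcoeff a e = pcoeff x e"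
    using M0_lead_aux[OF assms(1)] by blast
  have "j \<le> -1" using j assms(2) by (auto simp: ordle_def not_less[symmetric])
  then have "pcoeff a j = 0" using K_weyl[OF a(1)] by (auto simp: weyl_iff)
  then show False using a(2)[OF j(1)] j(2) by simp
qed

text \<open>Each right multiplication by \<open>dY\<close> lowers the order modulo \<open>M\<close>, so a power of \<open>dY\<close> kills \<open>M0/M\<close>;
  since commuting with \<open>\<partial>\<close> differentiates annihilating polynomials, the constant \<open>1\<close> annihilates too.\<close>
lemma M0_low_order:
  "x \<in> M0 \<Longrightarrow> ordle x (int i - 1) \<Longrightarrow> x * pfun (to_fract (dY ^ i)) \<in> M"
proof (induction i arbitrary: x)
  case 0
  then have "x = 0" using M0_neg by simp
  then show ?case using M_gens(1)[OF weyl_0] by simp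
next
  case (Suc i)
  then have ox: "ordle x (int i)" by simp
  obtain p where p: "pcoeff x (int i) = to_fract p" using lead_M0_poly[OF Suc.prems(1) ox] by blast
  let ?d = "eval_at dY pZ" and ?q = "pfun (to_fract p) * pD ^ i"
  have d: "?d = pfun (to_fract dY)" by (rule eval_at_pZ)
  define x' where "x' = x * ?d - ?d * ?q"
  have dw: "?d \<in> weyl" unfolding d by (rule weyl_pfun)
  have "x' \<in> M0" unfolding x'_def
    using Suc.prems dY_in_M0 dw weyl_monomial by (intro M0_diff M0_mult)
  moreover have "ordle x' (int i - 1)"
  proof (rule ordle_pred)
    have oq: "ordle ?q (int i)" by (auto simp: ordle_def pcoeff_pfun simp del: pcoeff_pfun_mult)
    have o1: "ordle (x * ?d) (int i)" using ordle_mult[OF ox ordle_pfun[of "to_fract dY"]] by (simp add: d)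
    have o2: "ordle (?d * ?q) (int i)" using ordle_mult[OF ordle_pfun[of "to_fract dY"] oq] by (simp add: d)
    show "ordle x' (int i)" unfolding x'_def using o1 o2 by (rule ordle_diff)
    have "pcoeff (x * ?d) (int i) = to_fract p * to_fract dY"
      using pcoeff_mult_top[OF ox ordle_pfun[of "to_fract dY"]] by (simp add: d p pcoeff_pfun)
    moreover have "pcoeff (?d * ?q) (int i) = to_fract dY * to_fract p"
      unfolding d by (simp only: pcoeff_pfun_mult pcoeff_mult_pD_power) (simp add: pcoeff_pfun pfun_mult[symmetric])
    ultimately show "pcoeff x' (int i) = 0" by (simp add: x'_def)
  qed
  ultimately have "x' * pfun (to_fract (dY ^ i)) \<in> M" by (rule Suc.IH)
  moreover have "?d * (?q * pfun (to_fract (dY ^ i))) \<in> M"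
    by (intro M_gens weyl_mult weyl_monomial weyl_pfun)
  ultimately have "x' * pfun (to_fract (dY ^ i)) + ?d * (?q * pfun (to_fract (dY ^ i))) \<in> M"
    by (rule M_add)
  moreover have "x' * pfun (to_fract (dY ^ i)) + ?d * (?q * pfun (to_fract (dY ^ i))) = x * pfun (to_fract (dY ^ Suc i))"
    by (simp add: x'_def left_diff_distrib mult.assoc d pfun_mult)
  ultimately show ?case by simp
qed

text \<open>The top coefficient is a nonzero constant, so a multiple of this generator lowers any
  element of order at least \<open>degree dX\<close>.\<close>

lemma kappa_lead:
  "ordle (gX) (int (degree dX))"
  "pcoeff (gX) (int (degree dX)) = to_fract [:lead_coeff dX:]"
proof -
  let ?N = "degree dX"
  define q where "q k = - (\<Sum>j<n. smult (v $$ (j, 0)) (adj_mat (pencil X) $$ (k, j)))" for k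
  have r: "rX = (cst q)"
    by (simp add: rX_def q_def eval_at_uminus eval_at_sum eval_at_smult vv_def pconst_commute fun_eq_iff)
  have m: "mem (eval_at dX pD) (cst q) (\<lambda>_. 0)"
    using mem_kappa unfolding r .
  have o: "ordle (eval_at dX pD) (int ?N)"
    by (auto simp: ordle_iff_wcoeff[OF weyl_eval_pD] wcoeff_eval_pD coeff_eq_0)
  have e: "gX = elt (eval_at dX pD) (cst q)"
    by (simp add: kappa_dX r[symmetric] elt_def)
  have "pcoeff (eval_at dX pD) (int ?N) = to_fract [:lead_coeff dX:]"
    by (simp add: wcoeff[OF weyl_eval_pD, symmetric] wcoeff_eval_pD)
  then show "ordle (gX) (int ?N)"
    "pcoeff (gX) (int ?N) = to_fract [:lead_coeff dX:]"
    using elt_lead[OF m o] by (simp_all add: e)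
qed

text \<open>Multiples of the second generator bring the order below \<open>degree dX\<close>, where
  \<open>M0_low_order\<close> applies; this gives one exponent for all elements.\<close>

lemma M0_annihilated:
  assumes "x \<in> M0"
  shows "x * pfun (to_fract (dY ^ degree dX)) \<in> M"
proof -
  let ?N = "degree dX"
  let ?g = "gX"
  have main: "x * pfun (to_fract (dY ^ ?N)) \<in> M" if "x \<in> M0" "ordle x (int ?N - 1 + int t)" for t x
    using that
  proof (induction t arbitrary: x)
    case 0
    then show ?case using M0_low_order by simp
  next
    case (Suc t)
    have ox: "ordle x (int (?N + t))" using Suc.prems(2) by (simp add: algebra_simps)
    obtain p where p: "pcoeff x (int (?N + t)) = to_fract p" using lead_M0_poly[OF Suc.prems(1) ox] by blast
    define c where "c = lead_coeff dX"
    have c0: "c \<noteq> 0" using shift_det_nonzero[OF X] by (simp add: c_def)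
    define q where "q = pfun (to_fract (smult (1 / c) p)) * pD ^ t"
    have qw: "q \<in> weyl" by (simp add: q_def weyl_monomial)
    have oq: "ordle q (int t)" "pcoeff q (int t) = to_fract (smult (1 / c) p)"
      unfolding q_def by (auto simp: ordle_def pcoeff_pfun simp del: pcoeff_pfun_mult)
    define x' where "x' = x - ?g * q"
    have "x' \<in> M0" unfolding x'_def by (rule M0_diff[OF Suc.prems(1) M0_mult[OF kappa_in_M0 qw]])
    moreover have "ordle x' (int (?N + t) - 1)"
    proof (rule ordle_pred)
      show "ordle x' (int (?N + t))" unfolding x'_def
        using ordle_diff[OF ox] ordle_mult[OF kappa_lead(1) oq(1)] by simp
      have "pcoeff (?g * q) (int (?N + t)) = to_fract [:c:] * to_fract (smult (1 / c) p)"
        using pcoeff_mult_top[OF kappa_lead(1) oq(1)] by (simp add: kappa_lead(2) oq(2) c_def)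
      also have "\<dots> = to_fract p" using c0 by (simp flip: to_fract_mult)
      finally show "pcoeff x' (int (?N + t)) = 0" using p by (simp add: x'_def)
    qed
    ultimately have "x' * pfun (to_fract (dY ^ ?N)) \<in> M" by (intro Suc.IH) (simp_all add: algebra_simps)
    moreover have "?g * (q * pfun (to_fract (dY ^ ?N))) \<in> M" using qw by (intro M_gens weyl_mult weyl_pfun)
    ultimately have "x' * pfun (to_fract (dY ^ ?N)) + ?g * (q * pfun (to_fract (dY ^ ?N))) \<in> M" by (rule M_add)
    then show ?case by (simp add: x'_def left_diff_distrib mult.assoc)
  qed
  obtain i where "ordle x i" using ordle_ex by blast
  then have "ordle x (int ?N - 1 + int (nat (i - int ?N + 1)))" by (rule ordle_mono) simp
  then show ?thesis using main assms by blast
qed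

lemma M_eq_M0: "M = M0"
proof -
  define P where "P p \<longleftrightarrow> (\<forall>x\<in>M0. x * pfun (to_fract p) \<in> M)" for p
  have "\<exists>c. c \<noteq> 0 \<and> P [:c:]"
  proof (rule pderiv_descent)
    show "dY ^ degree dX \<noteq> 0" using shift_det_nonzero[OF Y] by simp
    show "P (dY ^ degree dX)" using M0_annihilated by (simp add: P_def)
  next
    fix p assume p: "P p"
    show "P (pderiv p)" unfolding P_def
    proof
      fix x assume x: "x \<in> M0"
      have "x * pD * pfun (to_fract p) - x * pfun (to_fract p) * pD \<in> M"
        using p x M0_mult[OF x weyl_pD] M_mult[OF _ weyl_pD] by (intro M_diff) (auto simp: P_def)
      also have "x * pD * pfun (to_fract p) - x * pfun (to_fract p) * pD = x * pfun (to_fract (pderiv p))"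
        by (simp add: mult.assoc pD_pfun rderiv_to_fract distrib_left)
      finally show "x * pfun (to_fract (pderiv p)) \<in> M" .
    qed
  qed
  then obtain c where c: "c \<noteq> 0" "P [:c:]" by blast
  have "x \<in> M" if "x \<in> M0" for x
  proof -
    have "x * pconst c * pconst (1 / c) \<in> M"
      using c that M_mult weyl_pconst by (simp add: P_def pconst_def)
    also have "x * pconst c * pconst (1 / c) = x" using c by (simp add: mult.assoc pconst_mult[symmetric])
    finally show ?thesis .
  qed
  then show ?thesis using M_subset_M0 by blast
qed

subsection \<open>Cyclicity of \<open>v\<close>\<close>

lemma row_supp: "supp (row A \<xi>)" by (simp add: supp_def row_def)

lemma row_add: "row A (\<lambda>m. a m + b m) = (\<lambda>m. row A a m + row A b m)"
  by (rule ext) (simp add: row_def distrib_right sum.distrib)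
lemma row_scale: "row A (\<lambda>m. c * a m) = (\<lambda>m. c * row A a m)"
  by (rule ext) (simp add: row_def sum_distrib_left mult.assoc)

lemma row_pow_add: "(row A ^^ i) (\<lambda>m. a m + b m) = (\<lambda>m. (row A ^^ i) a m + (row A ^^ i) b m)"
  by (induction i) (simp_all add: row_add)
lemma row_pow_scale: "(row A ^^ i) (\<lambda>m. c * a m) = (\<lambda>m. c * (row A ^^ i) a m)"
  by (induction i) (simp_all add: row_scale)

lemma yy_add: "yy (\<lambda>m. a m + b m) i j = yy a i j + yy b i j"
  by (simp add: yy_def rows_def row_pow_add distrib_right sum.distrib)
lemma yy_scale: "yy (\<lambda>m. c * a m) i j = c * yy a i j"
  by (simp add: yy_def rows_def row_pow_scale sum_distrib_left mult.assoc)

lemma yy_0: "yy \<xi> 0 0 = (\<Sum>k<n. \<xi> k * v $$ (k, 0))"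
  by (simp add: yy_def rows_def)

text \<open>Apply \<xi> to \<open>X Y - Y X + 1 = v w\<close>: the right side is
  \<open>(\<xi> v) w = 0\<close>. Since rows act from the left, \<open>row X (row Y \<xi>)\<close>
  is \<open>\<xi> Y X\<close>.\<close>

lemma row_XY:
  assumes "supp \<xi>" "yy \<xi> 0 0 = 0"
  shows "row X (row Y \<xi>) = (\<lambda>m. row Y (row X \<xi>) m + \<xi> m)"
proof
  fix m
  show "row X (row Y \<xi>) m = row Y (row X \<xi>) m + \<xi> m"
  proof (cases "m < n")
    case True
    have sw: "row A (row B \<xi>) m = (\<Sum>k<n. \<xi> k * (\<Sum>l<n. B $$ (k, l) * A $$ (l, m)))" for A B
    proof -
      have "row A (row B \<xi>) m = (\<Sum>l<n. \<Sum>k<n. \<xi> k * B $$ (k, l) * A $$ (l, m))"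
        using True by (simp add: row_def sum_distrib_right)
      also have "\<dots> = (\<Sum>k<n. \<xi> k * (\<Sum>l<n. B $$ (k, l) * A $$ (l, m)))"
        by (subst sum.swap) (simp add: sum_distrib_left mult.assoc)
      finally show ?thesis .
    qed
    have "row Y (row X \<xi>) m - row X (row Y \<xi>) m + \<xi> m
      = (\<Sum>k<n. \<xi> k * ((\<Sum>l<n. X $$ (k, l) * Y $$ (l, m)) - (\<Sum>l<n. Y $$ (k, l) * X $$ (l, m)) + (if k = m then 1 else 0)))"
    proof -
      have "(\<Sum>k<n. \<xi> k * (if k = m then 1 else 0)) = (\<Sum>k<n. if k = m then \<xi> m else 0)"
        by (rule sum.cong) auto
      also have "\<dots> = \<xi> m" using True by simp
      finally show ?thesis unfolding sw distrib_left right_diff_distrib sum.distrib sum_subtractf by simp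
    qed
    also have "\<dots> = (\<Sum>k<n. \<xi> k * (v $$ (k, 0) * w $$ (0, m)))"
      by (rule sum.cong) (use True in \<open>simp_all add: rel_entry\<close>)
    also have "\<dots> = yy \<xi> 0 0 * w $$ (0, m)" by (simp add: yy_0 sum_distrib_right mult.assoc)
    finally show ?thesis using assms(2) by (simp add: algebra_simps)
  qed (use assms in \<open>simp add: row_def supp_def\<close>)
qed

text \<open>The annihilator of the span of all \<open>X^i Y^j v\<close>; that it is zero is the
  cyclicity of \<open>v\<close>.\<close>

definition perp :: "(nat \<Rightarrow> complex) \<Rightarrow> bool"
  where "perp \<xi> \<longleftrightarrow> supp \<xi> \<and> (\<forall>i j. yy \<xi> i j = 0)"

lemma yy_row_X: "yy (row X \<xi>) i j = yy \<xi> (Suc i) j"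
  by (simp add: yy_def rows_def funpow_swap1)

lemma perp_X: "perp \<xi> \<Longrightarrow> perp (row X \<xi>)"
  by (simp add: perp_def row_supp yy_row_X)

text \<open>Stability under \<open>X\<close> is an index shift; for \<open>Y\<close> the powers of
  \<open>X\<close> are pulled through one at a time with
  \<open>\<xi> Y X = \<xi> X Y + \<xi>\<close>.\<close>

lemma perp_Y: assumes "perp \<xi>" shows "perp (row Y \<xi>)"
proof -
  have "yy (row Y \<xi>) i j = 0" for i j
    using assms
  proof (induction i arbitrary: \<xi>)
    case 0
    have "yy (row Y \<xi>) 0 j = yy \<xi> 0 (Suc j)" by (simp add: yy_def rows_def funpow_swap1)
    then show ?case using 0 by (simp add: perp_def)
  next
    case (Suc i)
    have "yy (row Y \<xi>) (Suc i) j = yy (row X (row Y \<xi>)) i j" by (simp add: yy_row_X)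
    also have "\<dots> = yy (row Y (row X \<xi>)) i j + yy \<xi> i j"
      using Suc.prems by (simp add: row_XY perp_def yy_add)
    also have "\<dots> = 0" using Suc.IH[OF perp_X[OF Suc.prems]] Suc.prems by (simp add: perp_def)
    finally show ?case .
  qed
  then show ?thesis by (simp add: perp_def row_supp)
qed

text \<open>On the annihilator \<open>X\<close> and \<open>Y\<close> satisfy the Weyl relation,
  iterated here. At \<open>j = 0\<close> the truncated \<open>j - 1\<close> is harmless since its
  factor is 0.\<close>

lemma row_Y_pow_X:
  "perp \<xi> \<Longrightarrow> (row Y ^^ j) (row X \<xi>) = (\<lambda>m. row X ((row Y ^^ j) \<xi>) m + (- of_nat j) * (row Y ^^ (j - 1)) \<xi> m)"
proof (induction j arbitrary: \<xi>)
  case (Suc j)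
  have "row Y (row X \<xi>) = (\<lambda>m. row X (row Y \<xi>) m + (-1) * \<xi> m)"
    using row_XY[of \<xi>] Suc.prems by (simp add: perp_def)
  then have "(row Y ^^ Suc j) (row X \<xi>) = (row Y ^^ j) (\<lambda>m. row X (row Y \<xi>) m + (-1) * \<xi> m)"
    by (simp add: funpow_swap1)
  also have "\<dots> = (\<lambda>m. (row Y ^^ j) (row X (row Y \<xi>)) m + (-1) * (row Y ^^ j) \<xi> m)"
    by (simp only: row_pow_add row_pow_scale)
  also have "(row Y ^^ j) (row X (row Y \<xi>)) = (\<lambda>m. row X ((row Y ^^ j) (row Y \<xi>)) m + (- of_nat j) * (row Y ^^ (j - 1)) (row Y \<xi>) m)"
    by (rule Suc.IH[OF perp_Y[OF Suc.prems]])
  finally have e: "(row Y ^^ Suc j) (row X \<xi>) = (\<lambda>m. row X ((row Y ^^ j) (row Y \<xi>)) m + (- of_nat j) * (row Y ^^ (j - 1)) (row Y \<xi>) m + (-1) * (row Y ^^ j) \<xi> m)" .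
  have e2: "(- of_nat j) * (row Y ^^ (j - 1)) (row Y \<xi>) m = (- of_nat j) * (row Y ^^ j) \<xi> m" for m
    by (cases j) (simp_all add: funpow_swap1)
  show ?case unfolding e e2 by (simp add: funpow_swap1 algebra_simps)
qed simp

text \<open>A column of \<open>(Y - z) adj(Y - z) = det(Y - z)\<close> is paired with the array
  \<open>\<xi> Y^j\<close>: the left side gives zero, the right side evaluates the determinant at
  \<open>Y\<close>.\<close>

lemma row_cayley_hamilton:
  assumes l: "l < n"
  shows "(\<Sum>j\<le>degree dY. coeff dY j * (row Y ^^ j) \<xi> l) = 0"
proof -
  define f where "f i j k = (if i = 0 then (row Y ^^ j) \<xi> k else 0)" for i j k :: nat
  define s where "s k = eval_at (adj_mat (pencil Y) $$ (k, l)) pZ" for k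
  have sw: "s k \<in> weyl" for k by (simp add: s_def eval_at_pZ weyl_pfun)
  have Us: "Uop s k = (if k = l then pfun (to_fract dY) * pD ^ 0 else 0)" if k: "k < n" for k
  proof -
    have "Uop s k = eval_at (\<Sum>m<n. pencil Y $$ (k, m) * adj_mat (pencil Y) $$ (m, l)) pZ"
      by (simp add: Uop_pencil[OF k] s_def eval_at_sum eval_at_mult)
    then show ?thesis by (simp add: pencil_adj[OF Y k l] eval_at_pZ)
  qed
  have "0 = psum (Uop s) f"
    by (rule pairing_Uop[symmetric]) (auto simp: f_def row_def sw)
  also have "\<dots> = (\<Sum>k<n. if k = l then pairing (pfun (to_fract dY) * pD ^ 0) (\<lambda>i j. f i j l) else 0)"
    by (rule sum.cong) (auto simp: Us)
  also have "\<dots> = pairing (pfun (to_fract dY) * pD ^ 0) (\<lambda>i j. f i j l)" using l by simp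
  finally show ?thesis unfolding pairing_monomial by (simp add: f_def)
qed

lemma perp_0: assumes "perp \<xi>" "l < n" shows "\<xi> l = 0"
proof -
  \<comment> \<open>\<open>P\<close> says that \<open>\<xi> p(Y) = 0\<close> on the whole
    annihilator. It passes to the derivative because
    \<open>(\<xi> X) p(Y) = (\<xi> p(Y)) X - \<xi> p'(Y)\<close>. Quantifying over degree bounds
    \<open>N\<close> avoids computing degrees of derivatives.\<close>
  define P where "P p \<longleftrightarrow> (\<forall>\<xi> N m. perp \<xi> \<longrightarrow> m < n \<longrightarrow> (\<forall>j\<ge>N. coeff p j = 0) \<longrightarrow>
      (\<Sum>j<N. coeff p j * (row Y ^^ j) \<xi> m) = 0)" for p :: "complex poly"
  have "\<exists>c. c \<noteq> 0 \<and> P [:c:]"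
  proof (rule pderiv_descent)
    show "dY \<noteq> 0" by (rule shift_det_nonzero[OF Y])
    show "P dY" unfolding P_def
    proof (intro allI impI)
      fix \<xi> N m assume m: "m < n" and N: "\<forall>j\<ge>N. coeff dY j = 0"
      have "(\<Sum>j<N. coeff dY j * (row Y ^^ j) \<xi> m) = (\<Sum>j\<in>{..<N} \<union> {..degree dY}. coeff dY j * (row Y ^^ j) \<xi> m)"
        by (rule sum.mono_neutral_left) (use N in auto)
      also have "\<dots> = (\<Sum>j\<le>degree dY. coeff dY j * (row Y ^^ j) \<xi> m)"
        by (rule sum.mono_neutral_right) (auto simp: coeff_eq_0)
      finally show "(\<Sum>j<N. coeff dY j * (row Y ^^ j) \<xi> m) = 0" using row_cayley_hamilton[OF m] by simp
    qed
  next
    fix p assume p: "P p"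
    show "P (pderiv p)" unfolding P_def
    proof (intro allI impI)
      fix \<xi> N m assume \<xi>: "perp \<xi>" and m: "m < n" and N: "\<forall>j\<ge>N. coeff (pderiv p) j = 0"
      have pN: "\<forall>j\<ge>Suc N. coeff p j = 0"
      proof (intro allI impI)
        fix j assume "j \<ge> Suc N"
        then obtain j' where j': "j = Suc j'" "j' \<ge> N" by (cases j) auto
        then have "of_nat (Suc j') * coeff p (Suc j') = 0" using N by (simp add: coeff_pderiv)
        then show "coeff p j = 0" using j' by (metis mult_eq_0_iff of_nat_eq_0_iff nat.distinct(1))
      qed
      have 1: "(\<Sum>j<Suc N. coeff p j * (row Y ^^ j) (row X \<xi>) m) = 0"
        using p[unfolded P_def] perp_X[OF \<xi>] m pN by blast
      have "(\<Sum>j<Suc N. coeff p j * row X ((row Y ^^ j) \<xi>) m) = (\<Sum>k<n. (\<Sum>j<Suc N. coeff p j * (row Y ^^ j) \<xi> k) * X $$ (k, m))"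
        using m by (simp add: row_def sum_distrib_left sum_distrib_right mult.assoc del: sum.lessThan_Suc) (rule sum.swap)
      also have "\<dots> = 0"
      proof (rule sum.neutral, rule ballI)
        fix k assume "k \<in> {..<n}"
        then have "(\<Sum>j<Suc N. coeff p j * (row Y ^^ j) \<xi> k) = 0"
          using p[unfolded P_def] \<xi> pN by blast
        then show "(\<Sum>j<Suc N. coeff p j * (row Y ^^ j) \<xi> k) * X $$ (k, m) = 0" by simp
      qed
      finally have 2: "(\<Sum>j<Suc N. coeff p j * row X ((row Y ^^ j) \<xi>) m) = 0" .
      have "(\<Sum>j<Suc N. coeff p j * (row Y ^^ j) (row X \<xi>) m)
        = (\<Sum>j<Suc N. coeff p j * row X ((row Y ^^ j) \<xi>) m) + (\<Sum>j<Suc N. coeff p j * ((- of_nat j) * (row Y ^^ (j - 1)) \<xi> m))"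
        by (simp only: row_Y_pow_X[OF \<xi>] distrib_left sum.distrib)
      then have "(\<Sum>j<Suc N. coeff p j * ((- of_nat j) * (row Y ^^ (j - 1)) \<xi> m)) = 0" using 1 2 by simp
      also have "(\<Sum>j<Suc N. coeff p j * ((- of_nat j) * (row Y ^^ (j - 1)) \<xi> m))
        = - (\<Sum>j<N. coeff (pderiv p) j * (row Y ^^ j) \<xi> m)"
        unfolding sum.lessThan_Suc_shift sum_negf[symmetric]
        by (simp only: of_nat_0 minus_zero mult_zero_left mult_zero_right add_0_left)
          (rule sum.cong, simp_all add: coeff_pderiv algebra_simps)
      finally show "(\<Sum>j<N. coeff (pderiv p) j * (row Y ^^ j) \<xi> m) = 0" by simp
    qed
  qed
  then obtain c where c: "c \<noteq> 0" "P [:c:]" by blast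
  have "(\<Sum>j<1. coeff [:c:] j * (row Y ^^ j) \<xi> l) = 0"
    using c(2)[unfolded P_def, rule_format, of \<xi> l 1] assms by (auto simp: coeff_pCons split: nat.splits)
  then show ?thesis using c(1) by simp
qed

subsection \<open>The total colength\<close>

lemma yy_unit:
  assumes "supp \<xi>"
  shows "yy \<xi> i j = (\<Sum>k<n. \<xi> k * yy (\<lambda>m. if m = k then 1 else 0) i j)"
proof -
  have sum: "yy (\<lambda>m. \<Sum>k\<in>A. \<xi> k * e k m) i j = (\<Sum>k\<in>A. \<xi> k * yy (e k) i j)" for A :: "nat set" and e
  proof (induction A rule: infinite_finite_induct)
    case (insert x F)
    then show ?case using yy_add[of "\<lambda>m. \<xi> x * e x m" "\<lambda>m. \<Sum>k\<in>F. \<xi> k * e k m" i j]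
      by (simp add: yy_scale)
  qed (use yy_scale[of 0 "\<lambda>_. 0" i j] in simp_all)
  have "(\<Sum>k<n. \<xi> k * (if m = k then 1 else 0)) = \<xi> m" for m
  proof -
    have "(\<Sum>k<n. \<xi> k * (if m = k then 1 else 0)) = (\<Sum>k<n. if k = m then \<xi> m else 0)"
      by (rule sum.cong) auto
    also have "\<dots> = \<xi> m" using assms by (auto simp: supp_def)
    finally show ?thesis .
  qed
  then have "\<xi> = (\<lambda>m. \<Sum>k<n. \<xi> k * (if m = k then 1 else 0))" by (intro ext) simp
  then show ?thesis using sum[of "\<lambda>k m. if m = k then 1 else 0" "{..<n}"] by simp
qed

lemma pairing_K: "a \<in> K \<Longrightarrow> supp \<xi> \<Longrightarrow> pairing a (yy \<xi>) = 0" by (simp add: K_def)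

lemma M_module: "right_weyl_module M" using M0_module by (simp add: M_eq_M0)

lemma lead_M: "lead M i = lead K i" by (simp add: M_eq_M0 lead_M0)

lemma lead_M_poly: "f \<in> lead M i \<Longrightarrow> f \<in> range to_fract"
  unfolding lead_M using K_weyl by (auto simp: lead_def weyl_iff)

lemma lead_M_neg: assumes "i < 0" "f \<in> lead M i" shows "f = 0"
proof -
  obtain a where "a \<in> K" "f = pcoeff a i" using assms(2) unfolding lead_M by (auto simp: lead_def)
  then show ?thesis using K_weyl[of a] assms(1) by (simp add: weyl_iff)
qed

lemma dY_lead: "to_fract dY \<in> lead M (int i)"
proof -
  have "pcoeff (eval_at dY pZ) 0 \<in> lead M 0"
    using dY_in_M0 by (intro leadI) (simp_all add: M_eq_M0 eval_at_pZ ordle_pfun)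
  then show ?thesis using lead_Suc[OF M_module, of _ 0 i] by (simp add: eval_at_pZ pcoeff_pfun)
qed

lemma one_lead: "i \<ge> degree dX \<Longrightarrow> 1 \<in> lead M (int i)"
proof -
  assume i: "i \<ge> degree dX"
  let ?c = "lead_coeff dX"
  have c0: "?c \<noteq> 0" using shift_det_nonzero[OF X] by simp
  have "to_fract [:?c:] \<in> lead M (int (degree dX))"
    using kappa_in_M0 leadI[OF _ kappa_lead(1), of M] by (simp add: M_eq_M0 kappa_lead(2))
  then have "to_fract [:?c:] * to_fract [:1 / ?c:] \<in> lead M (int (degree dX))"
    by (rule lead_mult[OF M_module])
  moreover have "to_fract [:?c:] * to_fract [:1 / ?c:] = 1"
    using c0 by (simp flip: to_fract_mult add: one_pCons[symmetric])
  ultimately have "1 \<in> lead M (int (degree dX) + int (i - degree dX))"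
    using lead_Suc[OF M_module] by simp
  then show ?thesis using i by (simp add: of_nat_diff)
qed

lemma lead_M_principal: "\<exists>h. h \<noteq> 0 \<and> (\<forall>p. to_fract p \<in> lead M (int i) \<longleftrightarrow> h dvd p)"
proof -
  have "\<exists>h. h \<noteq> 0 \<and> (\<forall>p. p \<in> {p. to_fract p \<in> lead M (int i)} \<longleftrightarrow> h dvd p)"
  proof (rule poly_ideal_principal)
    show "dY \<in> {p. to_fract p \<in> lead M (int i)}" using dY_lead by simp
    show "dY \<noteq> 0" by (rule shift_det_nonzero[OF Y])
  qed (use lead_add[OF M_module] lead_mult[OF M_module] in auto)
  then show ?thesis by simp
qed

text \<open>The monomials \<open>z^j \<partial>^i\<close> with \<open>j < degree (h i)\<close> form
  a basis of the Weyl algebra modulo \<open>K\<close>: division by the \<open>h i\<close> shows that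
  they span, and a nonzero combination in \<open>K\<close> would have a top coefficient of degree
  too small for a multiple of \<open>h i\<close>.\<close>

theorem lead_M_colength:
  "\<exists>h. (\<forall>i. h i \<noteq> 0 \<and> (\<forall>p. to_fract p \<in> lead M (int i) \<longleftrightarrow> h i dvd p))
     \<and> (\<exists>N0. \<forall>i\<ge>N0. degree (h i) = 0)
     \<and> (\<forall>N. (\<forall>i\<ge>N. degree (h i) = 0) \<longrightarrow> (\<Sum>i<N. degree (h i)) = n)"
proof -
  have "\<forall>i. \<exists>h. h \<noteq> 0 \<and> (\<forall>p. to_fract p \<in> lead M (int i) \<longleftrightarrow> h dvd p)"
    using lead_M_principal by blast
  from choice[OF this] obtain h where h: "\<And>i. h i \<noteq> 0" "\<And>i p. to_fract p \<in> lead M (int i) \<longleftrightarrow> h i dvd p"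
    by blast
  have deg0: "degree (h i) = 0" if "i \<ge> degree dX" for i
  proof -
    have "h i dvd 1" using one_lead[OF that] h(2)[of 1] by simp
    then show ?thesis by (simp add: is_unit_iff_degree h(1))
  qed
  have "(\<Sum>i<N. degree (h i)) = n" if N: "\<forall>i\<ge>N. degree (h i) = 0" for N
  proof -
    define J where "J = (SIGMA i:{..<N}. {..<degree (h i)})"
    define y where "y k ij = yy (\<lambda>m. if m = k then 1 else 0) (fst ij) (snd ij)" for k and ij :: "nat \<times> nat"
    have fJ: "finite J" by (simp add: J_def)
    have cJ: "card J = (\<Sum>i<N. degree (h i))" by (simp add: J_def)
    \<comment> \<open>Too many monomials would have a nonzero combination in
      \<open>K\<close>.\<close>
    have "\<not> n < card J"
    proof
      assume "n < card J"
      then obtain c where c: "\<exists>j\<in>J. c j \<noteq> 0" "\<forall>k\<in>{..<n}. (\<Sum>j\<in>J. y k j * c j) = 0"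
        using homogeneous_system[of "{..<n}" J y] fJ by auto
      define p where "p i = (\<Sum>j<degree (h i). monom (c (i, j)) j)" for i
      have cp: "coeff (p i) j = (if j < degree (h i) then c (i, j) else 0)" for i j
        by (simp add: p_def coeff_sum)
      define a where "a = wop N p"
      have aw: "a \<in> weyl" by (simp add: a_def weyl_wop)
      have pa: "pairing a (yy \<xi>) = (\<Sum>ij\<in>J. c ij * yy \<xi> (fst ij) (snd ij))" for \<xi>
      proof -
        have "pairing a (yy \<xi>) = (\<Sum>i<N. pairing (pfun (to_fract (p i)) * pD ^ i) (yy \<xi>))"
          unfolding a_def wop_def by (rule pairing_sum) (rule weyl_monomial)
        also have "\<dots> = (\<Sum>i<N. \<Sum>j<degree (h i). c (i, j) * yy \<xi> i j)"
        proof (rule sum.cong[OF refl])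
          fix i
          have "(\<Sum>j\<le>degree (p i). coeff (p i) j * yy \<xi> i j)
             = (\<Sum>j\<in>{..degree (p i)} \<union> {..<degree (h i)}. coeff (p i) j * yy \<xi> i j)"
            by (rule sum.mono_neutral_left) (auto simp: coeff_eq_0)
          also have "\<dots> = (\<Sum>j<degree (h i). coeff (p i) j * yy \<xi> i j)"
            by (rule sum.mono_neutral_right) (auto simp: cp)
          finally show "pairing (pfun (to_fract (p i)) * pD ^ i) (yy \<xi>) = (\<Sum>j<degree (h i). c (i, j) * yy \<xi> i j)"
            by (simp add: pairing_monomial cp)
        qed
        also have "\<dots> = (\<Sum>ij\<in>J. c ij * yy \<xi> (fst ij) (snd ij))"
          unfolding J_def by (subst sum.Sigma) (auto intro!: sum.cong)
        finally show ?thesis .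
      qed
      have supp0: "pairing a (yy \<xi>) = 0" if "supp \<xi>" for \<xi>
      proof -
        have "pairing a (yy \<xi>) = (\<Sum>ij\<in>J. \<Sum>k<n. \<xi> k * (y k ij * c ij))"
          unfolding pa by (rule sum.cong) (simp_all add: yy_unit[OF that] y_def sum_distrib_left ac_simps)
        also have "\<dots> = (\<Sum>k<n. \<xi> k * (\<Sum>ij\<in>J. y k ij * c ij))"
          by (subst sum.swap) (simp add: sum_distrib_left)
        also have "\<dots> = 0" using c(2) by simp
        finally show ?thesis .
      qed
      then have aK: "a \<in> K" using aw by (simp add: K_def)
      have "a \<noteq> 0"
      proof
        assume "a = 0"
        obtain i j where ij: "(i, j) \<in> J" "c (i, j) \<noteq> 0" using c(1) by auto
        then have "p i = 0" using \<open>a = 0\<close> wcoeff_wop[of N p i] by (simp add: a_def J_def)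
        then show False using ij cp[of i j] by (simp add: J_def)
      qed
      then obtain e where e: "ordle a e" "pcoeff a e \<noteq> 0" using top_ex by blast
      then have e0: "0 \<le> e \<and> e < int N" unfolding a_def by (metis pcoeff_wop)
      then have ei: "e = int (nat e)" "nat e < N" by auto
      have pe: "pcoeff a e = to_fract (p (nat e))" using e0 by (simp add: a_def pcoeff_wop)
      have "to_fract (p (nat e)) \<in> lead M (int (nat e))"
        using leadI[OF aK e(1)] ei(1) pe by (simp add: lead_M)
      then have d: "h (nat e) dvd p (nat e)" using h(2) by blast
      have pn: "p (nat e) \<noteq> 0" using e(2) pe by simp
      then have "degree (h (nat e)) \<le> degree (p (nat e))" using d by (rule dvd_imp_degree_le[rotated])
      then have "coeff (p (nat e)) (degree (p (nat e))) = 0" using cp by simp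
      then show False using pn by simp
    qed
    \<comment> \<open>Too few would leave a nonzero row vector killing all of them.\<close>
    moreover have "\<not> card J < n"
    proof
      assume "card J < n"
      then obtain \<xi>0 where x0: "\<exists>k\<in>{..<n}. \<xi>0 k \<noteq> 0" "\<forall>ij\<in>J. (\<Sum>k<n. y k ij * \<xi>0 k) = 0"
        using homogeneous_system[of J "{..<n}" "\<lambda>ij k. y k ij"] fJ by auto
      define \<xi> where "\<xi> m = (if m < n then \<xi>0 m else 0)" for m
      have sx: "supp \<xi>" by (simp add: supp_def \<xi>_def)
      have yJ: "yy \<xi> i j = 0" if "(i, j) \<in> J" for i j
        using x0(2)[rule_format, OF that] by (simp add: yy_unit[OF sx] y_def \<xi>_def mult.commute)
      \<comment> \<open>Order by order: an element of \<open>K\<close> reduces the top coefficient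
        modulo \<open>h t\<close>, and the remainder is a combination of the monomials in
        \<open>J\<close>.\<close>
      have van: "pairing a (yy \<xi>) = 0" if "a \<in> weyl" "ordle a (int t - 1)" for a t
        using that
      proof (induction t arbitrary: a)
        case 0
        have "a = 0"
        proof (rule pdo_eqI)
          fix i show "pcoeff a i = pcoeff 0 i"
            using 0 by (cases "i < 0") (simp_all add: weyl_iff ordle_def)
        qed
        then show ?case by simp
      next
        case (Suc t)
        define p where "p = wcoeff a t"
        have "h t dvd p - p mod h t" by (rule dvd_minus_mod)
        then have "to_fract (p - p mod h t) \<in> lead K (int t)" using h(2) lead_M by blast
        then obtain b where b: "b \<in> K" "ordle b (int t)" "to_fract (p - p mod h t) = pcoeff b (int t)"
          by (auto simp: lead_def)
        define r where "r = pfun (to_fract (p mod h t)) * pD ^ t"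
        have rw: "r \<in> weyl" by (simp add: r_def weyl_monomial)
        have or: "ordle r (int t)" "pcoeff r (int t) = to_fract (p mod h t)"
          unfolding r_def by (auto simp: ordle_def pcoeff_pfun simp del: pcoeff_pfun_mult)
        define a' where "a' = a - b - r"
        have a'w: "a' \<in> weyl" using Suc.prems(1) K_weyl[OF b(1)] rw by (simp add: a'_def weyl_diff)
        have "ordle a (int t)" using Suc.prems(2) by simp
        then have o: "ordle a' (int t)" unfolding a'_def by (intro ordle_diff b or)
        have "pcoeff a' (int t) = 0"
          using wcoeff[OF Suc.prems(1), of t] by (simp add: a'_def or b(3)[symmetric] p_def to_fract_diff)
        then have "pairing a' (yy \<xi>) = 0" using Suc.IH[OF a'w] ordle_pred[OF o] by simp
        moreover have "pairing r (yy \<xi>) = 0"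
        proof -
          have "coeff (p mod h t) j * yy \<xi> t j = 0" for j
          proof (cases "j < degree (h t)")
            case True
            then have "t < N" using N by (metis not_le not_less_zero)
            then show ?thesis using yJ[of t j] True by (simp add: J_def)
          next
            case False
            then have "coeff (p mod h t) j = 0"
              using degree_mod_less[OF h(1)[of t], of p] by (metis coeff_0 coeff_eq_0 leI le_less_trans)
            then show ?thesis by simp
          qed
          then show ?thesis by (simp add: r_def pairing_monomial)
        qed
        moreover have "a = a' + (b + r)" by (simp add: a'_def)
        ultimately show ?case using pairing_K[OF b(1) sx] a'w K_weyl[OF b(1)] rw
          by (simp add: pairing_add weyl_add del: add_diff_eq)
      qed
      have "yy \<xi> i j = 0" for i j
      proof -
        let ?a = "pfun (to_fract (monom 1 j)) * pD ^ i"
        have "ordle ?a (int (Suc i) - 1)" by (auto simp: ordle_def pcoeff_pfun simp del: pcoeff_pfun_mult)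
        then have "pairing ?a (yy \<xi>) = 0" by (rule van[OF weyl_monomial])
        then have "(\<Sum>m\<le>j. (if m = j then yy \<xi> i j else 0)) = 0"
          by (simp add: pairing_monomial degree_monom_eq if_distrib[of "\<lambda>x. x * _"] eq_commute[of j] cong: if_cong)
        then show ?thesis by simp
      qed
      then have "perp \<xi>" using sx by (simp add: perp_def)
      moreover obtain k where "k < n" "\<xi>0 k \<noteq> 0" using x0(1) by auto
      ultimately show False using perp_0[of \<xi> k] by (simp add: \<xi>_def)
    qed
    ultimately show ?thesis using cJ by simp
  qed
  then show ?thesis using h deg0 by blast
qed

end

section \<open>Falling factorials\<close>

text \<open>The factor produced by the j-th derivative of an m-th power; as a function of m it is a
  polynomial of degree j.\<close>

definition ffl :: "nat \<Rightarrow> nat \<Rightarrow> nat" where "ffl m j = (\<Prod>i<j. m - i)"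

lemma ffl_0 [simp]: "ffl m 0 = 1" by (simp add: ffl_def)
lemma ffl_Suc: "ffl m (Suc j) = ffl m j * (m - j)" by (simp add: ffl_def)
lemma ffl_eq_0: "m < j \<Longrightarrow> ffl m j = 0" by (auto simp: ffl_def intro!: bexI[of _ m])

lemma pderivs_linear_power:
  fixes l :: complex
  shows "(pderiv ^^ j) ([:- l, 1:] ^ m) = smult (of_nat (ffl m j)) ([:- l, 1:] ^ (m - j))"
proof (induction j)
  case (Suc j)
  have "pderiv ([:- l, 1:] ^ (m - j)) = smult (of_nat (m - j)) ([:- l, 1:] ^ (m - Suc j))"
    by (simp add: pderiv_power pderiv_pCons one_pCons[symmetric])
  then show ?case by (simp add: Suc pderiv_smult ffl_Suc)
qed simp

text \<open>The combination is a polynomial in m of degree at most \<open>i\<close> with more than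
  \<open>i\<close> zeros; distinct degrees then separate the coefficients.\<close>

lemma ffl_independent:
  fixes a :: "nat \<Rightarrow> complex"
  assumes "finite B" "card B > i" "\<And>m. m \<in> B \<Longrightarrow> (\<Sum>j\<le>i. a j * of_nat (ffl m j)) = 0"
  shows "\<forall>j\<le>i. a j = 0"
proof -
  define FF :: "nat \<Rightarrow> complex poly" where "FF j = (\<Prod>k<j. [:- of_nat k, 1:])" for j
  have FFd: "degree (FF j) = j" "lead_coeff (FF j) = 1" for j
  proof -
    show "degree (FF j) = j" by (simp add: FF_def degree_prod_eq_sum_degree)
    have "lead_coeff (FF j) = (\<Prod>k<j. lead_coeff [:- of_nat k, 1:])" by (simp only: FF_def lead_coeff_prod)
    then show "lead_coeff (FF j) = 1" by simp
  qed
  have FFp: "poly (FF j) (of_nat m) = of_nat (ffl m j)" for j m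
  proof (induction j)
    case (Suc j)
    have "FF (Suc j) = FF j * [:- of_nat j, 1:]" by (simp add: FF_def)
    then have "poly (FF (Suc j)) (of_nat m) = of_nat (ffl m j) * (of_nat m - of_nat j)"
      by (simp only: poly_mult Suc) simp
    then show ?case
      by (cases "j \<le> m") (simp_all add: ffl_Suc of_nat_diff ffl_eq_0)
  qed (simp add: FF_def)
  define Q where "Q = (\<Sum>j\<le>i. smult (a j) (FF j))"
  have Qd: "degree Q \<le> i" unfolding Q_def
    by (rule degree_sum_le) (auto simp: FFd intro: order_trans[OF degree_smult_le])
  have Qp: "poly Q (of_nat m) = (\<Sum>j\<le>i. a j * of_nat (ffl m j))" for m
    by (simp add: Q_def poly_sum FFp)
  have "Q = 0"
  proof (rule ccontr)
    assume Q0: "Q \<noteq> 0"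
    have "card (of_nat ` B :: complex set) \<le> card {x. poly Q x = 0}"
      using poly_roots_finite[OF Q0] assms(3) Qp by (intro card_mono) auto
    also have "\<dots> \<le> degree Q" using Q0 by (rule card_poly_roots_bound)
    finally show False using assms(2) Qd by (simp add: card_image inj_on_def)
  qed
  then have "(\<Sum>j\<le>i. smult (a j) (FF j)) = 0" by (simp add: Q_def)
  then show ?thesis
  proof (induction i)
    case 0
    then show ?case by (simp add: FF_def)
  next
    case (Suc i)
    have "degree (\<Sum>j\<le>i. smult (a j) (FF j)) \<le> i"
      by (rule degree_sum_le) (auto simp: FFd intro: order_trans[OF degree_smult_le])
    then have "coeff (\<Sum>j\<le>i. smult (a j) (FF j)) (Suc i) = 0"
      by (intro coeff_eq_0) simp
    moreover have "coeff (FF (Suc i)) (Suc i) = 1" using FFd[of "Suc i"] by simp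
    ultimately have "a (Suc i) = 0"
      using arg_cong[OF Suc.prems, of "\<lambda>p. coeff p (Suc i)"] by simp
    moreover from this have "\<forall>j\<le>i. a j = 0" using Suc.prems by (intro Suc.IH) simp
    ultimately show ?case unfolding le_Suc_eq by blast
  qed
qed

lemma ffl_interpolation:
  fixes b :: "nat \<Rightarrow> complex"
  assumes "finite B" "card B \<le> i"
  shows "\<exists>c. \<forall>m\<in>B. (\<Sum>j<i. c j * of_nat (ffl m j)) = b m"
proof -
  \<comment> \<open>Polynomial functions of m of degree below \<open>i\<close>, in falling-factorial
    coordinates, because operators act through these. Multiplication by m uses
    \<open>m ffl m j = ffl m (j+1) + j ffl m j\<close>; Newton interpolation then adds one point at
    a time.\<close>
  define S where "S i = {q :: nat \<Rightarrow> complex. \<exists>c. \<forall>m. q m = (\<Sum>j<i. c j * of_nat (ffl m j))}" for i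
  have add: "(\<lambda>m. q m + r m) \<in> S i" if qr: "q \<in> S i" "r \<in> S i" for q r i
  proof -
    obtain c d where "\<forall>m. q m = (\<Sum>j<i. c j * of_nat (ffl m j))" "\<forall>m. r m = (\<Sum>j<i. d j * of_nat (ffl m j))"
      using qr unfolding S_def by blast
    then show ?thesis unfolding S_def
      by (auto simp: distrib_right sum.distrib intro!: exI[of _ "\<lambda>j. c j + d j"])
  qed
  have scale: "(\<lambda>m. x * q m) \<in> S i" if q: "q \<in> S i" for x q i
  proof -
    obtain c where "\<forall>m. q m = (\<Sum>j<i. c j * of_nat (ffl m j))" using q unfolding S_def by blast
    then show ?thesis unfolding S_def
      by (auto simp: sum_distrib_left mult.assoc intro!: exI[of _ "\<lambda>j. x * c j"])
  qed
  have mono: "q \<in> S (Suc i)" if q: "q \<in> S i" for q i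
  proof -
    obtain c where "\<forall>m. q m = (\<Sum>j<i. c j * of_nat (ffl m j))" using q unfolding S_def by blast
    then show ?thesis unfolding S_def by (auto intro!: exI[of _ "\<lambda>j. if j < i then c j else 0"])
  qed
  have shift: "(\<lambda>m. of_nat m * q m) \<in> S (Suc i)" if q: "q \<in> S i" for q i
  proof -
    obtain c where c: "\<forall>m. q m = (\<Sum>j<i. c j * of_nat (ffl m j))" using q unfolding S_def by blast
    have e: "of_nat m * (of_nat (ffl m j) :: complex) = of_nat (ffl m (Suc j)) + of_nat j * of_nat (ffl m j)" for m j
      by (cases "j \<le> m") (simp_all add: ffl_Suc ffl_eq_0 of_nat_diff algebra_simps)
    define d where "d j = (if j = 0 then 0 else c (j - 1)) + (if j < i then of_nat j * c j else 0)" for j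
    have "of_nat m * q m = (\<Sum>j<Suc i. d j * of_nat (ffl m j))" for m
    proof -
      have "of_nat m * q m = (\<Sum>j<i. c j * (of_nat m * of_nat (ffl m j)))"
        by (simp add: c sum_distrib_left ac_simps)
      also have "\<dots> = (\<Sum>j<i. c j * of_nat (ffl m (Suc j))) + (\<Sum>j<i. of_nat j * c j * of_nat (ffl m j))"
        unfolding e sum.distrib[symmetric] by (rule sum.cong) (auto simp: algebra_simps)
      also have "(\<Sum>j<i. c j * of_nat (ffl m (Suc j))) = (\<Sum>j<Suc i. (if j = 0 then 0 else c (j - 1)) * of_nat (ffl m j))"
        by (subst sum.lessThan_Suc_shift) simp
      also have "(\<Sum>j<i. of_nat j * c j * of_nat (ffl m j)) = (\<Sum>j<Suc i. (if j < i then of_nat j * c j else 0) * of_nat (ffl m j))"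
        by simp
      finally show ?thesis by (simp only: d_def distrib_right sum.distrib)
    qed
    then show ?thesis unfolding S_def by blast
  qed
  have "\<exists>q\<in>S (card B). \<forall>m\<in>B. q m = b m" using assms(1)
  proof (induction B rule: finite_induct)
    case empty
    then show ?case by (auto simp: S_def intro!: exI[of _ "\<lambda>_. 0"])
  next
    case (insert x B)
    then obtain q where q: "q \<in> S (card B)" "\<forall>m\<in>B. q m = b m" by blast
    have prod: "(\<lambda>m. \<Prod>y\<in>A. of_nat m - of_nat y) \<in> S (Suc (card A))" if "finite A" for A
      using that
    proof (induction A rule: finite_induct)
      case empty
      show ?case unfolding S_def by (auto intro!: exI[of _ "\<lambda>_. 1"])
    next
      case (insert z A)
      have "(\<lambda>m. of_nat m * (\<Prod>y\<in>A. of_nat m - of_nat y) + (- of_nat z) * (\<Prod>y\<in>A. of_nat m - of_nat y)) \<in> S (Suc (Suc (card A)))"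
        by (intro add shift scale mono insert.IH)
      then show ?case using insert.hyps by (simp add: algebra_simps)
    qed
    define P where "P m = (\<Prod>y\<in>B. of_nat m - of_nat y :: complex)" for m :: nat
    have Px: "P x \<noteq> 0" using insert.hyps by (auto simp: P_def)
    have PB: "P m = 0" if "m \<in> B" for m using that insert.hyps by (auto simp: P_def)
    have "(\<lambda>m. q m + ((b x - q x) / P x) * P m) \<in> S (Suc (card B))"
      using add[OF mono[OF q(1)] scale[OF prod[OF insert.hyps(1)], of "(b x - q x) / P x"]] by (simp add: P_def)
    moreover have "\<forall>m\<in>insert x B. q m + ((b x - q x) / P x) * P m = b m"
      using Px PB q by auto
    ultimately show ?case unfolding card_insert_disjoint[OF insert.hyps] 
      by (intro bexI[of _ "\<lambda>m. q m + ((b x - q x) / P x) * P m"])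
  qed
  then obtain q where q: "q \<in> S (card B)" "\<forall>m\<in>B. q m = b m" by blast
  have "q \<in> S (card B + k)" for k by (induction k) (use q mono in auto)
  from this[of "i - card B"] have "q \<in> S i" using assms(2) by simp
  then obtain c where "\<forall>m. q m = (\<Sum>j<i. c j * of_nat (ffl m j))" unfolding S_def by blast
  then show ?thesis using q(2) by (intro exI[of _ c]) simp
qed

section \<open>The action on polynomials\<close>

lemma rderivs_to_fract: "rderivs j (to_fract p) = to_fract ((pderiv ^^ j) p)"
  by (induction j) (simp_all add: rderiv_to_fract)

lemma act_eq:
  assumes "ordle P (int e)"
  shows "act P f = (\<Sum>j\<le>e. pcoeff P (int j) * rderivs j f)"
  unfolding act_def
  by (rule sum.mono_neutral_left) (use assms in \<open>auto simp: ordle_def not_less[symmetric] simp del: funpow.simps\<close>)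

lemma act_pfun: "act (pfun g * P) f = g * act P f"
proof -
  obtain e where e: "ordle P (int e)" using ordle_ex_nat by blast
  then have "ordle (pfun g * P) (int e)" by (simp add: ordle_def)
  then show ?thesis using e by (simp add: act_eq sum_distrib_left mult.assoc del: funpow.simps)
qed

lemma act_pD: assumes "pcoeff P (-1) = 0" shows "act (P * pD) f = act P (rderiv f)"
proof -
  obtain e where e: "ordle P (int e)" using ordle_ex_nat by blast
  then have o: "ordle (P * pD) (int (Suc e))" by (simp add: ordle_def)
  have "act (P * pD) f = (\<Sum>j\<le>Suc e. pcoeff P (int j - 1) * rderivs j f)"
    unfolding act_eq[OF o] by (simp only: pcoeff_mult_pD)
  also have "\<dots> = (\<Sum>j\<le>e. pcoeff P (int j) * rderivs (Suc j) f)"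
    by (subst sum.atMost_Suc_shift) (simp add: assms del: funpow.simps)
  also have "\<dots> = act P (rderiv f)" using e by (simp add: act_eq funpow_Suc_right del: funpow.simps)
  finally show ?thesis .
qed

lemma act_weyl:
  assumes "P \<in> weyl" "ordle P (int e)"
  shows "act P (to_fract p) = to_fract (\<Sum>j\<le>e. wcoeff P j * (pderiv ^^ j) p)"
  using assms by (simp add: act_eq rderivs_to_fract wcoeff[symmetric] to_fract_sum del: funpow.simps)

text \<open>Applied to \<open>z^i\<close>, the operator involves only coefficients up to the i-th,
  and that one with the factor i!; so polynomial values force polynomial coefficients one after the
  other.\<close>

lemma weyl_if_act:
  assumes P: "P \<in> diffops" and a: "\<And>p. act P (to_fract p) \<in> range to_fract"
  shows "P \<in> weyl"
proof -
  obtain e where e: "ordle P (int e)" using ordle_ex_nat by blast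
  have "pcoeff P (int i) \<in> range to_fract" for i
  proof (induction i rule: less_induct)
    case (less i)
    let ?m = "[:- 0, 1:] ^ i :: complex poly"
    have oe: "ordle P (int (max e i))" using e by (rule ordle_mono) simp
    have pl: "(pderiv ^^ j) ?m = smult (of_nat (ffl i j)) ([:- 0, 1:] ^ (i - j))" for j
      by (rule pderivs_linear_power)
    have "act P (to_fract ?m) = (\<Sum>j\<le>max e i. pcoeff P (int j) * to_fract ((pderiv ^^ j) ?m))"
      by (simp only: act_eq[OF oe] rderivs_to_fract)
    also have "\<dots> = (\<Sum>j\<in>insert i {..<i}. pcoeff P (int j) * to_fract ((pderiv ^^ j) ?m))"
      unfolding pl by (rule sum.mono_neutral_right) (auto simp: ffl_eq_0)
    also have "\<dots> = pcoeff P (int i) * to_fract ((pderiv ^^ i) ?m) + (\<Sum>j<i. pcoeff P (int j) * to_fract ((pderiv ^^ j) ?m))"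
      by (rule sum.insert) auto
    also have "(pderiv ^^ i) ?m = [:of_nat (ffl i i):]"
      unfolding pderivs_linear_power by simp
    finally have 1: "pcoeff P (int i) * to_fract [:of_nat (ffl i i):] = act P (to_fract ?m) + - (\<Sum>j<i. pcoeff P (int j) * to_fract ((pderiv ^^ j) ?m))"
      by simp
    have "(\<Sum>j<i. pcoeff P (int j) * to_fract ((pderiv ^^ j) ?m)) \<in> range to_fract"
      by (rule range_to_fract_sum) (auto intro!: range_to_fract_closed less)
    then have "pcoeff P (int i) * to_fract [:of_nat (ffl i i):] \<in> range to_fract"
      unfolding 1 by (intro range_to_fract_closed(1,3) a)
    then have "pcoeff P (int i) * to_fract [:of_nat (ffl i i):] * to_fract [:1 / of_nat (ffl i i):] \<in> range to_fract"
      by (rule range_to_fract_closed(2)[OF _ rangeI])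
    moreover have "pcoeff P (int i) * to_fract [:of_nat (ffl i i):] * to_fract [:1 / of_nat (ffl i i):] = pcoeff P (int i)"
    proof -
      have "ffl i i \<noteq> 0" by (simp add: ffl_def)
      then have "to_fract [:of_nat (ffl i i):] * to_fract [:1 / of_nat (ffl i i):] = (1 :: ratfun)"
        by (simp flip: to_fract_mult add: one_pCons[symmetric])
      then show ?thesis by (simp only: mult.assoc mult_1_right)
    qed
    ultimately show ?case by (simp only:)
  qed
  then have "pcoeff P k \<in> range to_fract" for k
  proof (cases "k < 0")
    case True
    then have "pcoeff P k = 0" using P by (simp add: diffops_def)
    then show ?thesis using range_to_fract_closed(4) by simp
  next
    case False
    then have "k = int (nat k)" by simp
    then show ?thesis using \<open>\<And>i. pcoeff P (int i) \<in> range to_fract\<close> by metis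
  qed
  then show ?thesis using P by (simp add: weyl_def)
qed

abbreviation dop :: "nat \<Rightarrow> (nat \<Rightarrow> complex poly) \<Rightarrow> complex poly \<Rightarrow> complex poly"
  where "dop i f p \<equiv> \<Sum>j\<le>i. f j * (pderiv ^^ j) p"

lemma poly_span_powers:
  fixes T :: "complex poly set"
  assumes z: "0 \<in> T" and add: "\<And>p q. p \<in> T \<Longrightarrow> q \<in> T \<Longrightarrow> p + q \<in> T"
    and smult: "\<And>c p. p \<in> T \<Longrightarrow> smult c p \<in> T" and pow: "\<And>m. [:- l, 1:] ^ m \<in> T"
  shows "p \<in> T"
proof -
  \<comment> \<open>Strengthened by an arbitrary power, since peeling off a coefficient multiplies
    by \<open>z = (z - l) + l\<close>.\<close>
  have "\<forall>m. [:- l, 1:] ^ m * p \<in> T"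
  proof (induction p)
    case (pCons a q)
    have "[:- l, 1:] ^ m * pCons a q \<in> T" for m
    proof -
      have "pCons a q = [:a:] + [:- l, 1:] * q + smult l q" by simp
      then have "[:- l, 1:] ^ m * pCons a q = [:- l, 1:] ^ m * ([:a:] + [:- l, 1:] * q + smult l q)" by (rule arg_cong)
      also have "\<dots> = smult a ([:- l, 1:] ^ m) + [:- l, 1:] ^ Suc m * q + smult l ([:- l, 1:] ^ m * q)"
        by (simp only: distrib_left power_Suc2 mult.assoc mult_smult_right) (simp add: mult.commute)
      finally have e: "[:- l, 1:] ^ m * pCons a q = \<dots>" .
      show ?thesis unfolding e by (intro add smult pow pCons.IH[rule_format])
    qed
    then show ?case by simp
  qed (simp add: z)
  from this[rule_format, of 0] show ?thesis by simp
qed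

section \<open>Local analysis at a point\<close>

text \<open>A nonzero polynomial q of degree \<open>i\<close> has at most \<open>i\<close> zeros,
  and \<open>z^s q(z\<partial>)\<close> needs one for every m with m + s a gap; this is the least
  non-negative weight s leaving enough zeros.\<close>

definition sgap :: "nat set \<Rightarrow> nat \<Rightarrow> nat"
  where "sgap G i = (LEAST s. card {x\<in>G. s \<le> x} \<le> i)"

text \<open>The least order at \<open>\<lambda>\<close> of leading coefficients of order-\<open>i\<close> operators with values in \<open>V\<^sub>\<lambda>\<close>, \<open>G\<close> being the gaps.\<close>
definition lorder :: "nat set \<Rightarrow> nat \<Rightarrow> nat"
  where "lorder G i = sgap G i + min i (card G)"

lemma sgap_card:
  assumes "finite G" shows "card {x\<in>G. sgap G i \<le> x} \<le> i"
  unfolding sgap_def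
proof (rule LeastI)
  have e: "{x\<in>G. Suc (Max G) \<le> x} = {}" using assms by (auto simp: Suc_le_eq) (meson Max_ge not_le)
  show "card {x\<in>G. Suc (Max G) \<le> x} \<le> i" unfolding e by simp
qed

lemma sgap_less: "s < sgap G i \<Longrightarrow> card {x\<in>G. s \<le> x} > i"
  unfolding sgap_def using not_less_Least by fastforce

lemma sgap_0: "finite G \<Longrightarrow> card G \<le> i \<Longrightarrow> sgap G i = 0"
  unfolding sgap_def by (rule Least_equality) auto

text \<open>With the possibly negative weight s = t - i, the set consists of the m for which m + s
  is negative or a gap. Beyond \<open>card G\<close> the threshold weight is
  \<open>card G - i\<close>, so the order \<open>s + i\<close> stays at \<open>card G\<close>: this
  is the origin of the \<open>min\<close> in \<open>lorder\<close>.\<close>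

lemma card_shifted:
  assumes G: "finite G" and t: "t < lorder G i"
  shows "finite {m. m + t < i \<or> m + t - i \<in> G \<and> i \<le> m + t} \<and> i < card {m. m + t < i \<or> m + t - i \<in> G \<and> i \<le> m + t}"
proof (cases "i \<le> t")
  case True
  have "i \<le> card G"
  proof (rule ccontr)
    assume "\<not> i \<le> card G"
    then show False using sgap_0[OF G, of i] t True by (simp add: lorder_def)
  qed
  then have s: "t - i < sgap G i" using t True by (simp add: lorder_def)
  have bij: "bij_betw (\<lambda>m. m + (t - i)) {m. m + t < i \<or> m + t - i \<in> G \<and> i \<le> m + t} {x\<in>G. t - i \<le> x}"
    by (rule bij_betwI[where g = "\<lambda>x. x - (t - i)"]) (use True in auto)
  show ?thesis unfolding bij_betw_finite[OF bij] bij_betw_same_card[OF bij] using sgap_less[OF s] G by simp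
next
  case False
  define d where "d = i - t"
  have e: "{m. m + t < i \<or> m + t - i \<in> G \<and> i \<le> m + t} = {..<d} \<union> (\<lambda>x. x + d) ` G"
  proof (intro equalityI subsetI)
    fix m assume "m \<in> {m. m + t < i \<or> m + t - i \<in> G \<and> i \<le> m + t}"
    moreover have "m \<in> (\<lambda>x. x + d) ` G" if "m + t - i \<in> G" "i \<le> m + t"
      using that False by (intro image_eqI[of _ _ "m + t - i"]) (auto simp: d_def)
    ultimately show "m \<in> {..<d} \<union> (\<lambda>x. x + d) ` G" by (auto simp: d_def)
  next
    fix m assume m: "m \<in> {..<d} \<union> (\<lambda>x. x + d) ` G"
    show "m \<in> {m. m + t < i \<or> m + t - i \<in> G \<and> i \<le> m + t}"
    proof (cases "m < d")
      case False
      then obtain x where "x \<in> G" "m = x + d" using m by auto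
      then have "m + t - i = x" "i \<le> m + t" using \<open>\<not> i \<le> t\<close> by (auto simp: d_def)
      then show ?thesis using \<open>x \<in> G\<close> by simp
    qed (auto simp: d_def)
  qed
  have "card ({..<d} \<union> (\<lambda>x. x + d) ` G) = d + card G"
    using G by (subst card_Un_disjoint) (auto simp: card_image)
  moreover have "t < card G"
  proof (cases "i \<le> card G")
    case True
    then show ?thesis using False by simp
  next
    case 2: False
    then show ?thesis using t sgap_0[OF G, of i] by (simp add: lorder_def)
  qed
  ultimately show ?thesis unfolding e using G False by (auto simp: d_def)
qed

text \<open>If all weights are at least t - i, the component of weight t - i sends the power m to
  the power m + t - i times a polynomial in m of degree at most \<open>i\<close>. That polynomial
  vanishes whenever the exponent is not a vanishing order, which is too often unless it is
  zero.\<close>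

lemma leading_divisible:
  fixes f :: "nat \<Rightarrow> complex poly"
  assumes V: "\<And>m. dop i f ([:- l, 1:] ^ m) \<in> V"
    and G: "finite (- vanishing_orders l V)"
  shows "[:- l, 1:] ^ lorder (- vanishing_orders l V) i dvd f i"
proof -
  let ?L = "[:- l, 1:]" and ?G = "- vanishing_orders l V"
  \<comment> \<open>The factor \<open>?L ^ (i - j)\<close> expresses that all weights are at least t
    - i without negative exponents.\<close>
  have "\<forall>j\<le>i. ?L ^ t dvd f j * ?L ^ (i - j)" if "t \<le> lorder ?G i" for t
    using that
  proof (induction t)
    case (Suc t)
    then have "\<forall>j. \<exists>g. j \<le> i \<longrightarrow> f j * ?L ^ (i - j) = ?L ^ t * g" by (auto simp: dvd_def)
    from choice[OF this] obtain g where g: "\<And>j. j \<le> i \<Longrightarrow> f j * ?L ^ (i - j) = ?L ^ t * g j" by blast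
    define B where "B = {m. m + t < i \<or> m + t - i \<in> ?G \<and> i \<le> m + t}"
    have B: "finite B" "card B > i" using card_shifted[OF G, of t i] Suc.prems by (auto simp: B_def)
    have q0: "(\<Sum>j\<le>i. poly (g j) l * of_nat (ffl m j)) = 0" if m: "m \<in> B" for m
    proof (rule ccontr)
      assume q: "(\<Sum>j\<le>i. poly (g j) l * of_nat (ffl m j)) \<noteq> 0"
      define S where "S = (\<Sum>j\<le>i. smult (of_nat (ffl m j)) (g j))"
      define D where "D = dop i f (?L ^ m)"
      have "poly S l \<noteq> 0" using q by (simp add: S_def poly_sum mult.commute)
      then have S: "S \<noteq> 0" "order l S = 0" by (auto simp: order_root)
      have "?L ^ i * D = (\<Sum>j\<le>i. ?L ^ (m + t) * smult (of_nat (ffl m j)) (g j))"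
        unfolding D_def sum_distrib_left
      proof (rule sum.cong[OF refl])
        fix j assume "j \<in> {..i}"
        then have j: "j \<le> i" by simp
        show "?L ^ i * (f j * (pderiv ^^ j) (?L ^ m)) = ?L ^ (m + t) * smult (of_nat (ffl m j)) (g j)"
        proof (cases "j \<le> m")
          case True
          have "?L ^ i * (f j * ?L ^ (m - j)) = f j * ?L ^ (i - j) * ?L ^ m"
            using j True by (simp add: power_add[symmetric] mult.assoc mult.left_commute[of "?L ^ i"])
          also have "\<dots> = ?L ^ (m + t) * g j" by (simp only: g[OF j] power_add mult.assoc mult.commute mult.left_commute)
          finally show ?thesis unfolding pderivs_linear_power by (simp only: mult_smult_right)
        next
          case False
          then show ?thesis unfolding pderivs_linear_power by (simp add: ffl_eq_0)
        qed
      qed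
      then have e: "?L ^ i * D = ?L ^ (m + t) * S" by (simp add: S_def sum_distrib_left)
      have nz: "?L ^ (m + t) * S \<noteq> 0" using S by simp
      then have D0: "D \<noteq> 0" using e by auto
      have "i + order l D = m + t + 0"
      proof -
        have nz2: "?L ^ i * D \<noteq> 0" using e nz by simp
        have "order l (?L ^ i * D) = i + order l D"
          unfolding order_mult[OF nz2] order_power_n_n ..
        moreover have "order l (?L ^ (m + t) * S) = m + t + 0"
          unfolding order_mult[OF nz] order_power_n_n S(2) ..
        ultimately show ?thesis using e by simp
      qed
      then have "i \<le> m + t" "order l D = m + t - i" by auto
      moreover have "D \<in> V" unfolding D_def by (rule V)
      ultimately have "m + t - i \<in> vanishing_orders l V" "i \<le> m + t" using D0 by (auto simp: vanishing_orders_def)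
      then show False using m by (auto simp: B_def)
    qed
    have "\<forall>j\<le>i. poly (g j) l = 0" by (rule ffl_independent[OF B]) (rule q0)
    then show ?case
    proof (intro allI impI)
      fix j assume "\<forall>j\<le>i. poly (g j) l = 0" and j: "j \<le> i"
      then have "?L dvd g j" by (simp add: poly_eq_0_iff_dvd)
      then have "?L ^ t * ?L dvd ?L ^ t * g j" by (rule mult_dvd_mono[OF dvd_refl])
      then show "?L ^ Suc t dvd f j * ?L ^ (i - j)" by (simp only: g[OF j] power_Suc2)
    qed
  qed simp
  from this[of "lorder ?G i"] show ?thesis by auto
qed

text \<open>Successive approximation in the weight with the top coefficient fixed from the start:
  modulo \<open>V\<close> the images become divisible by ever higher powers, until the primary
  condition absorbs them.\<close>

lemma operator_exists:
  assumes prim: "primary l V" and G: "finite (- vanishing_orders l V)"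
  shows "\<exists>f. f i = [:- l, 1:] ^ (sgap (- vanishing_orders l V) i + i) \<and>
    (\<forall>m. dop i f ([:- l, 1:] ^ m) \<in> V)"
proof -
  let ?L = "[:- l, 1:]" and ?G = "- vanishing_orders l V"
  define s where "s = sgap ?G i"
  have sub: "cpoly.subspace V" using prim by (simp add: primary_def)
  obtain N where N: "\<And>p. ?L ^ N * p \<in> V" using prim by (auto simp: primary_def)
  have "\<exists>f. f i = ?L ^ (s + i) \<and> (\<forall>m. \<exists>v\<in>V. ?L ^ (m + s + T) dvd dop i f (?L ^ m) - v)" for T
  proof (induction T)
    case 0
    define f where "f j = (if j = i then ?L ^ (s + i) else 0)" for j
    have "?L ^ (m + s) dvd dop i f (?L ^ m)" for m
    proof -
      have "dop i f (?L ^ m) = (\<Sum>j\<le>i. if j = i then ?L ^ (s + i) * (pderiv ^^ i) (?L ^ m) else 0)"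
        by (rule sum.cong) (auto simp: f_def simp del: funpow.simps)
      also have "\<dots> = ?L ^ (s + i) * (pderiv ^^ i) (?L ^ m)" by simp
      also have "\<dots> = smult (of_nat (ffl m i)) (?L ^ (s + i + (m - i)))"
        by (simp only: pderivs_linear_power mult_smult_right power_add)
      also have "?L ^ (m + s) dvd \<dots>"
      proof (cases "i \<le> m")
        case True
        then have "s + i + (m - i) = m + s" by simp
        then show ?thesis by (simp only:) (rule dvd_smult, rule dvd_refl)
      qed (simp add: ffl_eq_0)
      finally show ?thesis .
    qed
    moreover have "0 \<in> V" by (rule cpoly.subspace_0[OF sub])
    ultimately show ?case by (intro exI[of _ f]) (auto simp: f_def intro!: bexI[of _ 0])
  next
    case (Suc T)
    then obtain f where fi: "f i = ?L ^ (s + i)" and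
      f: "\<And>m. \<exists>v\<in>V. ?L ^ (m + s + T) dvd dop i f (?L ^ m) - v" by blast
    have "\<forall>m. \<exists>vh. fst vh \<in> V \<and> dop i f (?L ^ m) - fst vh = ?L ^ (m + s + T) * snd vh"
    proof
      fix m
      obtain v where v: "v \<in> V" "?L ^ (m + s + T) dvd dop i f (?L ^ m) - v"
        using f[of m] by (rule bexE)
      from v(2) obtain k where k: "dop i f (?L ^ m) - v = ?L ^ (m + s + T) * k"
        by (rule dvdE)
      show "\<exists>vh. fst vh \<in> V \<and> dop i f (?L ^ m) - fst vh = ?L ^ (m + s + T) * snd vh"
        by (rule exI[of _ "(v, k)"]) (simp only: fst_conv snd_conv v(1) k simp_thms)
    qed
    from choice[OF this] obtain vh where vh: "\<And>m. fst (vh m) \<in> V"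
      "\<And>m. dop i f (?L ^ m) - fst (vh m) = ?L ^ (m + s + T) * snd (vh m)" by blast
    \<comment> \<open>For these m no element of \<open>V\<close> has the order of the next term.
      Since they correspond to gaps of size at least \<open>s\<close>, there are at most
      \<open>i\<close> of them, and free terms of order below \<open>i\<close> adjust the next
      coefficient by a prescribed polynomial in m of degree below \<open>i\<close>.\<close>
    define B where "B = {m. m + s + T \<in> ?G}"
    have inj: "inj_on (\<lambda>m. m + s + T) B" by (auto simp: inj_on_def)
    have im: "(\<lambda>m. m + s + T) ` B \<subseteq> {x\<in>?G. s \<le> x}" by (auto simp: B_def)
    have fin: "finite {x\<in>?G. s \<le> x}" by (rule finite_subset[OF _ G]) auto
    have B: "finite B" using finite_imageD[OF finite_subset[OF im fin] inj] .
    have "card B = card ((\<lambda>m. m + s + T) ` B)" using inj by (simp add: card_image)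
    also have "\<dots> \<le> card {x\<in>?G. s \<le> x}" using card_mono[OF fin im] .
    also have "\<dots> \<le> i" unfolding s_def by (rule sgap_card[OF G])
    finally have "card B \<le> i" .
    from ffl_interpolation[OF B this, of "\<lambda>m. - poly (snd (vh m)) l"]
    obtain c where c: "\<forall>m\<in>B. (\<Sum>j<i. c j * of_nat (ffl m j)) = - poly (snd (vh m)) l" ..
    define q where "q m = (\<Sum>j<i. c j * of_nat (ffl m j))" for m
    define f' where "f' j = f j + (if j < i then smult (c j) (?L ^ (s + T + j)) else 0)" for j
    have ap: "dop i f' (?L ^ m) - fst (vh m) = ?L ^ (m + s + T) * (snd (vh m) + [:q m:])" for m
    proof -
      have "(\<Sum>j\<le>i. (if j < i then smult (c j) (?L ^ (s + T + j)) else 0) * (pderiv ^^ j) (?L ^ m))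
        = (\<Sum>j<i. smult (c j) (?L ^ (s + T + j)) * (pderiv ^^ j) (?L ^ m))"
        by (rule sum.mono_neutral_cong_right) auto
      also have "\<dots> = (\<Sum>j<i. smult (c j * of_nat (ffl m j)) (?L ^ (m + s + T)))"
      proof (rule sum.cong[OF refl])
        fix j
        show "smult (c j) (?L ^ (s + T + j)) * (pderiv ^^ j) (?L ^ m) = smult (c j * of_nat (ffl m j)) (?L ^ (m + s + T))"
        proof (cases "j \<le> m")
          case True
          then have "s + T + j + (m - j) = m + s + T" by simp
          then have "?L ^ (s + T + j) * ?L ^ (m - j) = ?L ^ (m + s + T)" by (simp only: power_add[symmetric])
          then show ?thesis by (simp only: pderivs_linear_power mult_smult_left mult_smult_right smult_smult) (simp add: mult.commute)
        next
          case False
          then show ?thesis by (simp add: pderivs_linear_power ffl_eq_0)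
        qed
      qed
      also have "\<dots> = ?L ^ (m + s + T) * [:q m:]" by (simp add: q_def smult_sum)
      finally have 1: "(\<Sum>j\<le>i. (if j < i then smult (c j) (?L ^ (s + T + j)) else 0) * (pderiv ^^ j) (?L ^ m)) = ?L ^ (m + s + T) * [:q m:]" .
      have "dop i f' (?L ^ m) = dop i f (?L ^ m) + ?L ^ (m + s + T) * [:q m:]"
        unfolding 1[symmetric] f'_def by (simp only: distrib_right sum.distrib)
      then have "dop i f' (?L ^ m) - fst (vh m) = (dop i f (?L ^ m) - fst (vh m)) + ?L ^ (m + s + T) * [:q m:]"
        by (simp only: diff_conv_add_uminus ac_simps)
      then show ?thesis unfolding vh(2) by (simp only: distrib_left)
    qed
    have "\<exists>v\<in>V. ?L ^ (m + s + Suc T) dvd dop i f' (?L ^ m) - v" for m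
    proof (cases "m \<in> B")
      case True
      then have "poly (snd (vh m) + [:q m:]) l = 0" using c by (simp add: q_def)
      then have "?L dvd snd (vh m) + [:q m:]" by (simp only: poly_eq_0_iff_dvd)
      then have "?L ^ (m + s + T) * ?L dvd ?L ^ (m + s + T) * (snd (vh m) + [:q m:])" by (rule mult_dvd_mono[OF dvd_refl])
      then show ?thesis unfolding ap[symmetric] using vh(1)[of m] by (intro bexI[of _ "fst (vh m)"]) (simp_all only: power_Suc2 add_Suc_right)
    next
      case False
      \<comment> \<open>Otherwise an element of \<open>V\<close> of exactly this order cancels the
        next coefficient.\<close>
      then have "m + s + T \<in> vanishing_orders l V" by (simp add: B_def)
      then obtain v where v: "v \<in> V" "v \<noteq> 0" "order l v = m + s + T" by (auto simp: vanishing_orders_def)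
      obtain k where k: "v = ?L ^ (m + s + T) * k" "\<not> ?L dvd k" using order_decomp[OF v(2), of l] v(3) by auto
      then have kl: "poly k l \<noteq> 0" by (simp add: poly_eq_0_iff_dvd)
      define x where "x = poly (snd (vh m) + [:q m:]) l / poly k l"
      have "poly (snd (vh m) + [:q m:] - smult x k) l = 0" using kl by (simp add: x_def)
      then have "?L dvd snd (vh m) + [:q m:] - smult x k" by (simp only: poly_eq_0_iff_dvd)
      then have "?L ^ (m + s + T) * ?L dvd ?L ^ (m + s + T) * (snd (vh m) + [:q m:] - smult x k)" by (rule mult_dvd_mono[OF dvd_refl])
      also have "?L ^ (m + s + T) * (snd (vh m) + [:q m:] - smult x k) = ?L ^ (m + s + T) * (snd (vh m) + [:q m:]) - smult x v"
        by (simp only: k(1) right_diff_distrib mult_smult_right)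
      also have "\<dots> = dop i f' (?L ^ m) - (fst (vh m) + smult x v)"
        by (simp only: ap[symmetric] diff_diff_eq)
      finally have "?L ^ (m + s + Suc T) dvd dop i f' (?L ^ m) - (fst (vh m) + smult x v)"
        by (simp only: power_Suc2 add_Suc_right)
      moreover have "fst (vh m) + smult x v \<in> V"
        using vh(1) v(1) cpoly.subspace_add[OF sub] cpoly.subspace_scale[OF sub] by blast
      ultimately show ?thesis by blast
    qed
    moreover have "f' i = ?L ^ (s + i)" by (simp add: f'_def fi)
    ultimately show ?case by blast
  qed
  from this[of N] obtain f where fi: "f i = ?L ^ (s + i)" and
      f: "\<And>m. \<exists>v\<in>V. ?L ^ (m + s + N) dvd dop i f (?L ^ m) - v" by blast
  have "dop i f (?L ^ m) \<in> V" for m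
  proof -
    obtain v k where v: "v \<in> V" "dop i f (?L ^ m) - v = ?L ^ (m + s + N) * k"
      using f[of m] unfolding dvd_def by (elim bexE exE)
    have "dop i f (?L ^ m) = v + ?L ^ N * (?L ^ (m + s) * k)"
      using v(2) by (simp only: power_add ac_simps diff_eq_eq)
    then show ?thesis using cpoly.subspace_add[OF sub v(1) N] by simp
  qed
  then show ?thesis using fi unfolding s_def by blast
qed

lemma primary_gaps:
  assumes "primary l V" shows "finite (- vanishing_orders l V)"
proof -
  obtain N where N: "\<And>p. [:- l, 1:] ^ N * p \<in> V" using assms by (auto simp: primary_def)
  have "r \<in> vanishing_orders l V" if "r \<ge> N" for r
  proof -
    have "[:- l, 1:] ^ N * [:- l, 1:] ^ (r - N) = [:- l, 1:] ^ r" using that by (simp only: power_add[symmetric]) simp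
    then have "[:- l, 1:] ^ r \<in> V" using N by metis
    moreover have "[:- l, 1:] ^ r \<noteq> 0" by (rule power_not_zero) simp
    ultimately show ?thesis unfolding vanishing_orders_def using order_power_n_n[of l r] by blast
  qed
  then have "- vanishing_orders l V \<subseteq> {..<N}" by (auto simp: not_less[symmetric])
  then show ?thesis by (rule finite_subset) simp
qed

lemma act_pD_power: "P \<in> weyl \<Longrightarrow> act (P * pD ^ k) f = act P (rderivs k f)"
proof (induction k arbitrary: f)
  case (Suc k)
  have "pcoeff (P * pD ^ k) (- 1) = 0" using Suc.prems by (simp add: weyl_iff)
  then have "act (P * pD ^ k * pD) f = act (P * pD ^ k) (rderiv f)" by (rule act_pD)
  then show ?case using Suc by (simp add: power_Suc2 mult.assoc funpow_Suc_right del: power_Suc funpow.simps)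
qed simp

text \<open>Up to the number of gaps this is the interpolation construction; beyond it, powers of
  \<partial> on the right keep the top coefficient while \<open>lorder\<close> is constant.\<close>

lemma local_operator:
  assumes prim: "primary l V"
  shows "\<exists>Q\<in>weyl. ordle Q (int i) \<and> pcoeff Q (int i) = to_fract ([:- l, 1:] ^ lorder (- vanishing_orders l V) i)
    \<and> (\<forall>p. act Q (to_fract p) \<in> to_fract ` V)"
proof -
  let ?G = "- vanishing_orders l V"
  note G = primary_gaps[OF prim]
  have sub: "cpoly.subspace V" using prim by (simp add: primary_def)
  have low: "\<exists>Q\<in>weyl. ordle Q (int i) \<and> pcoeff Q (int i) = to_fract ([:- l, 1:] ^ lorder ?G i)
    \<and> (\<forall>p. act Q (to_fract p) \<in> to_fract ` V)" if i: "i \<le> card ?G" for i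
  proof -
    obtain f where fi: "f i = [:- l, 1:] ^ (sgap ?G i + i)" and f: "\<And>m. dop i f ([:- l, 1:] ^ m) \<in> V"
      using operator_exists[OF prim G, of i] by blast
    define Q where "Q = wop (Suc i) f"
    have Q: "Q \<in> weyl" by (simp add: Q_def weyl_wop)
    have o: "ordle Q (int i)" by (simp add: Q_def ordle_def pcoeff_wop)
    have "pcoeff Q (int i) = to_fract ([:- l, 1:] ^ lorder ?G i)"
      using i by (simp add: Q_def pcoeff_wop fi lorder_def min_absorb1)
    moreover have "act Q (to_fract p) \<in> to_fract ` V" for p
    proof -
      have pa: "(pderiv ^^ j) (p + q) = (pderiv ^^ j) p + (pderiv ^^ j) q" for j and p q :: "complex poly"
        by (induction j) (simp_all add: pderiv_add)
      have ps: "(pderiv ^^ j) (smult c p) = smult c ((pderiv ^^ j) p)" for j c and p :: "complex poly"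
        by (induction j) (simp_all add: pderiv_smult)
      define T where "T = {p. dop i f p \<in> V}"
      have "p \<in> T"
      proof (rule poly_span_powers[where l = l])
        have "(pderiv ^^ j) (0 :: complex poly) = 0" for j by (induction j) simp_all
        then show "0 \<in> T" using cpoly.subspace_0[OF sub] by (simp add: T_def)
        show "p + q \<in> T" if "p \<in> T" "q \<in> T" for p q
          using cpoly.subspace_add[OF sub] that by (simp add: T_def pa distrib_left sum.distrib)
        show "smult c p \<in> T" if "p \<in> T" for c p
        proof -
          have "(\<Sum>j\<le>i. f j * (pderiv ^^ j) (smult c p)) = smult c (dop i f p)"
            by (simp only: ps mult_smult_right smult_sum2)
          then show ?thesis using cpoly.subspace_scale[OF sub] that by (simp add: T_def)
        qed
        show "[:- l, 1:] ^ m \<in> T" for m using f by (simp only: T_def mem_Collect_eq)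
      qed
      moreover have "act Q (to_fract p) = to_fract (dop i f p)"
        unfolding act_weyl[OF Q o] by (simp add: Q_def wcoeff_wop)
      ultimately show ?thesis by (simp only: T_def mem_Collect_eq imageI)
    qed
    ultimately show ?thesis using Q o by blast
  qed
  show ?thesis
  proof (cases "i \<le> card ?G")
    case True
    then show ?thesis by (rule low)
  next
    case False
    let ?g = "card ?G"
    obtain Q where Q: "Q \<in> weyl" "ordle Q (int ?g)" "pcoeff Q (int ?g) = to_fract ([:- l, 1:] ^ lorder ?G ?g)"
      "\<And>p. act Q (to_fract p) \<in> to_fract ` V" using low[of ?g] by blast
    let ?P = "Q * pD ^ (i - ?g)"
    have "?P \<in> weyl" using Q(1) by (intro weyl_intros)
    moreover have "ordle ?P (int i)" using Q(2) False by (auto simp: ordle_def)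
    moreover have "lorder ?G ?g = lorder ?G i" using False sgap_0[OF G] by (simp add: lorder_def)
    then have "pcoeff ?P (int i) = to_fract ([:- l, 1:] ^ lorder ?G i)" using Q(3) False by simp
    moreover have "act ?P (to_fract p) \<in> to_fract ` V" for p
      unfolding act_pD_power[OF Q(1)] rderivs_to_fract by (rule Q(4))
    ultimately show ?thesis by blast
  qed
qed

section \<open>Passing from one point to all points\<close>

definition stabilizer :: "(complex \<Rightarrow> complex poly set) \<Rightarrow> pdo set"
  where "stabilizer V = {Q \<in> weyl. \<forall>p. act Q (to_fract p) \<in> to_fract ` (\<Inter>l. V l)}"

lemma stabilizer_lead_divisible:
  assumes V: "\<And>l. primary l (V l)" and f: "to_fract f \<in> lead (stabilizer V) (int i)"
  shows "[:- l, 1:] ^ lorder (- vanishing_orders l (V l)) i dvd f"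
proof -
  obtain Q where Q: "Q \<in> weyl" "ordle Q (int i)" "to_fract f = pcoeff Q (int i)"
    "\<And>p. act Q (to_fract p) \<in> to_fract ` (\<Inter>l. V l)" using f by (auto simp: lead_def stabilizer_def)
  have "[:- l, 1:] ^ lorder (- vanishing_orders l (V l)) i dvd wcoeff Q i"
  proof (rule leading_divisible)
    fix m
    have "to_fract (dop i (wcoeff Q) ([:- l, 1:] ^ m)) \<in> to_fract ` (\<Inter>l. V l)"
      using Q(4) act_weyl[OF Q(1,2)] by metis
    then have "dop i (wcoeff Q) ([:- l, 1:] ^ m) \<in> (\<Inter>l. V l)"
      by (simp only: inj_image_mem_iff[OF inj_to_fract])
    then show "dop i (wcoeff Q) ([:- l, 1:] ^ m) \<in> V l" by blast
  qed (rule primary_gaps[OF V])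
  moreover have "wcoeff Q i = f" using Q(3) by (intro wcoeff_eqI) simp
  ultimately show ?thesis by simp
qed

text \<open>The inverse is improved one power at a time: a multiple of the current power cancels the
  value of the error at \<open>l\<close>.\<close>

lemma inverse_mod_linear_power:
  fixes c :: "complex poly"
  assumes "poly c l \<noteq> 0"
  shows "\<exists>x y. 1 - x * c = [:- l, 1:] ^ k * y"
proof (induction k)
  case 0
  then show ?case by (intro exI[of _ 0] exI[of _ 1]) simp
next
  case (Suc k)
  then obtain x y where xy: "1 - x * c = [:- l, 1:] ^ k * y" by blast
  define a where "a = poly y l / poly c l"
  have "poly (y - smult a c) l = 0" using assms by (simp add: a_def)
  then obtain z where z: "y - smult a c = [:- l, 1:] * z" unfolding poly_eq_0_iff_dvd by (rule dvdE)
  have "1 - (x + smult a ([:- l, 1:] ^ k)) * c = [:- l, 1:] ^ k * (y - smult a c)"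
    using xy by (simp only: distrib_right right_diff_distrib mult_smult_left mult_smult_right diff_diff_eq[symmetric])
  also have "\<dots> = [:- l, 1:] ^ Suc k * z" unfolding z by (simp only: power_Suc2 mult.assoc)
  finally show ?case by blast
qed

text \<open>The local operator is multiplied by a polynomial that is 1 modulo a high power at
  \<open>l\<close> and divisible by high powers at the other exceptional points; the order at
  \<open>l\<close> is unaffected.\<close>

lemma stabilizer_lead_exists:
  assumes V: "\<And>l. primary l (V l)" and fin: "finite {l. V l \<noteq> UNIV}"
  shows "\<exists>f. to_fract f \<in> lead (stabilizer V) (int i) \<and> f \<noteq> 0 \<and> order l f = lorder (- vanishing_orders l (V l)) i"
proof -
  let ?e = "lorder (- vanishing_orders l (V l)) i"
  obtain Q where Q: "Q \<in> weyl" "ordle Q (int i)" "pcoeff Q (int i) = to_fract ([:- l, 1:] ^ ?e)"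
    "\<And>p. act Q (to_fract p) \<in> to_fract ` V l" using local_operator[OF V[of l], of i] by blast
  have "\<forall>l. \<exists>N. \<forall>p. [:- l, 1:] ^ N * p \<in> V l" using V by (simp add: primary_def)
  from choice[OF this] obtain N where N: "\<And>l p. [:- l, 1:] ^ N l * p \<in> V l" by blast
  let ?A = "{l. V l \<noteq> UNIV} - {l}"
  define c0 where "c0 = (\<Prod>a\<in>?A. [:- a, 1:] ^ N a)"
  have "poly c0 l \<noteq> 0" unfolding c0_def using fin by (auto simp: poly_prod)
  \<comment> \<open>The exponent \<open>Suc (N l)\<close> makes the right side vanish at
    \<open>l\<close> even for \<open>N l = 0\<close>, so that \<open>c\<close> has value 1
    there.\<close>
  then obtain x y where xy: "1 - x * c0 = [:- l, 1:] ^ Suc (N l) * y"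
    using inverse_mod_linear_power by blast
  define c where "c = x * c0"
  have cl: "poly c l = 1" using arg_cong[OF xy, of "\<lambda>p. poly p l"] by (simp add: c_def)
  define P where "P = pfun (to_fract c) * Q"
  have Pw: "P \<in> weyl" using Q(1) by (simp add: P_def weyl_mult weyl_pfun)
  have "act P (to_fract p) \<in> to_fract ` (\<Inter>l. V l)" for p
  proof -
    obtain u where u: "u \<in> V l" "act Q (to_fract p) = to_fract u" using Q(4) by blast
    have "c * u \<in> V a" for a
    proof (cases "a = l")
      case True
      have "cpoly.subspace (V l)" using V by (simp add: primary_def)
      moreover have "c * u = u - [:- l, 1:] ^ N l * ([:- l, 1:] * y * u)"
      proof -
        have "c = 1 - [:- l, 1:] ^ Suc (N l) * y" unfolding xy[symmetric] by (simp add: c_def)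
        then have "c * u = u - [:- l, 1:] ^ Suc (N l) * y * u" by (simp only: left_diff_distrib mult_1_left)
        then show ?thesis by (simp only: power_Suc ac_simps)
      qed
      ultimately show ?thesis using True cpoly.subspace_diff u(1) N by metis
    next
      case a: False
      show ?thesis
      proof (cases "V a = UNIV")
        case False
        then have "c0 = [:- a, 1:] ^ N a * (\<Prod>b\<in>?A - {a}. [:- b, 1:] ^ N b)"
          unfolding c0_def using fin a by (intro prod.remove) auto
        then have "c * u = [:- a, 1:] ^ N a * ((\<Prod>b\<in>?A - {a}. [:- b, 1:] ^ N b) * x * u)"
          by (simp only: c_def ac_simps)
        then show ?thesis using N by (simp only:)
      qed simp
    qed
    moreover have "act P (to_fract p) = to_fract (c * u)" by (simp add: P_def act_pfun u)
    ultimately show ?thesis by blast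
  qed
  then have "P \<in> stabilizer V" using Pw by (simp add: stabilizer_def)
  moreover have "ordle P (int i)" using Q(2) by (simp add: P_def ordle_def)
  ultimately have "pcoeff P (int i) \<in> lead (stabilizer V) (int i)" by (rule leadI)
  moreover have "pcoeff P (int i) = to_fract (c * [:- l, 1:] ^ ?e)" by (simp add: P_def Q(3))
  moreover have nz: "c * [:- l, 1:] ^ ?e \<noteq> 0"
  proof -
    have "c \<noteq> 0" using cl by auto
    moreover have "[:- l, 1:] ^ ?e \<noteq> 0" by (rule power_not_zero) simp
    ultimately show ?thesis by (rule no_zero_divisors)
  qed
  moreover have "order l (c * [:- l, 1:] ^ ?e) = ?e"
    unfolding order_mult[OF nz] order_power_n_n using cl by (simp add: order_0I)
  ultimately show ?thesis by metis
qed

lemma to_fract_power: "to_fract (p ^ k) = to_fract p ^ k"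
  by (induction k) simp_all

text \<open>Clearing the denominator is left multiplication by \<open>d\<close>; the result maps
  polynomials to polynomials, so \<open>weyl_if_act\<close> puts it into the Weyl algebra.\<close>

lemma alpha_ideal_eq:
  fixes V :: "complex \<Rightarrow> complex poly set"
  assumes fin: "finite {l. V l \<noteq> UNIV}"
  defines "d \<equiv> (\<Prod>l | V l \<noteq> UNIV. to_fract [:- l, 1:] ^ codim (V l))"
  shows "d \<noteq> 0 \<and> {P \<in> diffops. \<forall>p. act P (to_fract p) \<in> adelic_point V} = (\<lambda>Q. pfun (inverse d) * Q) ` stabilizer V"
proof -
  have d: "d \<noteq> 0" unfolding d_def using fin by simp
  have dd: "d \<in> range to_fract" unfolding d_def
  proof -
    have "(\<Prod>l\<in>A. to_fract [:- l, 1:] ^ codim (V l)) = to_fract (\<Prod>l\<in>A. [:- l, 1:] ^ codim (V l))" for A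
      by (induction A rule: infinite_finite_induct) (simp_all add: to_fract_power)
    then show "(\<Prod>l | V l \<noteq> UNIV. to_fract [:- l, 1:] ^ codim (V l)) \<in> range to_fract" by simp
  qed
  have ap: "adelic_point V = (\<lambda>f. inverse d * f) ` (to_fract ` (\<Inter>l. V l))"
    unfolding adelic_point_def d_def image_image ..
  have "{P \<in> diffops. \<forall>p. act P (to_fract p) \<in> adelic_point V} = (\<lambda>Q. pfun (inverse d) * Q) ` stabilizer V"
  proof safe
    fix P assume P: "P \<in> diffops" "\<forall>p. act P (to_fract p) \<in> adelic_point V"
    define Q where "Q = pfun d * P"
    have Pq: "P = pfun (inverse d) * Q" using d by (simp add: Q_def mult.assoc[symmetric] pfun_mult[symmetric])
    have av: "act Q (to_fract p) \<in> to_fract ` (\<Inter>l. V l)" for p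
    proof -
      obtain f where f: "f \<in> to_fract ` (\<Inter>l. V l)" "act P (to_fract p) = inverse d * f" using P(2) unfolding ap by blast
      have "act Q (to_fract p) = d * inverse d * f" by (simp add: Q_def act_pfun f(2) mult.assoc)
      then show ?thesis using d f(1) by simp
    qed
    have "Q \<in> diffops" using P(1) by (simp add: Q_def diffops_def)
    moreover have "act Q (to_fract p) \<in> range to_fract" for p using av[of p] by blast
    ultimately have "Q \<in> weyl" by (rule weyl_if_act)
    then have "Q \<in> stabilizer V" using av by (simp add: stabilizer_def)
    then show "P \<in> (\<lambda>Q. pfun (inverse d) * Q) ` stabilizer V" using Pq by blast
  next
    fix Q assume Q: "Q \<in> stabilizer V"
    then show "pfun (inverse d) * Q \<in> diffops" by (simp add: stabilizer_def weyl_iff diffops_def)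
    show "act (pfun (inverse d) * Q) (to_fract p) \<in> adelic_point V" for p
      unfolding act_pfun ap using Q unfolding stabilizer_def by blast
  qed
  with d show ?thesis by blast
qed

section \<open>Gap combinatorics\<close>

lemma enumerate_count:
  fixes R :: "nat set"
  assumes "infinite R"
  shows "card {r\<in>R. r < enumerate R i} = i"
proof -
  have "{r\<in>R. r < enumerate R i} = enumerate R ` {..<i}"
  proof safe
    fix r assume "r \<in> R" "r < enumerate R i"
    then obtain j where "r = enumerate R j" using enumerate_Ex[OF assms \<open>r \<in> R\<close>] by metis
    then show "r \<in> enumerate R ` {..<i}" using \<open>r < enumerate R i\<close> assms by (simp add: enumerate_mono_iff)
  qed (use assms in \<open>auto simp: enumerate_in_set enumerate_mono\<close>)
  moreover have "inj_on (enumerate R) {..<i}"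
    using strict_mono_enumerate[OF assms] strict_mono_imp_inj_on by blast
  ultimately show ?thesis by (simp add: card_image)
qed

lemma card_below:
  fixes R :: "nat set"
  shows "card {r\<in>R. r < x} + card {y\<in>- R. y < x} = x"
proof -
  have "card ({r\<in>R. r < x} \<union> {y\<in>- R. y < x}) = card {r\<in>R. r < x} + card {y\<in>- R. y < x}"
    by (rule card_Un_disjoint) auto
  moreover have "{r\<in>R. r < x} \<union> {y\<in>- R. y < x} = {..<x}" by auto
  ultimately show ?thesis by simp
qed

lemma card_eq_sum_if:
  "finite A \<Longrightarrow> card {x\<in>A. P x} = (\<Sum>x\<in>A. if P x then 1 else 0)"
  by (simp add: sum.If_cases Int_def)

lemma cofinite_infinite: "finite (- R) \<Longrightarrow> infinite (R :: nat set)"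
  using finite_UnI[of "- R" R] by auto

text \<open>\<open>r_i\<close> is i plus the number of gaps below it, and every gap lies below or
  above; so \<open>g + i - r_i\<close> counts the gaps above \<open>r_i\<close>.\<close>

lemma enumerate_gap_count:
  fixes R :: "nat set"
  assumes G: "finite (- R)"
  shows "enumerate R i + card {y\<in>- R. enumerate R i < y} = card (- R) + i"
proof -
  let ?r = "enumerate R i"
  note inf = cofinite_infinite[OF G]
  have "?r \<in> R" using inf by (rule enumerate_in_set)
  then have "- R = {y\<in>- R. y < ?r} \<union> {y\<in>- R. ?r < y}" by auto (metis linorder_neqE_nat)
  then have "card (- R) = card ({y\<in>- R. y < ?r} \<union> {y\<in>- R. ?r < y})" by (rule arg_cong)
  also have "\<dots> = card {y\<in>- R. y < ?r} + card {y\<in>- R. ?r < y}"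
    by (rule card_Un_disjoint) (use G in \<open>auto intro: finite_subset[OF _ G]\<close>)
  finally show ?thesis using card_below[of R ?r] enumerate_count[OF inf, of i] by simp
qed

lemma sum_card_below:
  fixes G :: "nat set"
  assumes "finite G"
  shows "(\<Sum>x\<in>G. card {y\<in>G. y < x}) = (\<Sum>i<card G. i)"
  using assms
proof (induction G rule: finite_linorder_max_induct)
  case (insert b A)
  have b: "b \<notin> A" using insert by auto
  have "{y \<in> insert b A. y < b} = A" using insert by auto
  moreover have "{y \<in> insert b A. y < x} = {y \<in> A. y < x}" if "x \<in> A" for x using insert that by force
  ultimately show ?case using insert b by simp
qed simp

text \<open>Conjugate partitions: \<open>s < sgap G i\<close> holds exactly when more than
  \<open>i\<close> gaps are at least \<open>s\<close>. Summing over \<open>i\<close> first leaves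
  the pairs of a gap x and an s <= x, and each x has x + 1 of them.\<close>

lemma sum_sgap:
  assumes G: "finite G"
  shows "(\<Sum>i<card G. sgap G i) = (\<Sum>x\<in>G. Suc x)"
proof -
  define b where "b = Suc (Max (insert 0 G))"
  have b: "x < b" if "x \<in> G" for x using G that by (simp add: b_def less_Suc_eq_le)
  have iff: "s < sgap G i \<longleftrightarrow> i < card {x\<in>G. s \<le> x}" for s i
  proof
    assume *: "i < card {x\<in>G. s \<le> x}"
    show "s < sgap G i"
    proof (rule ccontr)
      assume "\<not> s < sgap G i"
      then have "card {x\<in>G. s \<le> x} \<le> card {x\<in>G. sgap G i \<le> x}" using G by (intro card_mono) auto
      then show False using sgap_card[OF G, of i] * by simp
    qed
  qed (rule sgap_less)
  have sb: "s < b" if "s < sgap G i" for s i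
  proof (rule ccontr)
    assume "\<not> s < b"
    then have e: "{x\<in>G. s \<le> x} = {}" using b by force
    show False using that unfolding iff e by simp
  qed
  have "(\<Sum>i<card G. sgap G i) = (\<Sum>i<card G. \<Sum>s<b. if i < card {x\<in>G. s \<le> x} then 1 else 0)"
  proof (rule sum.cong[OF refl])
    fix i
    have "{s\<in>{..<b}. i < card {x\<in>G. s \<le> x}} = {..<sgap G i}" using sb iff by auto
    then have "sgap G i = card {s\<in>{..<b}. i < card {x\<in>G. s \<le> x}}" by simp
    then show "sgap G i = (\<Sum>s<b. if i < card {x\<in>G. s \<le> x} then 1 else 0)"
      using card_eq_sum_if[of "{..<b}" "\<lambda>s. i < card {x\<in>G. s \<le> x}"] by simp
  qed
  also have "\<dots> = (\<Sum>s<b. \<Sum>i<card G. if i < card {x\<in>G. s \<le> x} then 1 else 0)" by (rule sum.swap)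
  also have "\<dots> = (\<Sum>s<b. card {x\<in>G. s \<le> x})"
  proof (rule sum.cong[OF refl])
    fix s
    have "card {x\<in>G. s \<le> x} \<le> card G" using G by (intro card_mono) auto
    then have "{i\<in>{..<card G}. i < card {x\<in>G. s \<le> x}} = {..<card {x\<in>G. s \<le> x}}" by auto
    then show "(\<Sum>i<card G. if i < card {x\<in>G. s \<le> x} then 1 else 0) = card {x\<in>G. s \<le> x}"
      using card_eq_sum_if[of "{..<card G}" "\<lambda>i. i < card {x\<in>G. s \<le> x}"] by simp
  qed
  also have "\<dots> = (\<Sum>s<b. \<Sum>x\<in>G. if s \<le> x then 1 else 0)" using card_eq_sum_if[OF G] by simp
  also have "\<dots> = (\<Sum>x\<in>G. \<Sum>s<b. if s \<le> x then 1 else 0)" by (rule sum.swap)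
  also have "\<dots> = (\<Sum>x\<in>G. Suc x)"
  proof (rule sum.cong[OF refl])
    fix x assume "x \<in> G"
    then have "{s\<in>{..<b}. s \<le> x} = {..x}" using b by force
    then show "(\<Sum>s<b. if s \<le> x then 1 else 0) = Suc x" using card_eq_sum_if[of "{..<b}" "\<lambda>s. s \<le> x"] by simp
  qed
  finally show ?thesis .
qed

text \<open>Both sides equal the sum of the gaps minus g(g - 1)/2. On the left, pairs of a vanishing
  order below a gap are counted by the gap; on the right \<open>sum_sgap\<close> applies, and terms
  from g on vanish.\<close>

lemma local_index_eq_lorder:
  assumes G: "finite (- vanishing_orders l V)" and N: "num_gaps l V \<le> N"
  shows "local_index l V = (\<Sum>i<N. int (lorder (- vanishing_orders l V) i) - int (num_gaps l V))"
proof -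
  define R where "R = vanishing_orders l V"
  define g where "g = card (- R)"
  note G' = G[folded R_def]
  note inf = cofinite_infinite[OF G']
  define k where "k i = card {y\<in>- R. enumerate R i < y}" for i
  have k: "int g + int i - int (enumerate R i) = int (k i)" for i
    using enumerate_gap_count[OF G', of i] by (simp add: k_def g_def)
  define b where "b = Suc (Max (insert 0 (- R)))"
  have b: "x < b" if "x \<in> - R" for x using G' that by (simp add: b_def less_Suc_eq_le)
  have kb: "k i = 0" if "i \<ge> b" for i
  proof -
    have "i \<le> enumerate R i" using inf by (rule le_enumerate)
    then have e: "{y\<in>- R. enumerate R i < y} = {}" using b that by force
    show ?thesis unfolding k_def e by simp
  qed
  have ge: "enumerate R i \<noteq> g + i \<longleftrightarrow> k i \<noteq> 0" for i
    using k[of i] by auto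
  have "local_index l V = (\<Sum>i | k i \<noteq> 0. int (k i))"
    unfolding local_index_def vanishing_seq_def num_gaps_def R_def[symmetric] g_def[symmetric] ge k ..
  also have "\<dots> = (\<Sum>i<b. int (k i))"
  proof (rule sum.mono_neutral_left)
    show "{i. k i \<noteq> 0} \<subseteq> {..<b}"
    proof
      fix i assume "i \<in> {i. k i \<noteq> 0}"
      then show "i \<in> {..<b}" using kb[of i] by (cases "i < b") auto
    qed
  qed auto
  also have "\<dots> = int (\<Sum>i<b. k i)" by simp
  also have "(\<Sum>i<b. k i) = (\<Sum>x\<in>- R. card {r\<in>R. r < x})"
  proof -
    have "(\<Sum>i<b. k i) = (\<Sum>i<b. \<Sum>x\<in>- R. if enumerate R i < x then 1 else 0)"
      by (simp only: k_def card_eq_sum_if[OF G'])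
    also have "\<dots> = (\<Sum>x\<in>- R. \<Sum>i<b. if enumerate R i < x then 1 else 0)" by (rule sum.swap)
    also have "\<dots> = (\<Sum>x\<in>- R. card {r\<in>R. r < x})"
    proof (rule sum.cong[OF refl])
      fix x assume x: "x \<in> - R"
      have "bij_betw (enumerate R) {i\<in>{..<b}. enumerate R i < x} {r\<in>R. r < x}"
        unfolding bij_betw_def
      proof
        show "inj_on (enumerate R) {i\<in>{..<b}. enumerate R i < x}"
          using strict_mono_enumerate[OF inf] strict_mono_imp_inj_on inj_on_subset by blast
        show "enumerate R ` {i\<in>{..<b}. enumerate R i < x} = {r\<in>R. r < x}"
        proof safe
          fix r assume r: "r \<in> R" "r < x"
          then obtain j where j: "r = enumerate R j" using enumerate_Ex[OF inf r(1)] by metis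
          have "j \<le> r" using j le_enumerate[OF inf] by simp
          then have "j < b" using r b[OF x] by simp
          then show "r \<in> enumerate R ` {i\<in>{..<b}. enumerate R i < x}" using j r by blast
        qed (rule enumerate_in_set[OF inf])
      qed
      from bij_betw_same_card[OF this]
      show "(\<Sum>i<b. if enumerate R i < x then 1 else 0) = card {r\<in>R. r < x}"
        using card_eq_sum_if[of "{..<b}" "\<lambda>i. enumerate R i < x"] by simp
    qed
    finally show ?thesis .
  qed
  also have "int (\<Sum>x\<in>- R. card {r\<in>R. r < x}) = (\<Sum>x\<in>- R. int x - int (card {y\<in>- R. y < x}))"
  proof -
    have "int (card {r\<in>R. r < x}) = int x - int (card {y\<in>- R. y < x})" for x
      using card_below[of R x] by linarith
    then show ?thesis by simp
  qed
  also have "\<dots> = (\<Sum>x\<in>- R. int x) - int (\<Sum>i<g. i)"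
    unfolding g_def sum_card_below[OF G', symmetric] by (simp add: sum_subtractf)
  finally have L: "local_index l V = (\<Sum>x\<in>- R. int x) - int (\<Sum>i<g. i)" .
  have "(\<Sum>i<N. int (lorder (- R) i) - int g) = (\<Sum>i<g. int (lorder (- R) i) - int g)"
    by (rule sum.mono_neutral_right)
      (use N sgap_0[OF G'] in \<open>auto simp: lorder_def g_def num_gaps_def R_def not_less\<close>)
  also have "\<dots> = (\<Sum>i<g. int (sgap (- R) i) + int i - int g)"
    by (rule sum.cong) (simp_all add: lorder_def g_def)
  also have "\<dots> = int (\<Sum>i<g. sgap (- R) i) + int (\<Sum>i<g. i) - int g * int g"
    by (simp add: sum.distrib sum_subtractf)
  also have "(\<Sum>i<g. sgap (- R) i) = (\<Sum>x\<in>- R. Suc x)" unfolding g_def by (rule sum_sgap[OF G'])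
  also have "int (\<Sum>x\<in>- R. Suc x) = (\<Sum>x\<in>- R. int x) + int g"
    by (simp add: sum.distrib g_def)
  finally have 2: "(\<Sum>i<N. int (lorder (- R) i) - int g) = (\<Sum>x\<in>- R. int x) + int g + int (\<Sum>i<g. i) - int g * int g" .
  have "2 * int (\<Sum>i<g. i) = int g * int g - int g"
    by (induction g) (auto simp: algebra_simps)
  then show ?thesis using L 2 by (simp add: R_def g_def num_gaps_def)
qed

lemma degree_eq_sum_order:
  fixes p :: "complex poly"
  assumes "p \<noteq> 0" "finite S" "\<And>l. l \<notin> S \<Longrightarrow> order l p = 0"
  shows "degree p = (\<Sum>l\<in>S. order l p)"
proof -
  have "degree p = degree (smult (lead_coeff p) (\<Prod>z | poly p z = 0. [:- z, 1:] ^ order z p))"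
    by (simp only: complex_poly_decompose)
  also have "\<dots> = degree (\<Prod>z | poly p z = 0. [:- z, 1:] ^ order z p)"
    using assms(1) by (simp only: degree_smult_eq leading_coeff_0_iff if_False)
  also have "\<dots> = (\<Sum>z | poly p z = 0. order z p)"
    by (subst degree_prod_eq_sum_degree) (simp_all add: degree_linear_power)
  also have "\<dots> = (\<Sum>l\<in>S. order l p)"
    by (rule sum.mono_neutral_left) (use assms in \<open>auto simp: order_root\<close>)
  finally show ?thesis .
qed

section \<open>The index formula\<close>

text \<open>Similarity preserves the size, so a class determines its index; this identifies the size
  hidden in \<open>beta_graph\<close> with the given one.\<close>

lemma cm_class_dim:
  assumes "c \<in> calogero_moser m" "(X, Y) \<in> c"
  shows "X \<in> carrier_mat m m \<and> Y \<in> carrier_mat m m"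
proof -
  obtain X0 Y0 P Q where *: "(X0, Y0) \<in> cm_pairs m" "similar_mat_wit X X0 P Q" "similar_mat_wit Y Y0 P Q"
    using assms unfolding calogero_moser_def quotient_def conj_rel_def by auto
  have 0: "X0 \<in> carrier_mat m m" "Y0 \<in> carrier_mat m m" using *(1) by (auto simp: cm_pairs_def)
  have carrier: "A \<in> carrier_mat m m" if "similar_mat_wit A B P Q" "B \<in> carrier_mat m m" for A B :: "complex mat"
  proof -
    have "A \<in> carrier_mat (dim_row A) (dim_row A)" "B \<in> carrier_mat (dim_row A) (dim_row A)"
      using that(1) unfolding similar_mat_wit_def Let_def by blast+
    then show ?thesis using that(2) by (metis carrier_matD(1))
  qed
  show ?thesis using carrier[OF *(2) 0(1)] carrier[OF *(3) 0(2)] ..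
qed

lemma stabilizer_lead_poly: "f \<in> lead (stabilizer V) i \<Longrightarrow> f \<in> range to_fract"
  by (auto simp: lead_def stabilizer_def weyl_iff)

lemma stabilizer_lead_neg: "i < 0 \<Longrightarrow> f \<in> lead (stabilizer V) i \<Longrightarrow> f = 0"
  by (auto simp: lead_def stabilizer_def weyl_iff)

lemma vanishing_orders_UNIV: "vanishing_orders l UNIV = UNIV"
proof -
  have "r \<in> vanishing_orders l UNIV" for r
  proof -
    have "[:- l, 1:] ^ r \<noteq> 0" by (rule power_not_zero) simp
    then show ?thesis unfolding vanishing_orders_def using order_power_n_n[of l r] by blast
  qed
  then show ?thesis by blast
qed

lemma order_poly_unit:
  fixes h :: "complex poly"
  shows "h \<noteq> 0 \<Longrightarrow> degree h = 0 \<Longrightarrow> order l h = 0"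
  using order_degree[of h l] by simp

context cm_data
begin

lemma index_formula:
  fixes V :: "complex \<Rightarrow> complex poly set"
  assumes V: "\<And>l. primary l (V l)" and fin: "finite {l. V l \<noteq> UNIV}"
    and iso: "iso_class M = alpha (adelic_point V)"
  shows "int n = (\<Sum>l | V l \<noteq> UNIV. local_index l (V l))"
proof -
  define d where "d = (\<Prod>l | V l \<noteq> UNIV. to_fract [:- l, 1:] ^ codim (V l))"
  define I where "I = {P \<in> diffops. \<forall>p. act P (to_fract p) \<in> adelic_point V}"
  have d: "d \<noteq> 0" "I = (\<lambda>Q. pfun (inverse d) * Q) ` stabilizer V"
    using alpha_ideal_eq[OF fin] by (auto simp: d_def I_def)
  have IM: "right_weyl_iso I M" using iso_class_eqD[OF M_module] iso by (simp add: alpha_def I_def)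
  obtain Q0 where Q0: "Q0 \<in> stabilizer V" "Q0 \<noteq> 0"
  proof -
    obtain f where f: "to_fract f \<in> lead (stabilizer V) (int 0)" "f \<noteq> 0" using stabilizer_lead_exists[OF V fin] by blast
    then obtain Q where "Q \<in> stabilizer V" "to_fract f = pcoeff Q (int 0)" by (auto simp: lead_def)
    then show ?thesis using that f(2) by (metis pcoeff_0 to_fract_eq_0_iff)
  qed
  have "0 \<in> stabilizer V"
  proof -
    have "0 \<in> V l" for l using V cpoly.subspace_0 by (auto simp: primary_def)
    then have "(0::ratfun) \<in> to_fract ` (\<Inter>l. V l)" by (intro image_eqI[of _ _ 0]) auto
    then show ?thesis by (simp add: stabilizer_def act_def)
  qed
  then have I0: "0 \<in> I" unfolding d(2) by (intro image_eqI[of _ _ 0]) auto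
  have I1: "pfun (inverse d) * Q0 \<in> I" "pfun (inverse d) * Q0 \<noteq> 0" using Q0 d by auto
  have I2: "pfun d * x \<in> weyl" if "x \<in> I" for x
    using that d by (auto simp: mult.assoc[symmetric] pfun_mult[symmetric] stabilizer_def)
  have "pfun d \<noteq> 0" using d(1) by simp
  from right_weyl_iso_left_mult[OF IM this I2 I0 I1]
  obtain q0 where q0: "q0 \<noteq> 0" "M = (\<lambda>x. q0 * x) ` I" by blast
  \<comment> \<open>Absorbing the denominator makes \<open>M\<close> a left multiple of
    \<open>stabilizer V\<close>, whose leading ideals consist of polynomials as well.\<close>
  define q where "q = q0 * pfun (inverse d)"
  have q: "q \<noteq> 0" "M = (\<lambda>x. q * x) ` stabilizer V"
    using q0 d by (auto simp: q_def image_image mult.assoc)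
  obtain o' where o': "ordle q o'" "pcoeff q o' \<noteq> 0" using top_ex q(1) by blast
  define c where "c = pcoeff q o'"
  have c0: "c \<noteq> 0" using o' by (simp add: c_def)
  have lead: "lead M (o' + i) = (\<lambda>f. c * f) ` lead (stabilizer V) i" for i
    using lead_left_mult[OF o'] q(2) by (simp add: c_def)
  \<comment> \<open>On both sides nonzero top coefficients occur in order 0 and in no negative
    order, so there is no shift.\<close>
  have "o' = 0"
  proof (rule antisym)
    have "to_fract dY \<in> lead M (o' + (- o'))" using dY_lead[of 0] by simp
    then obtain f where "f \<in> lead (stabilizer V) (- o')" "to_fract dY = c * f" unfolding lead by blast
    then have "\<not> - o' < 0" using stabilizer_lead_neg[of "- o'" f V] shift_det_nonzero[OF Y] by auto
    then show "o' \<le> 0" by simp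
    obtain f where f: "to_fract f \<in> lead (stabilizer V) (int 0)" "f \<noteq> 0" using stabilizer_lead_exists[OF V fin] by blast
    then have "c * to_fract f \<in> lead M (o' + 0)" unfolding lead by (intro imageI) simp
    then have "\<not> o' < 0" using lead_M_neg[of o' "c * to_fract f"] c0 f(2) by auto
    then show "0 \<le> o'" by simp
  qed
  then have lead0: "lead M (int i) = (\<lambda>f. c * f) ` lead (stabilizer V) (int i)" for i using lead[of "int i"] by simp
  obtain h N0 where h: "\<And>i. h i \<noteq> 0" "\<And>i p. to_fract p \<in> lead M (int i) \<longleftrightarrow> h i dvd p"
    and N0: "\<And>i. i \<ge> N0 \<Longrightarrow> degree (h i) = 0"
    and tot: "\<And>N. \<forall>i\<ge>N. degree (h i) = 0 \<Longrightarrow> (\<Sum>i<N. degree (h i)) = n"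
    using lead_M_colength by (elim exE conjE) blast
  have "\<exists>f. to_fract f \<in> lead (stabilizer V) (int i) \<and> to_fract (h i) = c * to_fract f" for i
  proof -
    have "to_fract (h i) \<in> lead M (int i)" using h(2) by simp
    then obtain g where "g \<in> lead (stabilizer V) (int i)" "to_fract (h i) = c * g" unfolding lead0 by blast
    then show ?thesis using stabilizer_lead_poly by blast
  qed
  then have "\<forall>i. \<exists>f. to_fract f \<in> lead (stabilizer V) (int i) \<and> to_fract (h i) = c * to_fract f" ..
  from choice[OF this] obtain f where f: "\<And>i. to_fract (f i) \<in> lead (stabilizer V) (int i)"
    "\<And>i. to_fract (h i) = c * to_fract (f i)" by blast
  have f0: "f i \<noteq> 0" for i using f(2)[of i] h(1)[of i] by auto
  let ?G = "\<lambda>l. - vanishing_orders l (V l)"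
  have order_f: "order l (f i) = lorder (?G l) i" for l i
  proof (rule antisym)
    show "lorder (?G l) i \<le> order l (f i)"
      using stabilizer_lead_divisible[OF V f(1)] f0 order_divides by blast
    obtain p where p: "to_fract p \<in> lead (stabilizer V) (int i)" "p \<noteq> 0" "order l p = lorder (?G l) i"
      using stabilizer_lead_exists[OF V fin] by blast
    then have cp: "c * to_fract p \<in> lead M (int i)" unfolding lead0 by (intro imageI)
    then obtain r where r: "c * to_fract p = to_fract r" using lead_M_poly by blast
    then have "h i dvd r" using cp h(2) by simp
    then obtain x where "r = h i * x" by (rule dvdE)
    then have "c * to_fract p = c * to_fract (f i * x)" using r f(2)[of i] by (simp add: mult.assoc)
    then have px: "p = f i * x" using c0 by (simp del: to_fract_mult)
    then show "order l (f i) \<le> lorder (?G l) i"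
      using p(2,3) order_mult[of "f i" x l] by auto
  qed
  \<comment> \<open>Comparison with an index k in the stable range removes the unknown factor
    \<open>c\<close>: \<open>h i / h k = f i / f k\<close>, where \<open>h k\<close> is a unit and
    \<open>f k\<close> has the number of gaps as its order at \<open>l\<close>.\<close>
  have order_h: "order l (h i) + num_gaps l (V l) = lorder (?G l) i" for l i
  proof -
    define k where "k = max N0 (num_gaps l (V l))"
    have k: "lorder (?G l) k = num_gaps l (V l)"
      using sgap_0[OF primary_gaps[OF V], of l k] by (simp add: lorder_def k_def num_gaps_def)
    have "to_fract (h i * f k) = to_fract (f i * h k)" using f(2)[of i] f(2)[of k] by simp
    then have e: "h i * f k = f i * h k" by (simp del: to_fract_mult)
    have "order l (h i) + order l (f k) = order l (f i) + order l (h k)"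
      using arg_cong[OF e, of "order l"] h(1) f0 by (simp add: order_mult)
    moreover have "order l (h k) = 0" using N0[of k] by (intro order_poly_unit h) (simp add: k_def)
    ultimately show ?thesis by (simp add: order_f k)
  qed
  let ?S = "{l. V l \<noteq> UNIV}"
  have UNIV0: "order l (h i) = 0" if "l \<notin> ?S" for l i
  proof -
    have "V l = UNIV" using that by simp
    then have "?G l = {}" by (simp add: vanishing_orders_UNIV)
    then show ?thesis using order_h[of l i] by (simp add: lorder_def sgap_0 num_gaps_def)
  qed
  \<comment> \<open>Large enough for the degrees to vanish from \<open>N\<close> on and for every
    local sum to be complete.\<close>
  define N where "N = N0 + (\<Sum>l\<in>?S. num_gaps l (V l))"
  have "n = (\<Sum>i<N. degree (h i))" using tot[of N] N0 by (simp add: N_def)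
  also have "\<dots> = (\<Sum>i<N. \<Sum>l\<in>?S. order l (h i))"
    by (rule sum.cong) (use h UNIV0 fin in \<open>auto intro!: degree_eq_sum_order\<close>)
  finally have "int n = (\<Sum>i<N. \<Sum>l\<in>?S. int (order l (h i)))" by simp
  also have "\<dots> = (\<Sum>l\<in>?S. \<Sum>i<N. int (order l (h i)))" by (rule sum.swap)
  also have "\<dots> = (\<Sum>l\<in>?S. local_index l (V l))"
  proof (rule sum.cong[OF refl])
    fix l assume l: "l \<in> ?S"
    have "num_gaps l (V l) \<le> (\<Sum>l\<in>?S. num_gaps l (V l))" using fin l by (intro member_le_sum) auto
    then have "num_gaps l (V l) \<le> N" by (simp add: N_def)
    moreover have "int (order l (h i)) = int (lorder (?G l) i) - int (num_gaps l (V l))" for i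
      using order_h[of l i] by linarith
    ultimately show "(\<Sum>i<N. int (order l (h i))) = local_index l (V l)"
      using local_index_eq_lorder[OF primary_gaps[OF V]] by simp
  qed
  finally show ?thesis .
qed

end

lemma vanishing_seq_eventually:
  assumes G: "finite (- vanishing_orders l V)"
  shows "\<exists>i0. \<forall>i\<ge>i0. vanishing_seq l V i = num_gaps l V + i"
proof (intro exI allI impI)
  let ?R = "vanishing_orders l V"
  fix i assume i: "Suc (Max (insert 0 (- ?R))) \<le> i"
  have "i \<le> enumerate ?R i" by (rule le_enumerate[OF cofinite_infinite[OF G]])
  moreover have "y \<le> Max (insert 0 (- ?R))" if "y \<in> - ?R" for y using G that by (intro Max_ge) auto
  ultimately have e: "{y\<in>- ?R. enumerate ?R i < y} = {}" using i by force
  show "vanishing_seq l V i = num_gaps l V + i"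
    using enumerate_gap_count[OF G, of i] unfolding e by (simp add: vanishing_seq_def num_gaps_def)
qed

lemma local_index_UNIV: "local_index l UNIV = 0"
proof -
  have e: "- vanishing_orders l UNIV = {}" by (simp add: vanishing_orders_UNIV)
  then show ?thesis using local_index_eq_lorder[of l UNIV 0] by (simp add: num_gaps_def)
qed

text \<open>The clauses on gaps guarantee that \<open>card\<close>, \<open>enumerate\<close> and the
  restricted sum in \<open>local_index\<close> compute the intended quantities and not default
  values.\<close>

theorem mainTheorem2:
  fixes V :: "complex \<Rightarrow> complex poly set" and n :: nat
    and c :: "(complex mat \<times> complex mat) set"
  assumes "\<And>l. primary l (V l)"
    and "finite {l. V l \<noteq> UNIV}"
    and "c \<in> calogero_moser n"
    and "(c, adelic_point V) \<in> beta_graph"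
  shows "(\<forall>l. finite (- vanishing_orders l (V l))
            \<and> (\<exists>i0. \<forall>i\<ge>i0. vanishing_seq l (V l) i = num_gaps l (V l) + i)
            \<and> (V l = UNIV \<longrightarrow> local_index l (V l) = 0))
       \<and> int n = (\<Sum>l | V l \<noteq> UNIV. local_index l (V l))"
proof -
  obtain m X Y v w where m: "c \<in> calogero_moser m" and XY: "(X, Y) \<in> c"
    and vw: "v \<in> carrier_mat m 1" "w \<in> carrier_mat 1 m" "X * Y - Y * X + 1\<^sub>m m = v * w"
    and iso: "iso_class (cm_ideal X Y v w) = alpha (adelic_point V)"
    using assms(4) unfolding beta_graph_def by blast
  have "m = n" using cm_class_dim[OF m XY] cm_class_dim[OF assms(3) XY] by auto
  then interpret cm_data n X Y v w
    using cm_class_dim[OF assms(3) XY] vw by unfold_locales auto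
  have "int n = (\<Sum>l | V l \<noteq> UNIV. local_index l (V l))"
    using assms(1,2) iso by (rule index_formula)
  moreover have "finite (- vanishing_orders l (V l))" for l using assms(1) by (rule primary_gaps)
  ultimately show ?thesis using vanishing_seq_eventually local_index_UNIV by simp
qed

end
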